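(* Let $\mathcal{V}$ be a monoidal model category with a measure $|-|:\mathcal{W}\to k$, and suppose that the category of small $\mathcal{V}$-categories admits the canonical model structure. Let $\chi$ denote the induced Euler characteristic of $\mathcal{V}$-categories. (1) Let $f:\mathcal{A}\to\mathcal{B}$ be a $\mathcal{V}$-functor between finite measurable $\mathcal{V}$-categories that is a weak equivalence (i.e. a DK-equivalence). If $\mathcal{A}$ or $\mathcal{B}$ admits Euler characteristic, then so does the other, and $\chi(\mathcal{A})=\chi(\mathcal{B})$. (2) Suppose moreover that the measure preserves fibrations and that $\mathcal{V}$ satisfies conditions (V1)-(V3) and (W1)-(W3) listed in the context. Let $p:\mathcal{E}\to\mathcal{B}$ be a naive fibration between fibrant $\mathcal{V}$-categories such that $\mathcal{E}$, $\mathcal{B}$ and every fiber of $p$ admit Euler characteristic, $\pi_0\mathcal{E}$ and $\pi_0\mathcal{B}$ are groupoids, and $\mathcal{B}$ is connected. Then $\chi(\mathcal{E})=\chi(\mathcal{B})\,\chi(\mathcal{F})$, where $\mathcal{F}$ is the fiber of $p$ over an object of $\mathcal{B}$.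
   Context: Basics. $(\mathcal{V},\otimes,\mathbf 1)$ is a monoidal model category (in the sense of Hovey); $\mathrm{Ho}(\mathcal{V})$ is its homotopy category (same objects as $\mathcal V$) with the induced monoidal structure. A $\mathcal{V}$-category $\mathcal{A}$ has a set of objects $\mathcal{A}_0$, hom-objects $\mathcal{A}(a,b)\in\mathcal{V}$, compositions $\mathcal{A}(b,c)\otimes\mathcal{A}(a,b)\to\mathcal{A}(a,c)$ and identities $1_a:\mathbf 1\to\mathcal{A}(a,a)$; it is finite if $\mathcal{A}_0$ is finite. For $X\in\mathcal{V}$, $\pi_0X=\mathrm{Ho}(\mathcal{V})(\mathbf 1,X)$. The category $\pi_0\mathcal{A}$ has object set $\mathcal{A}_0$ and $(\pi_0\mathcal{A})(a,b)=\pi_0(\mathcal{A}(a,b))$. An object $X$ of $\mathcal V$ is connected if $\pi_0X$ is a single point. A $\mathcal{V}$-category $\mathcal{A}$ is connected if any two objects of the category $\pi_0\mathcal{A}$ are joined by a zigzag of morphisms. Measure and Euler characteristic. Let $\mathcal{W}$ be a full subcategory of $\mathrm{Ho}(\mathcal{V})$ closed under finite coproducts and direct summands, and $k$ a ring. A measure is a monoid homomorphism $|-|:(\mathcal{W}_0/\cong,\otimes,\mathbf 1)\to(k,\cdot,1)$ on isomorphism classes of objects of $\mathcal W$ which preserves tensor products and finite coproducts ($|X\otimes Y|=|X||Y|$, $|\mathbf 1|=1$, $|X\amalg Y|=|X|+|Y|$). A $\mathcal{V}$-category $\mathcal{A}$ is measurable if all $\mathcal{A}(a,b)$ belong to $\mathcal{W}$.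 For $\mathcal{A}$ finite measurable, put $\xi(a,b)=|\mathcal{A}(a,b)|$. A weighting is $w:\mathcal{A}_0\to k$ with $\sum_b\xi(a,b)w(b)=1$ for all $a$; a coweighting is $v:\mathcal{A}_0\to k$ with $\sum_a v(a)\xi(a,b)=1$ for all $b$. $\mathcal{A}$ admits Euler characteristic if it is finite, measurable and has both a weighting $w$ and a coweighting $v$; then $\chi(\mathcal{A})=\sum_a w(a)=\sum_a v(a)$ (independent of choices). DK-equivalences, naive fibrations, canonical model structure. A $\mathcal{V}$-functor $f:\mathcal{A}\to\mathcal{B}$ is a DK-equivalence if each $\mathcal{A}(x,y)\to\mathcal{B}(fx,fy)$ is a weak equivalence in $\mathcal{V}$ and $\pi_0f$ is an equivalence of categories. A $\mathcal{V}$-functor $p:\mathcal{A}\to\mathcal{B}$ is a naive fibration if each $\mathcal{A}(x,y)\to\mathcal{B}(px,py)$ is a fibration in $\mathcal{V}$ and $\pi_0p$ is an isofibration (every isomorphism $p(e)\to b$ lifts to an isomorphism $e\to e'$). A model structure on small $\mathcal{V}$-categories is canonical if: (i) $\mathcal{A}$ is fibrant iff all $\mathcal{A}(a,b)$ are fibrant in $\mathcal{V}$; (ii) $f:\mathcal A\to\mathcal B$ is a trivial fibration iff it is surjective on objects and each $\mathcal{A}(a,b)\to\mathcal{B}(fa,fb)$ is a trivial fibration in $\mathcal V$; (iii) the weak equivalences are the DK-equivalences; (iv) the fibrations between fibrant objects are the naive fibrations. Fibers. The fiber of $p:E\to B$ in $\mathcal{V}$ over $b:\mathbf 1\to B$ is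 the pullback of $p$ along $b$. The fiber $\mathcal{F}_b$ of a $\mathcal{V}$-functor $p:\mathcal{E}\to\mathcal{B}$ over an object $b$ is the $\mathcal{V}$-category with objects $p^{-1}(b)$ and $\mathcal{F}_b(x,y)$ the fiber of $\mathcal{E}(x,y)\to\mathcal{B}(b,b)$ over $1_b:\mathbf 1\to\mathcal{B}(b,b)$. A measure preserves fibrations if for every fibration $p:E\to B$ in $\mathcal{V}$ such that $E$, $B$ and every fiber belong to $\mathcal{W}$ and $B$ is a finite coproduct $\coprod_i B_i$ of connected objects, $|E|=\sum_i|B_i|\cdot|F_i|$, where $F_i$ is the fiber of $p$ over a morphism $\mathbf 1\to B_i$. Conditions. (V1) $\mathcal{V}$ is cartesian ($\otimes$ is the categorical product, $\mathbf 1$ is terminal) and $\mathbf 1$ is cofibrant. (V2) $\pi_0(X)$ is empty iff $X$ is the initial object. (V3) The category of small $\mathcal{V}$-categories admits the canonical model structure. (W1) $\left(\coprod_iX_i\right)\otimes\left(\coprod_jY_j\right)$ is naturally isomorphic to $\coprod_{i,j}(X_i\otimes Y_j)$. (W2) Every object $X$ of $\mathcal{W}$ has finite $\pi_0X$. (W3) Every object $X$ of $\mathcal{W}$ is a finite coproduct $X=\coprod_{i\in\pi_0X}X_i$ of connected objects, and $X_i$ is the pullback of the canonical morphism $X=\coprod_iX_i\to\coprod_i\mathbf 1$ along the $i$-th inclusion $\mathbf 1\to\coprod_i\mathbf 1$.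
   Formalization: In (W3), X_i is additionally assumed to lie in W, to have its point sent to i, and to contain every morphism 1→X of V that represents i; otherwise a morphism 1→B_i, over which the fiber F_i is taken, need not exist. *)

theory Defs
  imports Main "HOL-Library.Equipollence"
begin

section \<open>Categories\<close>

record ('o, 'm) cat =
  Obj :: "'o set"
  Arr :: "'m set"
  Dom :: "'m \<Rightarrow> 'o"
  Cod :: "'m \<Rightarrow> 'o"
  Cmp :: "'m \<Rightarrow> 'm \<Rightarrow> 'm"  (infixl "\<cdot>\<index>" 60)
  Ide :: "'o \<Rightarrow> 'm"

definition hom :: "('o, 'm, 'z) cat_scheme \<Rightarrow> 'o \<Rightarrow> 'o \<Rightarrow> 'm set" where
  "hom C a b = {f \<in> Arr C. Dom C f = a \<and> Cod C f = b}"

locale category =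
  fixes C :: "('o, 'm, 'z) cat_scheme" (structure)
  assumes Dom_in: "f \<in> Arr C \<Longrightarrow> Dom C f \<in> Obj C"
    and Cod_in: "f \<in> Arr C \<Longrightarrow> Cod C f \<in> Obj C"
    and Ide_in: "a \<in> Obj C \<Longrightarrow> Ide C a \<in> hom C a a"
    and Cmp_in: "f \<in> hom C a b \<Longrightarrow> g \<in> hom C b c \<Longrightarrow> g \<cdot> f \<in> hom C a c"
    and Cmp_Ide: "f \<in> hom C a b \<Longrightarrow> f \<cdot> Ide C a = f"
    and Ide_Cmp: "f \<in> hom C a b \<Longrightarrow> Ide C b \<cdot> f = f"
    and Cmp_assoc: "f \<in> hom C a b \<Longrightarrow> g \<in> hom C b c \<Longrightarrow> h \<in> hom C c d \<Longrightarrow>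
          h \<cdot> (g \<cdot> f) = (h \<cdot> g) \<cdot> f"

definition op_cat :: "('o, 'm, 'z) cat_scheme \<Rightarrow> ('o, 'm) cat" where
  "op_cat C = \<lparr>Obj = Obj C, Arr = Arr C, Dom = Cod C, Cod = Dom C,
     Cmp = (\<lambda>g f. f \<cdot>\<^bsub>C\<^esub> g), Ide = Ide C\<rparr>"

definition iso_arr :: "('o, 'm, 'z) cat_scheme \<Rightarrow> 'm \<Rightarrow> bool" where
  "iso_arr C f \<longleftrightarrow> f \<in> Arr C \<and>
     (\<exists>g \<in> hom C (Cod C f) (Dom C f).
        g \<cdot>\<^bsub>C\<^esub> f = Ide C (Dom C f) \<and> f \<cdot>\<^bsub>C\<^esub> g = Ide C (Cod C f))"

definition isomorphic :: "('o, 'm, 'z) cat_scheme \<Rightarrow> 'o \<Rightarrow> 'o \<Rightarrow> bool" where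
  "isomorphic C a b \<longleftrightarrow> (\<exists>f \<in> hom C a b. iso_arr C f)"

definition is_groupoid :: "('o, 'm, 'z) cat_scheme \<Rightarrow> bool" where
  "is_groupoid C \<longleftrightarrow> category C \<and> (\<forall>f \<in> Arr C. iso_arr C f)"

text \<open>Any two objects are joined by a zigzag of arrows.\<close>

definition zigzag_connected :: "('o, 'm, 'z) cat_scheme \<Rightarrow> bool" where
  "zigzag_connected C \<longleftrightarrow> (\<forall>a \<in> Obj C. \<forall>b \<in> Obj C.
     (a, b) \<in> {(x, y). hom C x y \<noteq> {} \<or> hom C y x \<noteq> {}}\<^sup>*)"

subsection \<open>Functors and equivalences\<close>

definition is_functor ::
  "('a, 'f, 'y) cat_scheme \<Rightarrow> ('b, 'g, 'z) cat_scheme \<Rightarrow> ('a \<Rightarrow> 'b) \<Rightarrow> ('f \<Rightarrow> 'g) \<Rightarrow> bool" where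
  "is_functor C D Fo Fa \<longleftrightarrow>
     (\<forall>a \<in> Obj C. Fo a \<in> Obj D \<and> Fa (Ide C a) = Ide D (Fo a)) \<and>
     (\<forall>a b. \<forall>f \<in> hom C a b. Fa f \<in> hom D (Fo a) (Fo b)) \<and>
     (\<forall>a b c. \<forall>f \<in> hom C a b. \<forall>g \<in> hom C b c. Fa (g \<cdot>\<^bsub>C\<^esub> f) = Fa g \<cdot>\<^bsub>D\<^esub> Fa f)"

definition is_nat_iso ::
  "('a, 'f, 'y) cat_scheme \<Rightarrow> ('b, 'g, 'z) cat_scheme \<Rightarrow>
   ('a \<Rightarrow> 'b) \<Rightarrow> ('f \<Rightarrow> 'g) \<Rightarrow> ('a \<Rightarrow> 'b) \<Rightarrow> ('f \<Rightarrow> 'g) \<Rightarrow> ('a \<Rightarrow> 'g) \<Rightarrow> bool" where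
  "is_nat_iso C D Fo Fa Go Ga t \<longleftrightarrow>
     (\<forall>a \<in> Obj C. t a \<in> hom D (Fo a) (Go a) \<and> iso_arr D (t a)) \<and>
     (\<forall>a b. \<forall>f \<in> hom C a b. t b \<cdot>\<^bsub>D\<^esub> Fa f = Ga f \<cdot>\<^bsub>D\<^esub> t a)"

definition is_equivalence ::
  "('a, 'f, 'y) cat_scheme \<Rightarrow> ('b, 'g, 'z) cat_scheme \<Rightarrow> ('a \<Rightarrow> 'b) \<Rightarrow> ('f \<Rightarrow> 'g) \<Rightarrow> bool" where
  "is_equivalence C D Fo Fa \<longleftrightarrow> is_functor C D Fo Fa \<and>
     (\<exists>Go Ga s t. is_functor D C Go Ga \<and>
        is_nat_iso C C (\<lambda>a. a) (\<lambda>f. f) (Go \<circ> Fo) (Ga \<circ> Fa) s \<and>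
        is_nat_iso D D (Fo \<circ> Go) (Fa \<circ> Ga) (\<lambda>b. b) (\<lambda>g. g) t)"

definition is_isofibration ::
  "('a, 'f, 'y) cat_scheme \<Rightarrow> ('b, 'g, 'z) cat_scheme \<Rightarrow> ('a \<Rightarrow> 'b) \<Rightarrow> ('f \<Rightarrow> 'g) \<Rightarrow> bool" where
  "is_isofibration C D Fo Fa \<longleftrightarrow> is_functor C D Fo Fa \<and>
     (\<forall>e \<in> Obj C. \<forall>g \<in> Arr D. iso_arr D g \<and> Dom D g = Fo e \<longrightarrow>
        (\<exists>f \<in> Arr C. iso_arr C f \<and> Dom C f = e \<and> Fa f = g))"

subsection \<open>Limits and colimits\<close>

definition is_initial :: "('o, 'm, 'z) cat_scheme \<Rightarrow> 'o \<Rightarrow> bool" where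
  "is_initial C z \<longleftrightarrow> z \<in> Obj C \<and> (\<forall>x \<in> Obj C. \<exists>!f. f \<in> hom C z x)"

definition is_terminal :: "('o, 'm, 'z) cat_scheme \<Rightarrow> 'o \<Rightarrow> bool" where
  "is_terminal C t \<longleftrightarrow> t \<in> Obj C \<and> (\<forall>x \<in> Obj C. \<exists>!f. f \<in> hom C x t)"

definition is_product ::
  "('o, 'm, 'z) cat_scheme \<Rightarrow> 'o \<Rightarrow> 'o \<Rightarrow> 'o \<Rightarrow> 'm \<Rightarrow> 'm \<Rightarrow> bool" where
  "is_product C X Y P p q \<longleftrightarrow> p \<in> hom C P X \<and> q \<in> hom C P Y \<and>
     (\<forall>Z. \<forall>f \<in> hom C Z X. \<forall>g \<in> hom C Z Y.
        \<exists>!u. u \<in> hom C Z P \<and> p \<cdot>\<^bsub>C\<^esub> u = f \<and> q \<cdot>\<^bsub>C\<^esub> u = g)"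

text \<open>\<open>P\<close> with the injections \<open>inc i\<close> is a coproduct of the family \<open>X\<close> over \<open>I\<close>.\<close>

definition is_coproduct ::
  "('o, 'm, 'z) cat_scheme \<Rightarrow> 'i set \<Rightarrow> ('i \<Rightarrow> 'o) \<Rightarrow> 'o \<Rightarrow> ('i \<Rightarrow> 'm) \<Rightarrow> bool" where
  "is_coproduct C I X P inc \<longleftrightarrow> P \<in> Obj C \<and> (\<forall>i \<in> I. inc i \<in> hom C (X i) P) \<and>
     (\<forall>Y \<in> Obj C. \<forall>t. (\<forall>i \<in> I. t i \<in> hom C (X i) Y) \<longrightarrow>
        (\<exists>!u. u \<in> hom C P Y \<and> (\<forall>i \<in> I. u \<cdot>\<^bsub>C\<^esub> inc i = t i)))"

definition is_pullback ::
  "('o, 'm, 'z) cat_scheme \<Rightarrow> 'm \<Rightarrow> 'm \<Rightarrow> 'o \<Rightarrow> 'm \<Rightarrow> 'm \<Rightarrow> bool" where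
  "is_pullback C f g P p q \<longleftrightarrow> f \<in> Arr C \<and> g \<in> Arr C \<and> Cod C f = Cod C g \<and>
     p \<in> hom C P (Dom C f) \<and> q \<in> hom C P (Dom C g) \<and> f \<cdot>\<^bsub>C\<^esub> p = g \<cdot>\<^bsub>C\<^esub> q \<and>
     (\<forall>Z. \<forall>s \<in> hom C Z (Dom C f). \<forall>t \<in> hom C Z (Dom C g). f \<cdot>\<^bsub>C\<^esub> s = g \<cdot>\<^bsub>C\<^esub> t \<longrightarrow>
        (\<exists>!u. u \<in> hom C Z P \<and> p \<cdot>\<^bsub>C\<^esub> u = s \<and> q \<cdot>\<^bsub>C\<^esub> u = t))"

definition is_pushout ::
  "('o, 'm, 'z) cat_scheme \<Rightarrow> 'm \<Rightarrow> 'm \<Rightarrow> 'o \<Rightarrow> 'm \<Rightarrow> 'm \<Rightarrow> bool" where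
  "is_pushout C f g P i j \<longleftrightarrow> is_pullback (op_cat C) f g P i j"

definition is_cone ::
  "('a, 'f) cat \<Rightarrow> ('o, 'm, 'z) cat_scheme \<Rightarrow> ('a \<Rightarrow> 'o) \<Rightarrow> ('f \<Rightarrow> 'm) \<Rightarrow> 'o \<Rightarrow> ('a \<Rightarrow> 'm) \<Rightarrow> bool"
  where "is_cone J C Do Da L p \<longleftrightarrow> L \<in> Obj C \<and> (\<forall>j \<in> Obj J. p j \<in> hom C L (Do j)) \<and>
     (\<forall>f \<in> Arr J. Da f \<cdot>\<^bsub>C\<^esub> p (Dom J f) = p (Cod J f))"

definition is_limit ::
  "('a, 'f) cat \<Rightarrow> ('o, 'm, 'z) cat_scheme \<Rightarrow> ('a \<Rightarrow> 'o) \<Rightarrow> ('f \<Rightarrow> 'm) \<Rightarrow> 'o \<Rightarrow> ('a \<Rightarrow> 'm) \<Rightarrow> bool"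
  where "is_limit J C Do Da L p \<longleftrightarrow> is_cone J C Do Da L p \<and>
     (\<forall>X s. is_cone J C Do Da X s \<longrightarrow>
        (\<exists>!u. u \<in> hom C X L \<and> (\<forall>j \<in> Obj J. p j \<cdot>\<^bsub>C\<^esub> u = s j)))"

text \<open>The type \<open>'u\<close> plays the role of the universe of sets: a set is small if its cardinality is
  strictly smaller than that of \<open>'u\<close>.  Up to bijection, these are the elements of a Grothendieck
  universe when the cardinality of \<open>'u\<close> is strongly inaccessible, and the finite sets when
  \<open>'u\<close> is countable.\<close>

definition small :: "'u set \<Rightarrow> bool" where
  "small A \<longleftrightarrow> A \<prec> (UNIV :: 'u set)"

definition small_complete :: "'u itself \<Rightarrow> ('o, 'm, 'z) cat_scheme \<Rightarrow> bool" where
  "small_complete _ C \<longleftrightarrow> (\<forall>(J :: ('u, 'u) cat) Do Da.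
     category J \<and> small (Obj J) \<and> small (Arr J) \<and> is_functor J C Do Da \<longrightarrow>
     (\<exists>L p. is_limit J C Do Da L p))"

definition small_cocomplete :: "'u itself \<Rightarrow> ('o, 'm, 'z) cat_scheme \<Rightarrow> bool" where
  "small_cocomplete U C \<longleftrightarrow> small_complete U (op_cat C)"

section \<open>Model categories\<close>

text \<open>\<open>factL f\<close> and \<open>factR f\<close> are the two factors of \<open>f\<close>, and \<open>factM f g u v\<close> is the arrow between
  the middle objects induced by a square \<open>(u, v)\<close> from \<open>f\<close> to \<open>g\<close>.\<close>

record 'm factorization =
  factL :: "'m \<Rightarrow> 'm"
  factR :: "'m \<Rightarrow> 'm"
  factM :: "'m \<Rightarrow> 'm \<Rightarrow> 'm \<Rightarrow> 'm \<Rightarrow> 'm"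

definition is_square :: "('o, 'm, 'z) cat_scheme \<Rightarrow> 'm \<Rightarrow> 'm \<Rightarrow> 'm \<Rightarrow> 'm \<Rightarrow> bool" where
  "is_square C f g u v \<longleftrightarrow> f \<in> Arr C \<and> g \<in> Arr C \<and>
     u \<in> hom C (Dom C f) (Dom C g) \<and> v \<in> hom C (Cod C f) (Cod C g) \<and> g \<cdot>\<^bsub>C\<^esub> u = v \<cdot>\<^bsub>C\<^esub> f"

definition functorial_factorization ::
  "('o, 'm, 'z) cat_scheme \<Rightarrow> 'm factorization \<Rightarrow> bool" where
  "functorial_factorization C F \<longleftrightarrow>
     (\<forall>f \<in> Arr C. factL F f \<in> Arr C \<and> factR F f \<in> Arr C \<and>
        Dom C (factL F f) = Dom C f \<and> Cod C (factL F f) = Dom C (factR F f) \<and>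
        Cod C (factR F f) = Cod C f \<and> factR F f \<cdot>\<^bsub>C\<^esub> factL F f = f) \<and>
     (\<forall>f g u v. is_square C f g u v \<longrightarrow>
        factM F f g u v \<in> hom C (Cod C (factL F f)) (Cod C (factL F g)) \<and>
        factM F f g u v \<cdot>\<^bsub>C\<^esub> factL F f = factL F g \<cdot>\<^bsub>C\<^esub> u \<and>
        factR F g \<cdot>\<^bsub>C\<^esub> factM F f g u v = v \<cdot>\<^bsub>C\<^esub> factR F f) \<and>
     (\<forall>f \<in> Arr C. factM F f f (Ide C (Dom C f)) (Ide C (Cod C f)) = Ide C (Cod C (factL F f))) \<and>
     (\<forall>f g h u v u' v'. is_square C f g u v \<and> is_square C g h u' v' \<longrightarrow>
        factM F f h (u' \<cdot>\<^bsub>C\<^esub> u) (v' \<cdot>\<^bsub>C\<^esub> v) = factM F g h u' v' \<cdot>\<^bsub>C\<^esub> factM F f g u v)"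

record 'm model =
  Weq :: "'m set"
  Cof :: "'m set"
  Fib :: "'m set"
  cof_tfib :: "'m factorization"
  tcof_fib :: "'m factorization"

definition wide_subcategory :: "('o, 'm, 'z) cat_scheme \<Rightarrow> 'm set \<Rightarrow> bool" where
  "wide_subcategory C S \<longleftrightarrow> S \<subseteq> Arr C \<and> (\<forall>a \<in> Obj C. Ide C a \<in> S) \<and>
     (\<forall>f \<in> S. \<forall>g \<in> S. Cod C f = Dom C g \<longrightarrow> g \<cdot>\<^bsub>C\<^esub> f \<in> S)"

definition is_retract :: "('o, 'm, 'z) cat_scheme \<Rightarrow> 'm \<Rightarrow> 'm \<Rightarrow> bool" where
  "is_retract C f g \<longleftrightarrow> (\<exists>i j r s. is_square C f g i j \<and> is_square C g f r s \<and>
     r \<cdot>\<^bsub>C\<^esub> i = Ide C (Dom C f) \<and> s \<cdot>\<^bsub>C\<^esub> j = Ide C (Cod C f))"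

definition has_lifting :: "('o, 'm, 'z) cat_scheme \<Rightarrow> 'm \<Rightarrow> 'm \<Rightarrow> bool" where
  "has_lifting C i p \<longleftrightarrow> (\<forall>u v. is_square C i p u v \<longrightarrow>
     (\<exists>h \<in> hom C (Cod C i) (Dom C p). h \<cdot>\<^bsub>C\<^esub> i = u \<and> p \<cdot>\<^bsub>C\<^esub> h = v))"

text \<open>A model structure in the sense of Hovey; the functorial factorizations are part of the data.\<close>

locale model_structure = category C
  for C :: "('o, 'm, 'z) cat_scheme" (structure) and M :: "'m model" +
  assumes Weq_sub: "wide_subcategory C (Weq M)"
    and Cof_sub: "wide_subcategory C (Cof M)"
    and Fib_sub: "wide_subcategory C (Fib M)"
    and two_of_three:
      "f \<in> hom C a b \<Longrightarrow> g \<in> hom C b c \<Longrightarrow>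
         (f \<in> Weq M \<and> g \<cdot> f \<in> Weq M \<longrightarrow> g \<in> Weq M) \<and>
         (g \<in> Weq M \<and> g \<cdot> f \<in> Weq M \<longrightarrow> f \<in> Weq M)"
    and Weq_retract: "is_retract C f g \<Longrightarrow> g \<in> Weq M \<Longrightarrow> f \<in> Weq M"
    and Cof_retract: "is_retract C f g \<Longrightarrow> g \<in> Cof M \<Longrightarrow> f \<in> Cof M"
    and Fib_retract: "is_retract C f g \<Longrightarrow> g \<in> Fib M \<Longrightarrow> f \<in> Fib M"
    and lift_tcof: "i \<in> Cof M \<Longrightarrow> i \<in> Weq M \<Longrightarrow> p \<in> Fib M \<Longrightarrow> has_lifting C i p"
    and lift_tfib: "i \<in> Cof M \<Longrightarrow> p \<in> Fib M \<Longrightarrow> p \<in> Weq M \<Longrightarrow> has_lifting C i p"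
    and cof_tfib: "functorial_factorization C (cof_tfib M)"
    and cof_tfib_in: "f \<in> Arr C \<Longrightarrow> factL (cof_tfib M) f \<in> Cof M \<and>
          factR (cof_tfib M) f \<in> Fib M \<and> factR (cof_tfib M) f \<in> Weq M"
    and tcof_fib: "functorial_factorization C (tcof_fib M)"
    and tcof_fib_in: "f \<in> Arr C \<Longrightarrow> factL (tcof_fib M) f \<in> Cof M \<and>
          factL (tcof_fib M) f \<in> Weq M \<and> factR (tcof_fib M) f \<in> Fib M"

definition model_category ::
  "'u itself \<Rightarrow> ('o, 'm, 'z) cat_scheme \<Rightarrow> 'm model \<Rightarrow> bool" where
  "model_category U C M \<longleftrightarrow>
     model_structure C M \<and> small_complete U C \<and> small_cocomplete U C"

definition cofibrant :: "('o, 'm, 'z) cat_scheme \<Rightarrow> 'm model \<Rightarrow> 'o \<Rightarrow> bool" where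
  "cofibrant C M X \<longleftrightarrow> (\<exists>z. is_initial C z \<and> (\<exists>f \<in> hom C z X. f \<in> Cof M))"

definition fibrant :: "('o, 'm, 'z) cat_scheme \<Rightarrow> 'm model \<Rightarrow> 'o \<Rightarrow> bool" where
  "fibrant C M X \<longleftrightarrow> (\<exists>t. is_terminal C t \<and> (\<exists>f \<in> hom C X t. f \<in> Fib M))"

text \<open>Functorial cofibrant replacement: factor the arrow from the initial object to \<open>X\<close>.\<close>

definition from_initial :: "('o, 'm, 'z) cat_scheme \<Rightarrow> 'o \<Rightarrow> 'm" where
  "from_initial C X = (THE f. f \<in> hom C (SOME z. is_initial C z) X)"

definition cofrep :: "('o, 'm, 'z) cat_scheme \<Rightarrow> 'm model \<Rightarrow> 'o \<Rightarrow> 'o" where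
  "cofrep C M X = Dom C (factR (cof_tfib M) (from_initial C X))"

definition cofrep_map :: "('o, 'm, 'z) cat_scheme \<Rightarrow> 'm model \<Rightarrow> 'o \<Rightarrow> 'm" where
  "cofrep_map C M X = factR (cof_tfib M) (from_initial C X)"

definition cofrep_arr :: "('o, 'm, 'z) cat_scheme \<Rightarrow> 'm model \<Rightarrow> 'm \<Rightarrow> 'm" where
  "cofrep_arr C M f =
     factM (cof_tfib M) (from_initial C (Dom C f)) (from_initial C (Cod C f))
       (Ide C (SOME z. is_initial C z)) f"

section \<open>The homotopy category\<close>

text \<open>As in Hovey, the localization at a class \<open>S\<close> of arrows has strings of arrows and reversed
  arrows of \<open>S\<close> as arrows, modulo the evident relations.  A string is a list read from the source
  to the target.\<close>

datatype 'm zig = Fwd 'm | Bwd 'm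

inductive zigzag :: "('o, 'm, 'z) cat_scheme \<Rightarrow> 'm set \<Rightarrow> 'o \<Rightarrow> 'm zig list \<Rightarrow> 'o \<Rightarrow> bool"
  for C S where
  Nil: "X \<in> Obj C \<Longrightarrow> zigzag C S X [] X"
| Fwd: "f \<in> Arr C \<Longrightarrow> zigzag C S (Cod C f) p Y \<Longrightarrow> zigzag C S (Dom C f) (Fwd f # p) Y"
| Bwd: "w \<in> S \<Longrightarrow> zigzag C S (Dom C w) p Y \<Longrightarrow> zigzag C S (Cod C w) (Bwd w # p) Y"

inductive zig_rel :: "('o, 'm, 'z) cat_scheme \<Rightarrow> 'm set \<Rightarrow> 'm zig list \<Rightarrow> 'm zig list \<Rightarrow> bool"
  for C S where
  "a \<in> Obj C \<Longrightarrow> zig_rel C S [Fwd (Ide C a)] []"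
| "f \<in> hom C a b \<Longrightarrow> g \<in> hom C b c \<Longrightarrow> zig_rel C S [Fwd f, Fwd g] [Fwd (g \<cdot>\<^bsub>C\<^esub> f)]"
| "w \<in> S \<Longrightarrow> zig_rel C S [Fwd w, Bwd w] []"
| "w \<in> S \<Longrightarrow> zig_rel C S [Bwd w, Fwd w] []"

inductive zig_eq ::
  "('o, 'm, 'z) cat_scheme \<Rightarrow> 'm set \<Rightarrow> 'o \<Rightarrow> 'o \<Rightarrow> 'm zig list \<Rightarrow> 'm zig list \<Rightarrow> bool"
  for C S X Y where
  refl: "zigzag C S X p Y \<Longrightarrow> zig_eq C S X Y p p"
| sym: "zig_eq C S X Y p q \<Longrightarrow> zig_eq C S X Y q p"
| trans: "zig_eq C S X Y p q \<Longrightarrow> zig_eq C S X Y q r \<Longrightarrow> zig_eq C S X Y p r"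
| step: "zig_rel C S l r \<Longrightarrow> zigzag C S X (p @ l @ q) Y \<Longrightarrow> zigzag C S X (p @ r @ q) Y \<Longrightarrow>
    zig_eq C S X Y (p @ l @ q) (p @ r @ q)"

type_synonym ('o, 'm) loc_arr = "'o \<times> 'o \<times> 'm zig list set"

definition zig_class ::
  "('o, 'm, 'z) cat_scheme \<Rightarrow> 'm set \<Rightarrow> 'o \<Rightarrow> 'o \<Rightarrow> 'm zig list \<Rightarrow> ('o, 'm) loc_arr" where
  "zig_class C S X Y p = (X, Y, {q. zig_eq C S X Y p q})"

definition localization ::
  "('o, 'm, 'z) cat_scheme \<Rightarrow> 'm set \<Rightarrow> ('o, ('o, 'm) loc_arr) cat" where
  "localization C S = \<lparr>Obj = Obj C,
     Arr = {zig_class C S X Y p | X Y p. zigzag C S X p Y},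
     Dom = (\<lambda>(X, Y, P). X),
     Cod = (\<lambda>(X, Y, P). Y),
     Cmp = (\<lambda>(Y', Z, Q) (X, Y, P). (X, Z, {r. \<exists>p \<in> P. \<exists>q \<in> Q. zig_eq C S X Z (p @ q) r})),
     Ide = (\<lambda>X. zig_class C S X X [])\<rparr>"

definition Ho :: "('o, 'm, 'z) cat_scheme \<Rightarrow> 'm model \<Rightarrow> ('o, ('o, 'm) loc_arr) cat" where
  "Ho C M = localization C (Weq M)"

definition to_Ho :: "('o, 'm, 'z) cat_scheme \<Rightarrow> 'm model \<Rightarrow> 'm \<Rightarrow> ('o, 'm) loc_arr" where
  "to_Ho C M f = zig_class C (Weq M) (Dom C f) (Cod C f) [Fwd f]"

section \<open>Monoidal model categories\<close>

record ('o, 'm) moncat = "('o, 'm) cat" +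
  Ten :: "'o \<Rightarrow> 'o \<Rightarrow> 'o"  (infixl "\<otimes>\<index>" 70)
  TenA :: "'m \<Rightarrow> 'm \<Rightarrow> 'm"  (infixl "\<odot>\<index>" 70)
  Unit :: "'o"  ("\<one>\<index>")
  Assoc :: "'o \<Rightarrow> 'o \<Rightarrow> 'o \<Rightarrow> 'm"
  LUnit :: "'o \<Rightarrow> 'm"
  RUnit :: "'o \<Rightarrow> 'm"

locale monoidal_category = category V
  for V :: "('o, 'm) moncat" (structure) +
  assumes Unit_in: "\<one> \<in> Obj V"
    and Ten_in: "X \<in> Obj V \<Longrightarrow> Y \<in> Obj V \<Longrightarrow> X \<otimes> Y \<in> Obj V"
    and TenA_in: "f \<in> hom V X X' \<Longrightarrow> g \<in> hom V Y Y' \<Longrightarrow> f \<odot> g \<in> hom V (X \<otimes> Y) (X' \<otimes> Y')"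
    and TenA_Ide: "X \<in> Obj V \<Longrightarrow> Y \<in> Obj V \<Longrightarrow> Ide V X \<odot> Ide V Y = Ide V (X \<otimes> Y)"
    and TenA_Cmp: "f \<in> hom V X X' \<Longrightarrow> f' \<in> hom V X' X'' \<Longrightarrow> g \<in> hom V Y Y' \<Longrightarrow> g' \<in> hom V Y' Y'' \<Longrightarrow>
          (f' \<cdot> f) \<odot> (g' \<cdot> g) = (f' \<odot> g') \<cdot> (f \<odot> g)"
    and Assoc_in: "X \<in> Obj V \<Longrightarrow> Y \<in> Obj V \<Longrightarrow> Z \<in> Obj V \<Longrightarrow>
          Assoc V X Y Z \<in> hom V ((X \<otimes> Y) \<otimes> Z) (X \<otimes> (Y \<otimes> Z)) \<and> iso_arr V (Assoc V X Y Z)"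
    and Assoc_nat: "f \<in> hom V X X' \<Longrightarrow> g \<in> hom V Y Y' \<Longrightarrow> h \<in> hom V Z Z' \<Longrightarrow>
          Assoc V X' Y' Z' \<cdot> ((f \<odot> g) \<odot> h) = (f \<odot> (g \<odot> h)) \<cdot> Assoc V X Y Z"
    and LUnit_in: "X \<in> Obj V \<Longrightarrow> LUnit V X \<in> hom V (\<one> \<otimes> X) X \<and> iso_arr V (LUnit V X)"
    and LUnit_nat: "f \<in> hom V X X' \<Longrightarrow> LUnit V X' \<cdot> (Ide V \<one> \<odot> f) = f \<cdot> LUnit V X"
    and RUnit_in: "X \<in> Obj V \<Longrightarrow> RUnit V X \<in> hom V (X \<otimes> \<one>) X \<and> iso_arr V (RUnit V X)"
    and RUnit_nat: "f \<in> hom V X X' \<Longrightarrow> RUnit V X' \<cdot> (f \<odot> Ide V \<one>) = f \<cdot> RUnit V X"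
    and pentagon: "W \<in> Obj V \<Longrightarrow> X \<in> Obj V \<Longrightarrow> Y \<in> Obj V \<Longrightarrow> Z \<in> Obj V \<Longrightarrow>
          Assoc V W X (Y \<otimes> Z) \<cdot> Assoc V (W \<otimes> X) Y Z =
          (Ide V W \<odot> Assoc V X Y Z) \<cdot> Assoc V W (X \<otimes> Y) Z \<cdot> (Assoc V W X Y \<odot> Ide V Z)"
    and triangle: "X \<in> Obj V \<Longrightarrow> Y \<in> Obj V \<Longrightarrow>
          (Ide V X \<odot> LUnit V Y) \<cdot> Assoc V X \<one> Y = RUnit V X \<odot> Ide V Y"

text \<open>Both \<open>- \<otimes> X\<close> and \<open>X \<otimes> -\<close> have right adjoints, given by universal arrows.\<close>

definition closed_monoidal :: "('o, 'm) moncat \<Rightarrow> bool" where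
  "closed_monoidal V \<longleftrightarrow> monoidal_category V \<and>
     (\<forall>X \<in> Obj V. \<forall>Y \<in> Obj V.
        (\<exists>H \<in> Obj V. \<exists>ev \<in> hom V (H \<otimes>\<^bsub>V\<^esub> X) Y. \<forall>Z \<in> Obj V. \<forall>f \<in> hom V (Z \<otimes>\<^bsub>V\<^esub> X) Y.
           \<exists>!g. g \<in> hom V Z H \<and> ev \<cdot>\<^bsub>V\<^esub> (g \<odot>\<^bsub>V\<^esub> Ide V X) = f) \<and>
        (\<exists>H \<in> Obj V. \<exists>ev \<in> hom V (X \<otimes>\<^bsub>V\<^esub> H) Y. \<forall>Z \<in> Obj V. \<forall>f \<in> hom V (X \<otimes>\<^bsub>V\<^esub> Z) Y.
           \<exists>!g. g \<in> hom V Z H \<and> ev \<cdot>\<^bsub>V\<^esub> (Ide V X \<odot>\<^bsub>V\<^esub> g) = f))"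

definition pushout_product_axiom :: "('o, 'm) moncat \<Rightarrow> 'm model \<Rightarrow> bool" where
  "pushout_product_axiom V M \<longleftrightarrow>
     (\<forall>A B X Y. \<forall>f \<in> hom V A B \<inter> Cof M. \<forall>g \<in> hom V X Y \<inter> Cof M. \<forall>P i j.
        is_pushout V (f \<odot>\<^bsub>V\<^esub> Ide V X) (Ide V A \<odot>\<^bsub>V\<^esub> g) P i j \<longrightarrow>
        (\<forall>u \<in> hom V P (B \<otimes>\<^bsub>V\<^esub> Y).
           u \<cdot>\<^bsub>V\<^esub> i = Ide V B \<odot>\<^bsub>V\<^esub> g \<and> u \<cdot>\<^bsub>V\<^esub> j = f \<odot>\<^bsub>V\<^esub> Ide V Y \<longrightarrow>
           u \<in> Cof M \<and> (f \<in> Weq M \<or> g \<in> Weq M \<longrightarrow> u \<in> Weq M)))"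

definition unit_axiom :: "('o, 'm) moncat \<Rightarrow> 'm model \<Rightarrow> bool" where
  "unit_axiom V M \<longleftrightarrow> (\<forall>X. cofibrant V M X \<longrightarrow>
     cofrep_map V M \<one>\<^bsub>V\<^esub> \<odot>\<^bsub>V\<^esub> Ide V X \<in> Weq M \<and>
     Ide V X \<odot>\<^bsub>V\<^esub> cofrep_map V M \<one>\<^bsub>V\<^esub> \<in> Weq M)"

definition monoidal_model_category :: "'u itself \<Rightarrow> ('o, 'm) moncat \<Rightarrow> 'm model \<Rightarrow> bool" where
  "monoidal_model_category U V M \<longleftrightarrow> model_category U V M \<and> closed_monoidal V \<and>
     pushout_product_axiom V M \<and> unit_axiom V M"

subsection \<open>The induced monoidal structure on the homotopy category\<close>

text \<open>The derived tensor product of \<open>X\<close> and \<open>Y\<close> is \<open>QX \<otimes> QY\<close>, where \<open>Q\<close> is cofibrant replacement.\<close>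

definition ho_ten :: "('o, 'm) moncat \<Rightarrow> 'm model \<Rightarrow> 'o \<Rightarrow> 'o \<Rightarrow> 'o" where
  "ho_ten V M X Y = cofrep V M X \<otimes>\<^bsub>V\<^esub> cofrep V M Y"

text \<open>On arrows represented by strings \<open>p\<close> and \<open>q\<close>: first apply \<open>Q(-) \<otimes> QY\<close> to every letter of \<open>p\<close>,
  then \<open>QX' \<otimes> Q(-)\<close> to every letter of \<open>q\<close>.\<close>

fun ho_tenA ::
  "('o, 'm) moncat \<Rightarrow> 'm model \<Rightarrow> ('o, 'm) loc_arr \<Rightarrow> ('o, 'm) loc_arr \<Rightarrow> ('o, 'm) loc_arr" where
  "ho_tenA V M (X, X', P) (Y, Y', Q) =
     (ho_ten V M X Y, ho_ten V M X' Y',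
      {r. \<exists>p \<in> P. \<exists>q \<in> Q. zig_eq V (Weq M) (ho_ten V M X Y) (ho_ten V M X' Y')
         (map (map_zig (\<lambda>f. cofrep_arr V M f \<odot>\<^bsub>V\<^esub> Ide V (cofrep V M Y))) p @
          map (map_zig (\<lambda>g. Ide V (cofrep V M X') \<odot>\<^bsub>V\<^esub> cofrep_arr V M g)) q) r})"

text \<open>The comparison \<open>QX \<otimes> QY \<rightarrow> X \<otimes> Y\<close>, and the inverse of the unit isomorphism
  \<open>Q1 \<otimes> Q1 \<rightarrow> 1 \<otimes> Q1 \<rightarrow> Q1 \<rightarrow> 1\<close> in the homotopy category.\<close>

definition ho_ten_comparison :: "('o, 'm) moncat \<Rightarrow> 'm model \<Rightarrow> 'o \<Rightarrow> 'o \<Rightarrow> ('o, 'm) loc_arr" where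
  "ho_ten_comparison V M X Y = to_Ho V M (cofrep_map V M X \<odot>\<^bsub>V\<^esub> cofrep_map V M Y)"

definition ho_unit_inv :: "('o, 'm) moncat \<Rightarrow> 'm model \<Rightarrow> ('o, 'm) loc_arr" where
  "ho_unit_inv V M = zig_class V (Weq M) \<one>\<^bsub>V\<^esub> (ho_ten V M \<one>\<^bsub>V\<^esub> \<one>\<^bsub>V\<^esub>)
     [Bwd (cofrep_map V M \<one>\<^bsub>V\<^esub>),
      Bwd (LUnit V (cofrep V M \<one>\<^bsub>V\<^esub>)),
      Bwd (cofrep_map V M \<one>\<^bsub>V\<^esub> \<odot>\<^bsub>V\<^esub> Ide V (cofrep V M \<one>\<^bsub>V\<^esub>))]"

definition pi0 :: "('o, 'm) moncat \<Rightarrow> 'm model \<Rightarrow> 'o \<Rightarrow> ('o, 'm) loc_arr set" where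
  "pi0 V M X = hom (Ho V M) \<one>\<^bsub>V\<^esub> X"

definition connected_obj :: "('o, 'm) moncat \<Rightarrow> 'm model \<Rightarrow> 'o \<Rightarrow> bool" where
  "connected_obj V M X \<longleftrightarrow> X \<in> Obj V \<and> (\<exists>x. pi0 V M X = {x})"

section \<open>Enriched categories\<close>

text \<open>\<open>vcomp A a b c\<close> is the composition \<open>A(b, c) \<otimes> A(a, b) \<rightarrow> A(a, c)\<close>.\<close>

record ('u, 'o, 'm) vcat =
  vobj :: "'u set"
  vhom :: "'u \<Rightarrow> 'u \<Rightarrow> 'o"
  vcomp :: "'u \<Rightarrow> 'u \<Rightarrow> 'u \<Rightarrow> 'm"
  vid :: "'u \<Rightarrow> 'm"

text \<open>The last three conditions fix the values outside the objects, so that equality of records is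
  equality of enriched categories.\<close>

definition is_vcat :: "('o, 'm) moncat \<Rightarrow> ('u, 'o, 'm) vcat \<Rightarrow> bool" where
  "is_vcat V A \<longleftrightarrow>
     (\<forall>a \<in> vobj A. \<forall>b \<in> vobj A. vhom A a b \<in> Obj V) \<and>
     (\<forall>a \<in> vobj A. \<forall>b \<in> vobj A. \<forall>c \<in> vobj A.
        vcomp A a b c \<in> hom V (vhom A b c \<otimes>\<^bsub>V\<^esub> vhom A a b) (vhom A a c)) \<and>
     (\<forall>a \<in> vobj A. vid A a \<in> hom V \<one>\<^bsub>V\<^esub> (vhom A a a)) \<and>
     (\<forall>a \<in> vobj A. \<forall>b \<in> vobj A. \<forall>c \<in> vobj A. \<forall>d \<in> vobj A.
        vcomp A a b d \<cdot>\<^bsub>V\<^esub> (vcomp A b c d \<odot>\<^bsub>V\<^esub> Ide V (vhom A a b)) =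
        vcomp A a c d \<cdot>\<^bsub>V\<^esub> (Ide V (vhom A c d) \<odot>\<^bsub>V\<^esub> vcomp A a b c)
          \<cdot>\<^bsub>V\<^esub> Assoc V (vhom A c d) (vhom A b c) (vhom A a b)) \<and>
     (\<forall>a \<in> vobj A. \<forall>b \<in> vobj A.
        vcomp A a b b \<cdot>\<^bsub>V\<^esub> (vid A b \<odot>\<^bsub>V\<^esub> Ide V (vhom A a b)) = LUnit V (vhom A a b) \<and>
        vcomp A a a b \<cdot>\<^bsub>V\<^esub> (Ide V (vhom A a b) \<odot>\<^bsub>V\<^esub> vid A a) = RUnit V (vhom A a b)) \<and>
     (\<forall>a b. \<not> (a \<in> vobj A \<and> b \<in> vobj A) \<longrightarrow> vhom A a b = undefined) \<and>
     (\<forall>a b c. \<not> (a \<in> vobj A \<and> b \<in> vobj A \<and> c \<in> vobj A) \<longrightarrow> vcomp A a b c = undefined) \<and>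
     (\<forall>a. a \<notin> vobj A \<longrightarrow> vid A a = undefined)"

record ('u, 'o, 'm) vfun =
  vsrc :: "('u, 'o, 'm) vcat"
  vtgt :: "('u, 'o, 'm) vcat"
  vfo :: "'u \<Rightarrow> 'u"
  vfh :: "'u \<Rightarrow> 'u \<Rightarrow> 'm"

definition is_vfun :: "('o, 'm) moncat \<Rightarrow> ('u, 'o, 'm) vfun \<Rightarrow> bool" where
  "is_vfun V F \<longleftrightarrow> (let A = vsrc F; B = vtgt F; f = vfo F in
     is_vcat V A \<and> is_vcat V B \<and>
     (\<forall>a \<in> vobj A. f a \<in> vobj B) \<and>
     (\<forall>a \<in> vobj A. \<forall>b \<in> vobj A. vfh F a b \<in> hom V (vhom A a b) (vhom B (f a) (f b))) \<and>
     (\<forall>a \<in> vobj A. \<forall>b \<in> vobj A. \<forall>c \<in> vobj A.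
        vfh F a c \<cdot>\<^bsub>V\<^esub> vcomp A a b c =
        vcomp B (f a) (f b) (f c) \<cdot>\<^bsub>V\<^esub> (vfh F b c \<odot>\<^bsub>V\<^esub> vfh F a b)) \<and>
     (\<forall>a \<in> vobj A. vfh F a a \<cdot>\<^bsub>V\<^esub> vid A a = vid B (f a)) \<and>
     (\<forall>a. a \<notin> vobj A \<longrightarrow> f a = undefined) \<and>
     (\<forall>a b. \<not> (a \<in> vobj A \<and> b \<in> vobj A) \<longrightarrow> vfh F a b = undefined))"

text \<open>The category of small \<open>V\<close>-categories and \<open>V\<close>-functors.\<close>

definition VCat :: "('o, 'm) moncat \<Rightarrow> (('u, 'o, 'm) vcat, ('u, 'o, 'm) vfun) cat" where
  "VCat V = \<lparr>Obj = {A. is_vcat V A \<and> small (vobj A)},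
     Arr = {F. is_vfun V F \<and> small (vobj (vsrc F)) \<and> small (vobj (vtgt F))},
     Dom = vsrc,
     Cod = vtgt,
     Cmp = (\<lambda>G F. \<lparr>vsrc = vsrc F, vtgt = vtgt G,
        vfo = (\<lambda>a. if a \<in> vobj (vsrc F) then vfo G (vfo F a) else undefined),
        vfh = (\<lambda>a b. if a \<in> vobj (vsrc F) \<and> b \<in> vobj (vsrc F)
                 then vfh G (vfo F a) (vfo F b) \<cdot>\<^bsub>V\<^esub> vfh F a b else undefined)\<rparr>),
     Ide = (\<lambda>A. \<lparr>vsrc = A, vtgt = A,
        vfo = (\<lambda>a. if a \<in> vobj A then a else undefined),
        vfh = (\<lambda>a b. if a \<in> vobj A \<and> b \<in> vobj A then Ide V (vhom A a b) else undefined)\<rparr>)\<rparr>"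

subsection \<open>The category of components\<close>

text \<open>The composite of \<open>y : 1 \<rightarrow> A(b, c)\<close> and \<open>x : 1 \<rightarrow> A(a, b)\<close> in the homotopy category.\<close>

definition pi0_comp ::
  "('o, 'm) moncat \<Rightarrow> 'm model \<Rightarrow> ('u, 'o, 'm) vcat \<Rightarrow> 'u \<Rightarrow> 'u \<Rightarrow> 'u \<Rightarrow>
   ('o, 'm) loc_arr \<Rightarrow> ('o, 'm) loc_arr \<Rightarrow> ('o, 'm) loc_arr" where
  "pi0_comp V M A a b c y x =
     to_Ho V M (vcomp A a b c) \<cdot>\<^bsub>Ho V M\<^esub> ho_ten_comparison V M (vhom A b c) (vhom A a b)
       \<cdot>\<^bsub>Ho V M\<^esub> ho_tenA V M y x \<cdot>\<^bsub>Ho V M\<^esub> ho_unit_inv V M"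

definition pi0_cat ::
  "('o, 'm) moncat \<Rightarrow> 'm model \<Rightarrow> ('u, 'o, 'm) vcat \<Rightarrow>
   ('u, 'u \<times> 'u \<times> ('o, 'm) loc_arr) cat" where
  "pi0_cat V M A = \<lparr>Obj = vobj A,
     Arr = {(a, b, x). a \<in> vobj A \<and> b \<in> vobj A \<and> x \<in> pi0 V M (vhom A a b)},
     Dom = (\<lambda>(a, b, x). a),
     Cod = (\<lambda>(a, b, x). b),
     Cmp = (\<lambda>(b', c, y) (a, b, x). (a, c, pi0_comp V M A a b c y x)),
     Ide = (\<lambda>a. (a, a, to_Ho V M (vid A a)))\<rparr>"

fun pi0_arr ::
  "('o, 'm) moncat \<Rightarrow> 'm model \<Rightarrow> ('u, 'o, 'm) vfun \<Rightarrow>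
   'u \<times> 'u \<times> ('o, 'm) loc_arr \<Rightarrow> 'u \<times> 'u \<times> ('o, 'm) loc_arr" where
  "pi0_arr V M F (a, b, x) = (vfo F a, vfo F b, to_Ho V M (vfh F a b) \<cdot>\<^bsub>Ho V M\<^esub> x)"

definition connected_vcat :: "('o, 'm) moncat \<Rightarrow> 'm model \<Rightarrow> ('u, 'o, 'm) vcat \<Rightarrow> bool" where
  "connected_vcat V M A \<longleftrightarrow> zigzag_connected (pi0_cat V M A)"

subsection \<open>The canonical model structure\<close>

definition DK_equivalence :: "('o, 'm) moncat \<Rightarrow> 'm model \<Rightarrow> ('u, 'o, 'm) vfun \<Rightarrow> bool" where
  "DK_equivalence V M F \<longleftrightarrow> is_vfun V F \<and>
     (\<forall>x \<in> vobj (vsrc F). \<forall>y \<in> vobj (vsrc F). vfh F x y \<in> Weq M) \<and>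
     is_equivalence (pi0_cat V M (vsrc F)) (pi0_cat V M (vtgt F)) (vfo F) (pi0_arr V M F)"

definition naive_fibration :: "('o, 'm) moncat \<Rightarrow> 'm model \<Rightarrow> ('u, 'o, 'm) vfun \<Rightarrow> bool" where
  "naive_fibration V M F \<longleftrightarrow> is_vfun V F \<and>
     (\<forall>x \<in> vobj (vsrc F). \<forall>y \<in> vobj (vsrc F). vfh F x y \<in> Fib M) \<and>
     is_isofibration (pi0_cat V M (vsrc F)) (pi0_cat V M (vtgt F)) (vfo F) (pi0_arr V M F)"

definition canonical_model_structure ::
  "('o, 'm) moncat \<Rightarrow> 'm model \<Rightarrow> ('u, 'o, 'm) vfun model \<Rightarrow> bool" where
  "canonical_model_structure V M K \<longleftrightarrow> model_structure (VCat V) K \<and>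
     (\<forall>A \<in> Obj (VCat V). fibrant (VCat V) K A \<longleftrightarrow>
        (\<forall>a \<in> vobj A. \<forall>b \<in> vobj A. fibrant V M (vhom A a b))) \<and>
     (\<forall>F \<in> Arr (VCat V). F \<in> Fib K \<and> F \<in> Weq K \<longleftrightarrow>
        vfo F ` vobj (vsrc F) = vobj (vtgt F) \<and>
        (\<forall>a \<in> vobj (vsrc F). \<forall>b \<in> vobj (vsrc F). vfh F a b \<in> Fib M \<and> vfh F a b \<in> Weq M)) \<and>
     (\<forall>F \<in> Arr (VCat V). F \<in> Weq K \<longleftrightarrow> DK_equivalence V M F) \<and>
     (\<forall>F \<in> Arr (VCat V). fibrant (VCat V) K (vsrc F) \<and> fibrant (VCat V) K (vtgt F) \<longrightarrow>
        (F \<in> Fib K \<longleftrightarrow> naive_fibration V M F))"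

subsection \<open>Fibers\<close>

text \<open>\<open>F\<close> with inclusion \<open>j\<close> is a fiber of \<open>p\<close> over the point \<open>b : 1 \<rightarrow> B\<close>.\<close>

definition is_fiber :: "('o, 'm) moncat \<Rightarrow> 'm \<Rightarrow> 'm \<Rightarrow> 'o \<Rightarrow> 'm \<Rightarrow> bool" where
  "is_fiber V p b F j \<longleftrightarrow> b \<in> hom V \<one>\<^bsub>V\<^esub> (Cod V p) \<and> (\<exists>t. is_pullback V p b F j t)"

text \<open>A chosen pullback (object, inclusion into \<open>E(x, y)\<close>, projection to the unit); the composition
  and the identities of the fiber are induced by the universal property.\<close>

definition fiber_pb ::
  "('o, 'm) moncat \<Rightarrow> ('u, 'o, 'm) vfun \<Rightarrow> 'u \<Rightarrow> 'u \<Rightarrow> 'u \<Rightarrow> 'o \<times> 'm \<times> 'm" where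
  "fiber_pb V p b x y =
     (SOME (F, j, t). is_pullback V (vfh p x y) (vid (vtgt p) b) F j t)"

definition vfiber :: "('o, 'm) moncat \<Rightarrow> ('u, 'o, 'm) vfun \<Rightarrow> 'u \<Rightarrow> ('u, 'o, 'm) vcat" where
  "vfiber V p b =
     (let O' = {x \<in> vobj (vsrc p). vfo p x = b};
          F = (\<lambda>x y. fst (fiber_pb V p b x y));
          j = (\<lambda>x y. fst (snd (fiber_pb V p b x y)));
          t = (\<lambda>x y. snd (snd (fiber_pb V p b x y)))
      in \<lparr>vobj = O',
          vhom = (\<lambda>x y. if x \<in> O' \<and> y \<in> O' then F x y else undefined),
          vcomp = (\<lambda>x y z. if x \<in> O' \<and> y \<in> O' \<and> z \<in> O' then
            (THE u. u \<in> hom V (F y z \<otimes>\<^bsub>V\<^esub> F x y) (F x z) \<and>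
               j x z \<cdot>\<^bsub>V\<^esub> u = vcomp (vsrc p) x y z \<cdot>\<^bsub>V\<^esub> (j y z \<odot>\<^bsub>V\<^esub> j x y) \<and>
               t x z \<cdot>\<^bsub>V\<^esub> u = LUnit V \<one>\<^bsub>V\<^esub> \<cdot>\<^bsub>V\<^esub> (t y z \<odot>\<^bsub>V\<^esub> t x y)) else undefined),
          vid = (\<lambda>x. if x \<in> O' then
            (THE u. u \<in> hom V \<one>\<^bsub>V\<^esub> (F x x) \<and>
               j x x \<cdot>\<^bsub>V\<^esub> u = vid (vsrc p) x \<and> t x x \<cdot>\<^bsub>V\<^esub> u = Ide V \<one>\<^bsub>V\<^esub>) else undefined)\<rparr>)"

section \<open>Measures and Euler characteristic\<close>

text \<open>The full subcategory of \<open>Ho V\<close> on which the measure is defined is given by its class \<open>W\<close> of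
  objects.  Being the source of a monoid homomorphism, it contains the unit and is closed under the
  (derived) tensor product.  The coproducts are those of the homotopy category; closure under the
  coproducts of one-element families makes \<open>W\<close> closed under isomorphism.  The ring need not be
  commutative, and the class \<open>{ring, monoid_mult}\<close> allows the zero ring.\<close>

definition monoidal_measure ::
  "('o, 'm) moncat \<Rightarrow> 'm model \<Rightarrow> 'o set \<Rightarrow> ('o \<Rightarrow> 'k::{ring, monoid_mult}) \<Rightarrow> bool" where
  "monoidal_measure V M W mu \<longleftrightarrow> W \<subseteq> Obj V \<and>
     (\<forall>(I :: nat set) X P inc. finite I \<and> is_coproduct (Ho V M) I X P inc \<longrightarrow>
        (P \<in> W \<longleftrightarrow> (\<forall>i \<in> I. X i \<in> W))) \<and>
     \<one>\<^bsub>V\<^esub> \<in> W \<and> (\<forall>X \<in> W. \<forall>Y \<in> W. ho_ten V M X Y \<in> W) \<and>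
     (\<forall>X \<in> W. \<forall>Y \<in> W. isomorphic (Ho V M) X Y \<longrightarrow> mu X = mu Y) \<and>
     mu \<one>\<^bsub>V\<^esub> = 1 \<and> (\<forall>X \<in> W. \<forall>Y \<in> W. mu (ho_ten V M X Y) = mu X * mu Y) \<and>
     (\<forall>(I :: nat set) X P inc. finite I \<and> is_coproduct (Ho V M) I X P inc \<and> P \<in> W \<longrightarrow>
        mu P = (\<Sum>i\<in>I. mu (X i)))"

definition measurable_vcat :: "'o set \<Rightarrow> ('u, 'o, 'm) vcat \<Rightarrow> bool" where
  "measurable_vcat W A \<longleftrightarrow> (\<forall>a \<in> vobj A. \<forall>b \<in> vobj A. vhom A a b \<in> W)"

definition is_weighting ::
  "('o \<Rightarrow> 'k::{ring, monoid_mult}) \<Rightarrow> ('u, 'o, 'm) vcat \<Rightarrow> ('u \<Rightarrow> 'k) \<Rightarrow> bool" where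
  "is_weighting mu A w \<longleftrightarrow> (\<forall>a \<in> vobj A. (\<Sum>b \<in> vobj A. mu (vhom A a b) * w b) = 1)"

definition is_coweighting ::
  "('o \<Rightarrow> 'k::{ring, monoid_mult}) \<Rightarrow> ('u, 'o, 'm) vcat \<Rightarrow> ('u \<Rightarrow> 'k) \<Rightarrow> bool" where
  "is_coweighting mu A v \<longleftrightarrow> (\<forall>b \<in> vobj A. (\<Sum>a \<in> vobj A. v a * mu (vhom A a b)) = 1)"

definition admits_euler_char ::
  "'o set \<Rightarrow> ('o \<Rightarrow> 'k::{ring, monoid_mult}) \<Rightarrow> ('u, 'o, 'm) vcat \<Rightarrow> bool" where
  "admits_euler_char W mu A \<longleftrightarrow> finite (vobj A) \<and> measurable_vcat W A \<and>
     (\<exists>w. is_weighting mu A w) \<and> (\<exists>v. is_coweighting mu A v)"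

definition euler_char ::
  "('o \<Rightarrow> 'k::{ring, monoid_mult}) \<Rightarrow> ('u, 'o, 'm) vcat \<Rightarrow> 'k" where
  "euler_char mu A = (\<Sum>a \<in> vobj A. (SOME w. is_weighting mu A w) a)"

text \<open>The value does not depend on the chosen weighting and can be computed from a coweighting.\<close>

lemma euler_char_eq:
  assumes "admits_euler_char W mu A"
  shows "is_weighting mu A w \<Longrightarrow> euler_char mu A = (\<Sum>a \<in> vobj A. w a)"
    and "is_coweighting mu A v \<Longrightarrow> euler_char mu A = (\<Sum>a \<in> vobj A. v a)"
proof -
  have *: "(\<Sum>a \<in> vobj A. w a) = (\<Sum>a \<in> vobj A. v a)"
    if "is_weighting mu A w" "is_coweighting mu A v" for w v
  proof -
    have "(\<Sum>b \<in> vobj A. w b) = (\<Sum>b \<in> vobj A. (\<Sum>a \<in> vobj A. v a * mu (vhom A a b)) * w b)"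
      using that(2) by (simp add: is_coweighting_def)
    also have "\<dots> = (\<Sum>b \<in> vobj A. \<Sum>a \<in> vobj A. v a * (mu (vhom A a b) * w b))"
      by (simp add: sum_distrib_right mult.assoc)
    also have "\<dots> = (\<Sum>a \<in> vobj A. \<Sum>b \<in> vobj A. v a * (mu (vhom A a b) * w b))"
      by (rule sum.swap)
    also have "\<dots> = (\<Sum>a \<in> vobj A. v a * (\<Sum>b \<in> vobj A. mu (vhom A a b) * w b))"
      by (simp add: sum_distrib_left)
    also have "\<dots> = (\<Sum>a \<in> vobj A. v a)"
      using that(1) by (simp add: is_weighting_def)
    finally show ?thesis .
  qed
  obtain w0 v0 where w0: "is_weighting mu A w0" and v0: "is_coweighting mu A v0"
    using assms unfolding admits_euler_char_def by blast
  have s: "is_weighting mu A (SOME w. is_weighting mu A w)"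
    using someI[of "is_weighting mu A", OF w0] .
  show "is_coweighting mu A v \<Longrightarrow> euler_char mu A = (\<Sum>a \<in> vobj A. v a)"
    using *[OF s] by (simp add: euler_char_def)
  show "is_weighting mu A w \<Longrightarrow> euler_char mu A = (\<Sum>a \<in> vobj A. w a)"
    using *[OF s v0] *[OF _ v0] by (simp add: euler_char_def)
qed

subsection \<open>Measures preserving fibrations\<close>

text \<open>The coproduct decomposition of \<open>B\<close> is taken in \<open>V\<close>, with summands in \<open>W\<close>, where \<open>mu\<close> is
  defined.\<close>

definition preserves_fibrations ::
  "('o, 'm) moncat \<Rightarrow> 'm model \<Rightarrow> 'o set \<Rightarrow> ('o \<Rightarrow> 'k::{ring, monoid_mult}) \<Rightarrow> bool" where
  "preserves_fibrations V M W mu \<longleftrightarrow>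
     (\<forall>E B p. p \<in> hom V E B \<and> p \<in> Fib M \<and> E \<in> W \<and> B \<in> W \<and>
        (\<forall>b F j. is_fiber V p b F j \<longrightarrow> F \<in> W) \<longrightarrow>
        (\<forall>(I :: nat set) Bc inc b F j. finite I \<and> is_coproduct V I Bc B inc \<and>
           (\<forall>i \<in> I. connected_obj V M (Bc i) \<and> Bc i \<in> W \<and> b i \<in> hom V \<one>\<^bsub>V\<^esub> (Bc i) \<and>
              is_fiber V p (inc i \<cdot>\<^bsub>V\<^esub> b i) (F i) (j i)) \<longrightarrow>
           mu E = (\<Sum>i\<in>I. mu (Bc i) * mu (F i))))"

subsection \<open>Conditions on the base category and on the measured objects\<close>

definition to_unit :: "('o, 'm) moncat \<Rightarrow> 'o \<Rightarrow> 'm" where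
  "to_unit V X = (THE f. f \<in> hom V X \<one>\<^bsub>V\<^esub>)"

definition condV1 :: "('o, 'm) moncat \<Rightarrow> 'm model \<Rightarrow> bool" where
  "condV1 V M \<longleftrightarrow> is_terminal V \<one>\<^bsub>V\<^esub> \<and>
     (\<forall>X \<in> Obj V. \<forall>Y \<in> Obj V. is_product V X Y (X \<otimes>\<^bsub>V\<^esub> Y)
        (RUnit V X \<cdot>\<^bsub>V\<^esub> (Ide V X \<odot>\<^bsub>V\<^esub> to_unit V Y))
        (LUnit V Y \<cdot>\<^bsub>V\<^esub> (to_unit V X \<odot>\<^bsub>V\<^esub> Ide V Y))) \<and>
     cofibrant V M \<one>\<^bsub>V\<^esub>"

definition condV2 :: "('o, 'm) moncat \<Rightarrow> 'm model \<Rightarrow> bool" where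
  "condV2 V M \<longleftrightarrow> (\<forall>X \<in> Obj V. pi0 V M X = {} \<longleftrightarrow> is_initial V X)"

text \<open>Naturality of the isomorphism is expressed by saying that it is the canonical one, i.e. that
  the tensor product of two coproducts is a coproduct along the tensored injections.\<close>

definition condW1 :: "'u itself \<Rightarrow> ('o, 'm) moncat \<Rightarrow> bool" where
  "condW1 _ V \<longleftrightarrow> (\<forall>(I :: 'u set) (J :: 'u set) X Y P Q i j.
     is_coproduct V I X P i \<and> is_coproduct V J Y Q j \<longrightarrow>
     is_coproduct V (I \<times> J) (\<lambda>(r, s). X r \<otimes>\<^bsub>V\<^esub> Y s) (P \<otimes>\<^bsub>V\<^esub> Q) (\<lambda>(r, s). i r \<odot>\<^bsub>V\<^esub> j s))"

definition condW2 :: "('o, 'm) moncat \<Rightarrow> 'm model \<Rightarrow> 'o set \<Rightarrow> bool" where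
  "condW2 V M W \<longleftrightarrow> (\<forall>X \<in> W. finite (pi0 V M X))"

text \<open>\<open>Xc x\<close>, an object of \<open>W\<close>, is the component of \<open>X\<close> containing the point \<open>x \<in> pi0 X\<close>: the point of
  \<open>Xc x\<close> is sent to \<open>x\<close>, and an arrow \<open>1 \<rightarrow> X\<close> of \<open>V\<close> representing \<open>x\<close> factors through \<open>Xc x\<close>.
  In the last conjunct \<open>D\<close> is the coproduct of copies of the unit and \<open>q\<close> is the canonical arrow.\<close>

definition condW3 :: "('o, 'm) moncat \<Rightarrow> 'm model \<Rightarrow> 'o set \<Rightarrow> bool" where
  "condW3 V M W \<longleftrightarrow> (\<forall>X \<in> W. finite (pi0 V M X) \<and>
     (\<exists>Xc inc. is_coproduct V (pi0 V M X) Xc X inc \<and>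
        (\<forall>x \<in> pi0 V M X. Xc x \<in> W \<and> connected_obj V M (Xc x) \<and>
           (\<forall>y \<in> pi0 V M (Xc x). to_Ho V M (inc x) \<cdot>\<^bsub>Ho V M\<^esub> y = x) \<and>
           (\<forall>g \<in> hom V \<one>\<^bsub>V\<^esub> X. to_Ho V M g = x \<longrightarrow>
              (\<exists>h \<in> hom V \<one>\<^bsub>V\<^esub> (Xc x). inc x \<cdot>\<^bsub>V\<^esub> h = g))) \<and>
        (\<forall>D d q. is_coproduct V (pi0 V M X) (\<lambda>_. \<one>\<^bsub>V\<^esub>) D d \<and> q \<in> hom V X D \<and>
           (\<forall>x \<in> pi0 V M X. q \<cdot>\<^bsub>V\<^esub> inc x = d x \<cdot>\<^bsub>V\<^esub> to_unit V (Xc x)) \<longrightarrow>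
           (\<forall>x \<in> pi0 V M X. is_pullback V q (d x) (Xc x) (inc x) (to_unit V (Xc x))))))"

end

theory Submission
  imports Defs
begin

text \<open>Invariance under weak equivalences comes down to the matrices of measures.  If \<open>f : A \<rightarrow> B\<close> and
  \<open>g : B \<rightarrow> A\<close> are maps of objects with \<open>|B(b, f a)| = |A(g b, a)|\<close> and \<open>|B(f a, b)| = |A(a, g b)|\<close>, then a
  weighting or coweighting is pushed forward along \<open>f\<close> or \<open>g\<close> by summing over preimages, and its total
  does not change (\<open>euler_char_push\<close>).  For a DK-equivalence \<open>f\<close> such a \<open>g\<close> exists
  (\<open>Weq_adjoint_on_objects\<close>).  It is produced inside the model structure on \<open>V\<close>-categories, by lifting
  into a full subcategory of a fibrant replacement of \<open>A\<close>; as all the functors involved are weak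
  equivalences, the hom-objects are compared through weak equivalences of \<open>V\<close>.

  For a fibration \<open>p : E \<rightarrow> B\<close> with fiber \<open>F\<close> over \<open>b\<close>, let \<open>x\<close> be an object of \<open>E\<close> and \<open>y\<close> one of \<open>F\<close>.
  The fibration \<open>E(x, y) \<rightarrow> B(p x, b)\<close> gives \<open>|E(x, y)| = \<Sum>\<^sub>i |B\<^sub>i| |G\<^sub>i|\<close>, where \<open>B\<^sub>i\<close> are the components of
  \<open>B(p x, b)\<close> and \<open>G\<^sub>i\<close> is the fiber over a point \<open>\<gamma>\<^sub>i\<close> of \<open>B\<^sub>i\<close>.  Lifting \<open>\<gamma>\<^sub>i\<close> to an equivalence
  \<open>x \<rightarrow> x\<^sub>i\<close> with \<open>x\<^sub>i\<close> in \<open>F\<close>, and precomposing with it, identifies \<open>G\<^sub>i\<close> with \<open>F(x\<^sub>i, y)\<close> in the homotopy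
  category (\<open>fiber_transport\<close>).  As \<open>x\<^sub>i\<close> does not depend on \<open>y\<close>, a weighting \<open>w\<close> of \<open>F\<close> satisfies
  \<open>\<Sum>\<^sub>y |E(x, y)| w(y) = \<Sum>\<^sub>i |B\<^sub>i| = |B(p x, b)|\<close>.  Since \<open>\<pi>\<^sub>0 B\<close> is a connected groupoid, all its hom-objects have one
  measure \<open>\<beta>\<close>, and \<open>\<beta>\<close> is inverse to \<open>\<chi>(B)\<close>.  So \<open>\<chi>(B) w\<close>, extended by zero, is a weighting of \<open>E\<close>, and its
  total is \<open>\<chi>(B) \<chi>(F)\<close>.  The ring need not be commutative, but values of the measure commute with each
  other because the product of \<open>V\<close> is symmetric.

  The work lies in the identification of fibers.  It rests on two facts on points \<open>1 \<rightarrow> X\<close> of a fibrant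
  object.  A class in \<open>\<pi>\<^sub>0 X\<close> is represented by a point (\<open>point_representable\<close>).  An equivalence relation
  between points which is preserved by maps and reflected by trivial fibrations contains equality in
  \<open>\<pi>\<^sub>0 X\<close> (\<open>ho_eq_imp\<close>); this replaces homotopies.  It applies to the relation between two points of
  having equivalent fibers, and to that of agreeing on whether a given map of fibrations is an
  equivalence on fibers, because over a contractible base the inclusion of a fiber is
  invertible in the homotopy category (\<open>fiber_over_contractible\<close>).  The second instance shows that
  precomposition with a loop in the component of the identity is invertible on fibers
  (\<open>fiber_loop_iso\<close>), and the two-out-of-six property extends this to all equivalences.\<close>

section \<open>Isomorphisms, terminal objects and pullbacks\<close>

context category
begin

lemma homD: "f \<in> hom C a b \<Longrightarrow> f \<in> Arr C" "f \<in> hom C a b \<Longrightarrow> Dom C f = a"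
    "f \<in> hom C a b \<Longrightarrow> Cod C f = b"
  by (simp_all add: hom_def)

lemma hom_Obj: "f \<in> hom C a b \<Longrightarrow> a \<in> Obj C" "f \<in> hom C a b \<Longrightarrow> b \<in> Obj C"
  using Dom_in Cod_in by (auto simp: hom_def)

lemma Arr_hom: "f \<in> Arr C \<Longrightarrow> f \<in> hom C (Dom C f) (Cod C f)"
  by (simp add: hom_def)

lemma iso_arrI:
  assumes "f \<in> hom C a b" "g \<in> hom C b a" "g \<cdot> f = Ide C a" "f \<cdot> g = Ide C b"
  shows "iso_arr C f"
  using assms unfolding iso_arr_def by (auto simp: homD)

lemma iso_arrE:
  assumes "iso_arr C f" "f \<in> hom C a b"
  obtains g where "g \<in> hom C b a" "g \<cdot> f = Ide C a" "f \<cdot> g = Ide C b" "iso_arr C g"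
proof -
  obtain g where g: "g \<in> hom C b a" "g \<cdot> f = Ide C a" "f \<cdot> g = Ide C b"
    using assms unfolding iso_arr_def by (auto simp: homD)
  then show thesis using that iso_arrI[OF g(1) assms(2) g(3,2)] by blast
qed

lemma iso_Ide: "a \<in> Obj C \<Longrightarrow> iso_arr C (Ide C a)"
  using iso_arrI[OF Ide_in Ide_in] Cmp_Ide[OF Ide_in] by blast

lemma iso_Cmp:
  assumes "f \<in> hom C a b" "g \<in> hom C b c" "iso_arr C f" "iso_arr C g"
  shows "iso_arr C (g \<cdot> f)"
proof -
  obtain f' where f': "f' \<in> hom C b a" "f' \<cdot> f = Ide C a" "f \<cdot> f' = Ide C b"
    using iso_arrE[OF assms(3,1)] .
  obtain g' where g': "g' \<in> hom C c b" "g' \<cdot> g = Ide C b" "g \<cdot> g' = Ide C c"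
    using iso_arrE[OF assms(4,2)] .
  have "(f' \<cdot> g') \<cdot> (g \<cdot> f) = f' \<cdot> (g' \<cdot> (g \<cdot> f))"
    using Cmp_assoc[OF Cmp_in[OF assms(1,2)] g'(1) f'(1)] by simp
  also have "g' \<cdot> (g \<cdot> f) = f"
    using Cmp_assoc[OF assms(1,2) g'(1)] g' Ide_Cmp[OF assms(1)] by simp
  finally have 1: "(f' \<cdot> g') \<cdot> (g \<cdot> f) = Ide C a" using f' by simp
  have "(g \<cdot> f) \<cdot> (f' \<cdot> g') = g \<cdot> (f \<cdot> (f' \<cdot> g'))"
    using Cmp_assoc[OF Cmp_in[OF g'(1) f'(1)] assms(1,2)] by simp
  also have "f \<cdot> (f' \<cdot> g') = g'"
    using Cmp_assoc[OF g'(1) f'(1) assms(1)] f' Ide_Cmp[OF g'(1)] by simp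
  finally have 2: "(g \<cdot> f) \<cdot> (f' \<cdot> g') = Ide C c" using g' by simp
  show ?thesis
    by (rule iso_arrI[OF Cmp_in[OF assms(1,2)] Cmp_in[OF g'(1) f'(1)] 1 2])
qed

lemma left_right_inverse_eq:
  assumes "f \<in> hom C a b" "l \<in> hom C b a" "r \<in> hom C b a"
    "l \<cdot> f = Ide C a" "f \<cdot> r = Ide C b"
  shows "l = r"
proof -
  have "l = l \<cdot> (f \<cdot> r)" using assms Cmp_Ide by simp
  also have "\<dots> = (l \<cdot> f) \<cdot> r" using Cmp_assoc[OF assms(3,1,2)] .
  also have "\<dots> = r" using assms Ide_Cmp by simp
  finally show ?thesis .
qed

lemma iso_cancel_left:
  assumes "f \<in> hom C a b" "g \<in> hom C b c" "iso_arr C g" "iso_arr C (g \<cdot> f)"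
  shows "iso_arr C f"
proof -
  obtain g' where g': "g' \<in> hom C c b" "g' \<cdot> g = Ide C b" "iso_arr C g'"
    using iso_arrE[OF assms(3,2)] .
  have "f = g' \<cdot> (g \<cdot> f)" using Cmp_assoc[OF assms(1,2) g'(1)] g' Ide_Cmp[OF assms(1)] by simp
  then show ?thesis using iso_Cmp[OF Cmp_in[OF assms(1,2)] g'(1) assms(4) g'(3)] by simp
qed

lemma iso_cancel_right:
  assumes "f \<in> hom C a b" "g \<in> hom C b c" "iso_arr C f" "iso_arr C (g \<cdot> f)"
  shows "iso_arr C g"
proof -
  obtain f' where f': "f' \<in> hom C b a" "f \<cdot> f' = Ide C b" "iso_arr C f'"
    using iso_arrE[OF assms(3,1)] .
  have "g = (g \<cdot> f) \<cdot> f'" using Cmp_assoc[OF f'(1) assms(1,2)] f' Cmp_Ide[OF assms(2)] by simp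
  then show ?thesis using iso_Cmp[OF f'(1) Cmp_in[OF assms(1,2)] f'(3) assms(4)] by simp
qed

text \<open>A left inverse of \<open>g\<close> comes from \<open>hg\<close> and a right inverse from \<open>gf\<close>.\<close>

lemma two_of_six:
  assumes f: "f \<in> hom C a b" and g: "g \<in> hom C b c" and h: "h \<in> hom C c d"
    and gf: "iso_arr C (g \<cdot> f)" and hg: "iso_arr C (h \<cdot> g)"
  shows "iso_arr C f" "iso_arr C g"
proof -
  obtain k where k: "k \<in> hom C c a" "(g \<cdot> f) \<cdot> k = Ide C c"
    using iso_arrE[OF gf Cmp_in[OF f g]] .
  obtain l where l: "l \<in> hom C d b" "l \<cdot> (h \<cdot> g) = Ide C b"
    using iso_arrE[OF hg Cmp_in[OF g h]] .
  have r: "g \<cdot> (f \<cdot> k) = Ide C c" using Cmp_assoc[OF k(1) f g] k by simp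
  have s: "(l \<cdot> h) \<cdot> g = Ide C b" using Cmp_assoc[OF g h l(1)] l by simp
  have "l \<cdot> h = f \<cdot> k"
    by (rule left_right_inverse_eq[OF g Cmp_in[OF h l(1)] Cmp_in[OF k(1) f] s r])
  then show "iso_arr C g" using iso_arrI[OF g Cmp_in[OF k(1) f]] r s by simp
  then show "iso_arr C f" by (rule iso_cancel_left[OF f g _ gf])
qed

lemma isomorphicI: "f \<in> hom C a b \<Longrightarrow> iso_arr C f \<Longrightarrow> isomorphic C a b"
  unfolding isomorphic_def by blast

lemma isomorphic_sym: "isomorphic C a b \<Longrightarrow> isomorphic C b a"
  unfolding isomorphic_def by (meson iso_arrE)

lemma isomorphic_trans: "isomorphic C a b \<Longrightarrow> isomorphic C b c \<Longrightarrow> isomorphic C a c"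
  unfolding isomorphic_def by (meson iso_Cmp Cmp_in)

lemma terminal_eq:
  assumes "is_terminal C t" "f \<in> hom C x t" "g \<in> hom C x t"
  shows "f = g"
  using assms hom_Obj(1)[OF assms(2)] unfolding is_terminal_def by blast

lemma terminal_ex:
  assumes "is_terminal C t" "x \<in> Obj C"
  obtains f where "f \<in> hom C x t"
  using assms unfolding is_terminal_def by blast

lemma initial_eq:
  assumes "is_initial C z" "f \<in> hom C z x" "g \<in> hom C z x"
  shows "f = g"
  using assms hom_Obj(2)[OF assms(2)] unfolding is_initial_def by blast

lemma initial_ex:
  assumes "is_initial C z" "x \<in> Obj C"
  obtains f where "f \<in> hom C z x"
  using assms unfolding is_initial_def by blast

lemma terminal_iso:
  assumes "is_terminal C s" "is_terminal C t" "f \<in> hom C s t"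
  shows "iso_arr C f"
proof -
  obtain g where g: "g \<in> hom C t s"
    using terminal_ex[OF assms(1) hom_Obj(2)[OF assms(3)]] .
  show ?thesis
    by (rule iso_arrI[OF assms(3) g terminal_eq[OF assms(1)] terminal_eq[OF assms(2)]])
      (use Cmp_in assms g Ide_in hom_Obj in blast)+
qed

lemma pullbackD:
  assumes "is_pullback C f g P p q"
  shows "p \<in> hom C P (Dom C f)" "q \<in> hom C P (Dom C g)" "f \<cdot> p = g \<cdot> q"
    "f \<in> hom C (Dom C f) (Cod C f)" "g \<in> hom C (Dom C g) (Cod C f)"
  using assms unfolding is_pullback_def by (auto simp: hom_def)

lemma pullback_lift:
  assumes "is_pullback C f g P p q" "s \<in> hom C Z (Dom C f)" "t \<in> hom C Z (Dom C g)"
    "f \<cdot> s = g \<cdot> t"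
  obtains u where "u \<in> hom C Z P" "p \<cdot> u = s" "q \<cdot> u = t"
  using assms unfolding is_pullback_def by blast

lemma pullback_eq:
  assumes "is_pullback C f g P p q" "u \<in> hom C Z P" "v \<in> hom C Z P"
    "p \<cdot> u = p \<cdot> v" "q \<cdot> u = q \<cdot> v"
  shows "u = v"
proof -
  note d = pullbackD[OF assms(1)]
  have "f \<cdot> (p \<cdot> u) = g \<cdot> (q \<cdot> u)"
    using Cmp_assoc[OF assms(2) d(1,4)] Cmp_assoc[OF assms(2) d(2,5)] d(3) by simp
  then have "\<exists>!w. w \<in> hom C Z P \<and> p \<cdot> w = p \<cdot> u \<and> q \<cdot> w = q \<cdot> u"
    using assms(1) Cmp_in[OF assms(2) d(1)] Cmp_in[OF assms(2) d(2)]
    unfolding is_pullback_def by blast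
  then show ?thesis using assms by metis
qed

lemma pullbackI:
  assumes "f \<in> hom C a c" "g \<in> hom C b c" "p \<in> hom C P a" "q \<in> hom C P b" "f \<cdot> p = g \<cdot> q"
    and ex: "\<And>Z s t. s \<in> hom C Z a \<Longrightarrow> t \<in> hom C Z b \<Longrightarrow> f \<cdot> s = g \<cdot> t \<Longrightarrow>
      \<exists>u \<in> hom C Z P. p \<cdot> u = s \<and> q \<cdot> u = t"
    and un: "\<And>Z u v. u \<in> hom C Z P \<Longrightarrow> v \<in> hom C Z P \<Longrightarrow> p \<cdot> u = p \<cdot> v \<Longrightarrow> q \<cdot> u = q \<cdot> v \<Longrightarrow> u = v"
  shows "is_pullback C f g P p q"
proof -
  have "\<exists>!u. u \<in> hom C Z P \<and> p \<cdot> u = s \<and> q \<cdot> u = t"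
    if st: "s \<in> hom C Z a" "t \<in> hom C Z b" "f \<cdot> s = g \<cdot> t" for Z s t
  proof -
    obtain u where u: "u \<in> hom C Z P" "p \<cdot> u = s" "q \<cdot> u = t" using ex[OF st] by blast
    show ?thesis
    proof (rule ex1I[of _ u])
      fix v assume "v \<in> hom C Z P \<and> p \<cdot> v = s \<and> q \<cdot> v = t"
      then show "v = u" using un[of v Z u] u by simp
    qed (use u in simp)
  qed
  then show ?thesis
    using assms(1-5) unfolding is_pullback_def by (simp add: homD(1)[OF assms(1)] homD(1)[OF assms(2)]
      homD(2)[OF assms(1)] homD(2)[OF assms(2)] homD(3)[OF assms(1)] homD(3)[OF assms(2)])
qed

lemma pullback_commute:
  assumes "is_pullback C f g P p q"
  shows "is_pullback C g f P q p"
proof (rule pullbackI)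
  note d = pullbackD[OF assms]
  show "g \<in> hom C (Dom C g) (Cod C f)" "f \<in> hom C (Dom C f) (Cod C f)"
    "q \<in> hom C P (Dom C g)" "p \<in> hom C P (Dom C f)" "g \<cdot> q = f \<cdot> p" using d by simp_all
  show "\<exists>u\<in>hom C Z P. q \<cdot> u = s \<and> p \<cdot> u = t"
    if "s \<in> hom C Z (Dom C g)" "t \<in> hom C Z (Dom C f)" "g \<cdot> s = f \<cdot> t" for Z s t
    using pullback_lift[OF assms that(2,1) that(3)[symmetric]] by blast
  show "u = v" if "u \<in> hom C Z P" "v \<in> hom C Z P" "q \<cdot> u = q \<cdot> v" "p \<cdot> u = p \<cdot> v" for Z u v
    using pullback_eq[OF assms that(1,2,4,3)] .
qed

text \<open>The two halves of the pasting law are used to regard a fiber of a pulled back map as a fiber of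
  the map, and conversely.\<close>

lemma pullback_unpaste:
  assumes P: "is_pullback C f g P p q" and h: "h \<in> hom C D (Dom C g)"
    and Q: "is_pullback C f (g \<cdot> h) Q m s"
  obtains r where "r \<in> hom C Q P" "p \<cdot> r = m" "is_pullback C q h Q r s"
proof -
  note d = pullbackD[OF P]
  note gh = Cmp_in[OF h d(5)]
  have e: "m \<in> hom C Q (Dom C f)" "s \<in> hom C Q D" "f \<cdot> m = g \<cdot> h \<cdot> s"
    using pullbackD[OF Q] unfolding homD(2)[OF gh] by blast+
  have fm: "f \<cdot> m = g \<cdot> (h \<cdot> s)" using e Cmp_assoc[OF e(2) h d(5)] by simp
  obtain r where r: "r \<in> hom C Q P" "p \<cdot> r = m" "q \<cdot> r = h \<cdot> s"
    using pullback_lift[OF P e(1) Cmp_in[OF e(2) h] fm] .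
  have "is_pullback C q h Q r s"
  proof (rule pullbackI[OF d(2) h r(1) e(2) r(3)])
    fix Z x y assume x: "x \<in> hom C Z P" and y: "y \<in> hom C Z D" and xy: "q \<cdot> x = h \<cdot> y"
    have "f \<cdot> (p \<cdot> x) = g \<cdot> (q \<cdot> x)"
      using Cmp_assoc[OF x d(1,4)] Cmp_assoc[OF x d(2,5)] d(3) by simp
    then have 1: "f \<cdot> (p \<cdot> x) = g \<cdot> h \<cdot> y" using xy Cmp_assoc[OF y h d(5)] by simp
    have y': "y \<in> hom C Z (Dom C (g \<cdot> h))" using y unfolding homD(2)[OF gh] .
    obtain u where u: "u \<in> hom C Z Q" "m \<cdot> u = p \<cdot> x" "s \<cdot> u = y"
      using pullback_lift[OF Q Cmp_in[OF x d(1)] y' 1] .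
    have "r \<cdot> u = x"
    proof (rule pullback_eq[OF P Cmp_in[OF u(1) r(1)] x])
      show "p \<cdot> (r \<cdot> u) = p \<cdot> x" using Cmp_assoc[OF u(1) r(1) d(1)] r u by simp
      show "q \<cdot> (r \<cdot> u) = q \<cdot> x"
        using Cmp_assoc[OF u(1) r(1) d(2)] r u xy Cmp_assoc[OF u(1) e(2) h] by simp
    qed
    then show "\<exists>u\<in>hom C Z Q. r \<cdot> u = x \<and> s \<cdot> u = y" using u by blast
  next
    fix Z u v assume uv: "u \<in> hom C Z Q" "v \<in> hom C Z Q" "r \<cdot> u = r \<cdot> v" "s \<cdot> u = s \<cdot> v"
    have "m \<cdot> u = m \<cdot> v"
      using Cmp_assoc[OF uv(1) r(1) d(1)] Cmp_assoc[OF uv(2) r(1) d(1)] r uv by simp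
    then show "u = v" by (rule pullback_eq[OF Q uv(1,2) _ uv(4)])
  qed
  then show thesis using that r by blast
qed

lemma pullback_paste:
  assumes P: "is_pullback C f g P p q" and h: "h \<in> hom C D (Dom C g)"
    and Q: "is_pullback C q h Q r s"
  shows "is_pullback C f (g \<cdot> h) Q (p \<cdot> r) s"
proof -
  note d = pullbackD[OF P]
  have e: "r \<in> hom C Q P" "s \<in> hom C Q D" "q \<cdot> r = h \<cdot> s"
    using pullbackD[OF Q] unfolding homD(2)[OF h] homD(2)[OF d(2)] by blast+
  show ?thesis
  proof (rule pullbackI[OF d(4) Cmp_in[OF h d(5)] Cmp_in[OF e(1) d(1)] e(2)])
    show "f \<cdot> (p \<cdot> r) = g \<cdot> h \<cdot> s"
      using Cmp_assoc[OF e(1) d(1,4)] Cmp_assoc[OF e(1) d(2,5)] Cmp_assoc[OF e(2) h d(5)] d(3) e(3)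
      by simp
  next
    fix Z x y assume x: "x \<in> hom C Z (Dom C f)" and y: "y \<in> hom C Z D" and xy: "f \<cdot> x = g \<cdot> h \<cdot> y"
    have "f \<cdot> x = g \<cdot> (h \<cdot> y)" using xy Cmp_assoc[OF y h d(5)] by simp
    then obtain u where u: "u \<in> hom C Z P" "p \<cdot> u = x" "q \<cdot> u = h \<cdot> y"
      using pullback_lift[OF P x Cmp_in[OF y h]] by blast
    obtain v where v: "v \<in> hom C Z Q" "r \<cdot> v = u" "s \<cdot> v = y"
      using pullback_lift[OF Q, unfolded homD(2)[OF h] homD(2)[OF d(2)], OF u(1) y u(3)] .
    show "\<exists>v\<in>hom C Z Q. p \<cdot> r \<cdot> v = x \<and> s \<cdot> v = y"
      using u v Cmp_assoc[OF v(1) e(1) d(1)] by auto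
  next
    fix Z u v assume uv: "u \<in> hom C Z Q" "v \<in> hom C Z Q" "p \<cdot> r \<cdot> u = p \<cdot> r \<cdot> v" "s \<cdot> u = s \<cdot> v"
    have "r \<cdot> u = r \<cdot> v"
    proof (rule pullback_eq[OF P Cmp_in[OF uv(1) e(1)] Cmp_in[OF uv(2) e(1)]])
      show "p \<cdot> (r \<cdot> u) = p \<cdot> (r \<cdot> v)"
        using uv Cmp_assoc[OF uv(1) e(1) d(1)] Cmp_assoc[OF uv(2) e(1) d(1)] by simp
      show "q \<cdot> (r \<cdot> u) = q \<cdot> (r \<cdot> v)"
        using uv Cmp_assoc[OF uv(1) e(1) d(2)] Cmp_assoc[OF uv(2) e(1) d(2)] e(3)
          Cmp_assoc[OF uv(1) e(2) h] Cmp_assoc[OF uv(2) e(2) h] by simp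
    qed
    then show "u = v" using pullback_eq[OF Q uv(1,2) _ uv(4)] by blast
  qed
qed

lemma pullback_comparison_iso:
  assumes P: "is_pullback C f g P p q" and P': "is_pullback C f g P' p' q'"
    and u: "u \<in> hom C P P'" "p' \<cdot> u = p" "q' \<cdot> u = q"
  shows "iso_arr C u"
proof -
  note d = pullbackD[OF P] and d' = pullbackD[OF P']
  obtain v where v: "v \<in> hom C P' P" "p \<cdot> v = p'" "q \<cdot> v = q'"
    using pullback_lift[OF P d'(1,2,3)] .
  have "v \<cdot> u = Ide C P"
    by (rule pullback_eq[OF P Cmp_in[OF u(1) v(1)] Ide_in[OF hom_Obj(1)[OF u(1)]]])
      (simp_all add: Cmp_assoc[OF u(1) v(1) d(1)] Cmp_assoc[OF u(1) v(1) d(2)] u v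
        Cmp_Ide[OF d(1)] Cmp_Ide[OF d(2)])
  moreover have "u \<cdot> v = Ide C P'"
    by (rule pullback_eq[OF P' Cmp_in[OF v(1) u(1)] Ide_in[OF hom_Obj(2)[OF u(1)]]])
      (simp_all add: Cmp_assoc[OF v(1) u(1) d'(1)] Cmp_assoc[OF v(1) u(1) d'(2)] u v
        Cmp_Ide[OF d'(1)] Cmp_Ide[OF d'(2)])
  ultimately show ?thesis by (rule iso_arrI[OF u(1) v(1)])
qed

lemma pullback_isomorphic:
  assumes "is_pullback C f g P p q" "is_pullback C f g P' p' q'"
  shows "isomorphic C P P'"
proof -
  obtain u where "u \<in> hom C P P'" "p' \<cdot> u = p" "q' \<cdot> u = q"
    using pullback_lift[OF assms(2) pullbackD(1,2,3)[OF assms(1)]] .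
  then show ?thesis using isomorphicI pullback_comparison_iso[OF assms] by blast
qed

lemma pullback_Ide:
  assumes "f \<in> hom C a b"
  shows "is_pullback C (Ide C b) f a f (Ide C a)"
proof (rule pullbackI[OF Ide_in[OF hom_Obj(2)[OF assms]] assms assms Ide_in[OF hom_Obj(1)[OF assms]]])
  show "Ide C b \<cdot> f = f \<cdot> Ide C a" using Ide_Cmp[OF assms] Cmp_Ide[OF assms] by simp
  show "\<exists>u\<in>hom C Z a. f \<cdot> u = s \<and> Ide C a \<cdot> u = t"
    if "s \<in> hom C Z b" "t \<in> hom C Z a" "Ide C b \<cdot> s = f \<cdot> t" for Z s t
    using that Ide_Cmp by metis
  show "u = v" if "u \<in> hom C Z a" "v \<in> hom C Z a" "Ide C a \<cdot> u = Ide C a \<cdot> v" for Z u v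
    using that Ide_Cmp by metis
qed

end

section \<open>Localization\<close>

lemma zig_eq_zigzag: "zig_eq C S X Y p q \<Longrightarrow> zigzag C S X p Y \<and> zigzag C S X q Y"
  by (induction rule: zig_eq.induct) auto

inductive_cases zigzag_NilE: "zigzag C S X [] Y"
inductive_cases zigzag_FwdE: "zigzag C S X (Fwd f # p) Y"
inductive_cases zigzag_BwdE: "zigzag C S X (Bwd f # p) Y"

lemma zigzag_append: "zigzag C S X p Y \<Longrightarrow> zigzag C S Y q Z \<Longrightarrow> zigzag C S X (p @ q) Z"
  by (induction rule: zigzag.induct) (auto intro: zigzag.intros)

lemma zig_eq_append:
  assumes "zig_eq C S Y Z p q" "zigzag C S X l Y" "zigzag C S Z r T"
  shows "zig_eq C S X T (l @ p @ r) (l @ q @ r)"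
  using assms(1)
proof (induction rule: zig_eq.induct)
  case (refl p)
  show ?case by (intro zig_eq.refl zigzag_append[OF assms(2)] zigzag_append[OF refl assms(3)])
next
  case (step a b p q)
  have "zigzag C S X (l @ (p @ a @ q) @ r) T" "zigzag C S X (l @ (p @ b @ q) @ r) T"
    by (intro zigzag_append[OF assms(2)] zigzag_append[OF step(2) assms(3)]
        zigzag_append[OF step(3) assms(3)])+
  then show ?case using zig_eq.step[OF step(1), of X "l @ p" "q @ r" T] by simp
qed (blast intro: zig_eq.intros)+

lemma zig_class_cong: "zig_eq C S X Y p q \<Longrightarrow> zig_class C S X Y p = zig_class C S X Y q"
  unfolding zig_class_def using zig_eq.sym zig_eq.trans by fast

lemma zig_class_eqD:
  "zig_class C S X Y p = zig_class C S X Y q \<Longrightarrow> zigzag C S X q Y \<Longrightarrow> zig_eq C S X Y p q"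
  unfolding zig_class_def using zig_eq.refl by fast


locale localized_category = category C for C :: "('o, 'm, 'z) cat_scheme" (structure) +
  fixes S :: "'m set"
  assumes S_Arr: "S \<subseteq> Arr C"
begin

lemma zigzag_Obj: "zigzag C S X p Y \<Longrightarrow> X \<in> Obj C \<and> Y \<in> Obj C"
  by (induction rule: zigzag.induct) (use S_Arr Dom_in Cod_in in auto)

lemma zigzag_hom: "f \<in> hom C a b \<Longrightarrow> zigzag C S a [Fwd f] b"
  using zigzag.Fwd[of f C S "[]" b] zigzag.Nil[of b C S] hom_Obj(2)[of f a b] by (auto simp: hom_def)

lemma zigzag_inv: "f \<in> S \<Longrightarrow> f \<in> hom C a b \<Longrightarrow> zigzag C S b [Bwd f] a"
  using zigzag.Bwd[of f S C "[]" a] zigzag.Nil[of a C S] hom_Obj(1)[of f a b] by (auto simp: hom_def)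

lemma zig_rel_eq:
  assumes "zig_rel C S l r" "zigzag C S X l Y" "zigzag C S X r Y"
  shows "zig_eq C S X Y l r"
  using zig_eq.step[OF assms(1), of X "[]" "[]" Y] assms by simp

text \<open>The composite of two arrows of a localization is the concatenation of representatives,
  whatever representatives are used.\<close>

lemma localization_Cmp:
  assumes p: "zigzag C S X p Y" and q: "zigzag C S Y q Z"
  shows "zig_class C S Y Z q \<cdot>\<^bsub>localization C S\<^esub> zig_class C S X Y p = zig_class C S X Z (p @ q)"
proof -
  have "zig_eq C S X Z (p' @ q') r \<longleftrightarrow> zig_eq C S X Z (p @ q) r"
    if "zig_eq C S X Y p p'" "zig_eq C S Y Z q q'" for p' q' r
  proof -
    have "zig_eq C S X Z (p @ q) (p' @ q)"
      using zig_eq_append[OF that(1) _ q, of X "[]"] zigzag.Nil[of X C S] zigzag_Obj[OF p] by simp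
    moreover have "zig_eq C S X Z (p' @ q) (p' @ q')"
      using zig_eq_append[OF that(2), of X p' "[]" Z] zigzag.Nil[of Z C S] zigzag_Obj[OF q]
        zig_eq_zigzag[OF that(1)] by simp
    ultimately show ?thesis using zig_eq.sym zig_eq.trans by metis
  qed
  then show ?thesis
    using assms by (auto simp: localization_def zig_class_def intro: zig_eq.refl)
qed

lemma localization_hom: "hom (localization C S) X Y = {zig_class C S X Y p |p. zigzag C S X p Y}"
  by (auto simp: hom_def localization_def zig_class_def)

lemma localization_Ide: "Ide (localization C S) X = zig_class C S X X []"
  by (simp add: localization_def)

lemma localization_category: "category (localization C S)"
proof
  fix f assume "f \<in> Arr (localization C S)"
  then show "Dom (localization C S) f \<in> Obj (localization C S)"
    "Cod (localization C S) f \<in> Obj (localization C S)"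
    using zigzag_Obj by (auto simp: localization_def zig_class_def)
next
  fix a assume "a \<in> Obj (localization C S)"
  then show "Ide (localization C S) a \<in> hom (localization C S) a a"
    unfolding localization_hom localization_Ide
    by (auto simp: localization_def intro!: zigzag.Nil)
next
  fix f a b assume "f \<in> hom (localization C S) a b"
  then obtain p where p: "f = zig_class C S a b p" "zigzag C S a p b"
    unfolding localization_hom by blast
  have n: "zigzag C S a [] a" "zigzag C S b [] b" using zigzag_Obj[OF p(2)] zigzag.Nil by auto
  show "f \<cdot>\<^bsub>localization C S\<^esub> Ide (localization C S) a = f"
    "Ide (localization C S) b \<cdot>\<^bsub>localization C S\<^esub> f = f"
    using localization_Cmp[OF n(1) p(2)] localization_Cmp[OF p(2) n(2)]
    by (simp_all add: localization_Ide p)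
  fix g c assume "g \<in> hom (localization C S) b c"
  then obtain q where q: "g = zig_class C S b c q" "zigzag C S b q c"
    unfolding localization_hom by blast
  show "g \<cdot>\<^bsub>localization C S\<^esub> f \<in> hom (localization C S) a c"
    unfolding localization_hom p q localization_Cmp[OF p(2) q(2)]
    using zigzag_append[OF p(2) q(2)] by blast
  fix h d assume "h \<in> hom (localization C S) c d"
  then obtain r where r: "h = zig_class C S c d r" "zigzag C S c r d"
    unfolding localization_hom by blast
  show "h \<cdot>\<^bsub>localization C S\<^esub> (g \<cdot>\<^bsub>localization C S\<^esub> f) = h \<cdot>\<^bsub>localization C S\<^esub> g \<cdot>\<^bsub>localization C S\<^esub> f"
    unfolding p q r localization_Cmp[OF p(2) q(2)] localization_Cmp[OF q(2) r(2)]
      localization_Cmp[OF p(2) zigzag_append[OF q(2) r(2)]]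
      localization_Cmp[OF zigzag_append[OF p(2) q(2)] r(2)] by simp
qed

lemma localization_Fwd_Cmp:
  assumes "f \<in> hom C a b" "g \<in> hom C b c"
  shows "zig_class C S a c [Fwd (g \<cdot> f)] =
    zig_class C S b c [Fwd g] \<cdot>\<^bsub>localization C S\<^esub> zig_class C S a b [Fwd f]"
proof -
  have "zig_eq C S a c [Fwd f, Fwd g] [Fwd (g \<cdot> f)]"
    using zig_rel_eq[OF zig_rel.intros(2)[OF assms]]
      zigzag_append[OF zigzag_hom[OF assms(1)] zigzag_hom[OF assms(2)]]
      zigzag_hom[OF Cmp_in[OF assms]] by simp
  then show ?thesis
    using localization_Cmp[OF zigzag_hom[OF assms(1)] zigzag_hom[OF assms(2)]]
      zig_class_cong by force
qed

lemma localization_Fwd_Ide: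
  assumes "a \<in> Obj C"
  shows "zig_class C S a a [Fwd (Ide C a)] = Ide (localization C S) a"
  using zig_class_cong[OF zig_rel_eq[OF zig_rel.intros(1)[OF assms] zigzag_hom[OF Ide_in[OF assms]] zigzag.Nil[OF assms]]]
  by (simp add: localization_Ide)

lemma localization_inverse:
  assumes "w \<in> S" "w \<in> hom C a b"
  shows "zig_class C S b a [Bwd w] \<in> hom (localization C S) b a"
    "zig_class C S a b [Fwd w] \<in> hom (localization C S) a b"
    "zig_class C S b a [Bwd w] \<cdot>\<^bsub>localization C S\<^esub> zig_class C S a b [Fwd w] = Ide (localization C S) a"
    "zig_class C S a b [Fwd w] \<cdot>\<^bsub>localization C S\<^esub> zig_class C S b a [Bwd w] = Ide (localization C S) b"
proof -
  note f = zigzag_hom[OF assms(2)] and b = zigzag_inv[OF assms]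
  show "zig_class C S b a [Bwd w] \<in> hom (localization C S) b a"
    "zig_class C S a b [Fwd w] \<in> hom (localization C S) a b"
    unfolding localization_hom using f b by blast+
  have "zig_eq C S a a [Fwd w, Bwd w] []" "zig_eq C S b b [Bwd w, Fwd w] []"
    using zig_rel_eq[OF zig_rel.intros(3)[OF assms(1)]] zig_rel_eq[OF zig_rel.intros(4)[OF assms(1)]]
      zigzag_append[OF f b] zigzag_append[OF b f] zigzag.Nil[of _ C S] zigzag_Obj[OF f] by simp_all
  then show "zig_class C S b a [Bwd w] \<cdot>\<^bsub>localization C S\<^esub> zig_class C S a b [Fwd w] = Ide (localization C S) a"
    "zig_class C S a b [Fwd w] \<cdot>\<^bsub>localization C S\<^esub> zig_class C S b a [Bwd w] = Ide (localization C S) b"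
    using localization_Cmp[OF f b] localization_Cmp[OF b f] zig_class_cong
    by (force simp: localization_Ide)+
qed

end

section \<open>Fibrations in a model category\<close>

lemma has_liftingI:
  assumes "\<And>u v. i \<in> Arr C \<Longrightarrow> p \<in> Arr C \<Longrightarrow> u \<in> hom C (Dom C i) (Dom C p) \<Longrightarrow>
      v \<in> hom C (Cod C i) (Cod C p) \<Longrightarrow> p \<cdot>\<^bsub>C\<^esub> u = v \<cdot>\<^bsub>C\<^esub> i \<Longrightarrow>
      \<exists>h \<in> hom C (Cod C i) (Dom C p). h \<cdot>\<^bsub>C\<^esub> i = u \<and> p \<cdot>\<^bsub>C\<^esub> h = v"
  shows "has_lifting C i p"
  using assms unfolding has_lifting_def is_square_def by blast

context category
begin

lemma has_liftingE:
  assumes "has_lifting C i p" "i \<in> hom C a b" "p \<in> hom C x y" "u \<in> hom C a x" "v \<in> hom C b y"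
    "p \<cdot> u = v \<cdot> i"
  obtains h where "h \<in> hom C b x" "h \<cdot> i = u" "p \<cdot> h = v"
  using assms unfolding has_lifting_def is_square_def by (fastforce simp: hom_def)

text \<open>The retract argument: the lift of the identity along \<open>i\<close> exhibits \<open>f\<close> as a retract of \<open>p\<close>.\<close>

lemma retract_of_factor:
  assumes f: "f \<in> hom C a b" and i: "i \<in> hom C a m" and p: "p \<in> hom C m b"
    and pi: "p \<cdot> i = f" and lift: "has_lifting C i f"
  shows "is_retract C f p"
proof -
  have "f \<cdot> Ide C a = p \<cdot> i" using pi Cmp_Ide[OF f] by simp
  then obtain h where h: "h \<in> hom C m a" "h \<cdot> i = Ide C a" "f \<cdot> h = p"
    using has_liftingE[OF lift i f Ide_in[OF hom_Obj(1)[OF f]] p] by blast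
  note b = hom_Obj(2)[OF f]
  have "is_square C f p i (Ide C b)" "is_square C p f h (Ide C b)"
    using f i p h pi Ide_in[OF b] Ide_Cmp[OF f] Ide_Cmp[OF p] by (auto simp: is_square_def hom_def)
  then show ?thesis
    unfolding is_retract_def using h f Ide_Cmp[OF Ide_in[OF b]] by (auto simp: hom_def)
qed

lemma iso_has_lifting:
  assumes p: "p \<in> hom C x y" and "iso_arr C p"
  shows "has_lifting C i p"
proof (rule has_liftingI)
  obtain q where q: "q \<in> hom C y x" "q \<cdot> p = Ide C x" "p \<cdot> q = Ide C y"
    using iso_arrE[OF assms(2,1)] .
  fix u v assume i: "i \<in> Arr C" and u: "u \<in> hom C (Dom C i) (Dom C p)"
    and v: "v \<in> hom C (Cod C i) (Cod C p)" and e: "p \<cdot> u = v \<cdot> i"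
  have u: "u \<in> hom C (Dom C i) x" and v: "v \<in> hom C (Cod C i) y" using u v p by (auto simp: hom_def)
  have "(q \<cdot> v) \<cdot> i = q \<cdot> (p \<cdot> u)" using Cmp_assoc[OF Arr_hom[OF i] v q(1)] e by simp
  also have "\<dots> = u" using Cmp_assoc[OF u p q(1)] q Ide_Cmp[OF u] by simp
  finally have 1: "(q \<cdot> v) \<cdot> i = u" .
  have 2: "p \<cdot> (q \<cdot> v) = v" using Cmp_assoc[OF v q(1) p] q Ide_Cmp[OF v] by simp
  show "\<exists>h\<in>hom C (Cod C i) (Dom C p). h \<cdot> i = u \<and> p \<cdot> h = v"
    using 1 2 Cmp_in[OF v q(1)] p by (auto simp: hom_def)
qed

lemma pullback_has_lifting:
  assumes P: "is_pullback C f g P p q" and lift: "has_lifting C i f"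
  shows "has_lifting C i q"
proof (rule has_liftingI)
  note d = pullbackD[OF P]
  fix u v assume i: "i \<in> Arr C" and "u \<in> hom C (Dom C i) (Dom C q)"
    and "v \<in> hom C (Cod C i) (Cod C q)" and e: "q \<cdot> u = v \<cdot> i"
  then have u: "u \<in> hom C (Dom C i) P" and v: "v \<in> hom C (Cod C i) (Dom C g)"
    using d by (auto simp: hom_def)
  note i' = Arr_hom[OF i]
  have "f \<cdot> (p \<cdot> u) = (g \<cdot> v) \<cdot> i"
    using Cmp_assoc[OF u d(1,4)] Cmp_assoc[OF u d(2,5)] Cmp_assoc[OF i' v d(5)] d(3) e by simp
  then obtain h where h: "h \<in> hom C (Cod C i) (Dom C f)" "h \<cdot> i = p \<cdot> u" "f \<cdot> h = g \<cdot> v"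
    using has_liftingE[OF lift i' d(4) Cmp_in[OF u d(1)] Cmp_in[OF v d(5)]] by blast
  obtain k where k: "k \<in> hom C (Cod C i) P" "p \<cdot> k = h" "q \<cdot> k = v"
    using pullback_lift[OF P h(1) v h(3)] .
  have "k \<cdot> i = u"
    by (rule pullback_eq[OF P Cmp_in[OF i' k(1)] u])
      (use Cmp_assoc[OF i' k(1) d(1)] Cmp_assoc[OF i' k(1) d(2)] k h e in simp_all)
  then show "\<exists>h\<in>hom C (Cod C i) (Dom C q). h \<cdot> i = u \<and> q \<cdot> h = v"
    using k d(2) by (auto simp: hom_def)
qed

end

context model_structure
begin

lemma Weq_Arr: "f \<in> Weq M \<Longrightarrow> f \<in> Arr C" and Cof_Arr: "f \<in> Cof M \<Longrightarrow> f \<in> Arr C"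
  and Fib_Arr: "f \<in> Fib M \<Longrightarrow> f \<in> Arr C"
  using Weq_sub Cof_sub Fib_sub unfolding wide_subcategory_def by blast+

lemma Weq_Ide: "a \<in> Obj C \<Longrightarrow> Ide C a \<in> Weq M"
  using Weq_sub unfolding wide_subcategory_def by blast

lemma Weq_Cmp: "f \<in> hom C a b \<Longrightarrow> g \<in> hom C b c \<Longrightarrow> f \<in> Weq M \<Longrightarrow> g \<in> Weq M \<Longrightarrow> g \<cdot> f \<in> Weq M"
  using Weq_sub unfolding wide_subcategory_def by (auto simp: hom_def)

lemma Fib_Cmp: "f \<in> hom C a b \<Longrightarrow> g \<in> hom C b c \<Longrightarrow> f \<in> Fib M \<Longrightarrow> g \<in> Fib M \<Longrightarrow> g \<cdot> f \<in> Fib M"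
  using Fib_sub unfolding wide_subcategory_def by (auto simp: hom_def)

lemma Weq_cancel_left:
  "f \<in> hom C a b \<Longrightarrow> g \<in> hom C b c \<Longrightarrow> g \<in> Weq M \<Longrightarrow> g \<cdot> f \<in> Weq M \<Longrightarrow> f \<in> Weq M"
  using two_of_three by blast

lemma Weq_cancel_right:
  "f \<in> hom C a b \<Longrightarrow> g \<in> hom C b c \<Longrightarrow> f \<in> Weq M \<Longrightarrow> g \<cdot> f \<in> Weq M \<Longrightarrow> g \<in> Weq M"
  using two_of_three by blast

lemma factor_cof_tfib:
  assumes "f \<in> hom C a b"
  obtains m i p where "i \<in> hom C a m" "p \<in> hom C m b" "p \<cdot> i = f"
    "i \<in> Cof M" "p \<in> Fib M" "p \<in> Weq M"
proof -
  let ?i = "factL (cof_tfib M) f" and ?p = "factR (cof_tfib M) f"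
  have "?i \<in> hom C a (Cod C ?i)" "?p \<in> hom C (Cod C ?i) b" "?p \<cdot> ?i = f"
    "?i \<in> Cof M" "?p \<in> Fib M" "?p \<in> Weq M"
    using cof_tfib cof_tfib_in assms unfolding functorial_factorization_def hom_def by auto
  then show thesis by (rule that)
qed

lemma factor_tcof_fib:
  assumes "f \<in> hom C a b"
  obtains m i p where "i \<in> hom C a m" "p \<in> hom C m b" "p \<cdot> i = f"
    "i \<in> Cof M" "i \<in> Weq M" "p \<in> Fib M"
proof -
  let ?i = "factL (tcof_fib M) f" and ?p = "factR (tcof_fib M) f"
  have "?i \<in> hom C a (Cod C ?i)" "?p \<in> hom C (Cod C ?i) b" "?p \<cdot> ?i = f"
    "?i \<in> Cof M" "?i \<in> Weq M" "?p \<in> Fib M"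
    using tcof_fib tcof_fib_in assms unfolding functorial_factorization_def hom_def by auto
  then show thesis by (rule that)
qed

lemma Fib_if_has_lifting:
  assumes f: "f \<in> hom C a b" and "\<And>i. i \<in> Cof M \<Longrightarrow> i \<in> Weq M \<Longrightarrow> has_lifting C i f"
  shows "f \<in> Fib M"
proof -
  obtain m i p where "i \<in> hom C a m" "p \<in> hom C m b" "p \<cdot> i = f" "i \<in> Cof M" "i \<in> Weq M" "p \<in> Fib M"
    using factor_tcof_fib[OF f] .
  then show ?thesis using Fib_retract[OF retract_of_factor[OF f]] assms(2) by blast
qed

lemma tfib_if_has_lifting:
  assumes f: "f \<in> hom C a b" and "\<And>i. i \<in> Cof M \<Longrightarrow> has_lifting C i f"
  shows "f \<in> Fib M" "f \<in> Weq M"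
proof -
  obtain m i p where "i \<in> hom C a m" "p \<in> hom C m b" "p \<cdot> i = f" "i \<in> Cof M" "p \<in> Fib M" "p \<in> Weq M"
    using factor_cof_tfib[OF f] .
  then show "f \<in> Fib M" "f \<in> Weq M"
    using Fib_retract[OF retract_of_factor[OF f]] Weq_retract[OF retract_of_factor[OF f]] assms(2)
    by blast+
qed

lemma iso_tfib:
  assumes "f \<in> hom C a b" "iso_arr C f"
  shows "f \<in> Fib M" "f \<in> Weq M"
  using tfib_if_has_lifting[OF assms(1)] iso_has_lifting[OF assms] by blast+

lemma pullback_Fib:
  assumes "is_pullback C f g P p q" "f \<in> Fib M"
  shows "q \<in> Fib M"
  using Fib_if_has_lifting[OF pullbackD(2)[OF assms(1)]] pullback_has_lifting[OF assms(1)]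
    lift_tcof assms(2) by blast

lemma pullback_tfib:
  assumes "is_pullback C f g P p q" "f \<in> Fib M" "f \<in> Weq M"
  shows "q \<in> Fib M" "q \<in> Weq M"
  using tfib_if_has_lifting[OF pullbackD(2)[OF assms(1)]] pullback_has_lifting[OF assms(1)]
    lift_tfib assms(2,3) by blast+

lemma lift_tcofE:
  assumes "i \<in> hom C a b" "i \<in> Cof M" "i \<in> Weq M" "p \<in> hom C x y" "p \<in> Fib M"
    "u \<in> hom C a x" "v \<in> hom C b y" "p \<cdot> u = v \<cdot> i"
  obtains h where "h \<in> hom C b x" "h \<cdot> i = u" "p \<cdot> h = v"
  using has_liftingE[OF lift_tcof[OF assms(2,3,5)] assms(1,4,6,7,8)] .

subsection \<open>The homotopy category\<close>

sublocale Ho: localized_category C "Weq M"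
  by unfold_locales (use Weq_Arr in blast)

sublocale HoC: category "Ho C M"
  unfolding Ho_def by (rule Ho.localization_category)

abbreviation ho :: "'m \<Rightarrow> ('o, 'm) loc_arr" where "ho f \<equiv> to_Ho C M f"

lemma ho_class: "f \<in> hom C a b \<Longrightarrow> ho f = zig_class C (Weq M) a b [Fwd f]"
  by (simp add: to_Ho_def hom_def)

lemma Ho_Obj: "Obj (Ho C M) = Obj C"
  by (simp add: Ho_def localization_def)

lemma ho_in: "f \<in> hom C a b \<Longrightarrow> ho f \<in> hom (Ho C M) a b"
  unfolding Ho_def Ho.localization_hom using ho_class Ho.zigzag_hom by blast

lemma ho_Cmp:
  assumes "f \<in> hom C a b" "g \<in> hom C b c"
  shows "ho (g \<cdot> f) = ho g \<cdot>\<^bsub>Ho C M\<^esub> ho f"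
  using Ho.localization_Fwd_Cmp[OF assms] ho_class assms Cmp_in[OF assms] by (simp add: Ho_def)

lemma ho_Ide: "a \<in> Obj C \<Longrightarrow> ho (Ide C a) = Ide (Ho C M) a"
  using Ho.localization_Fwd_Ide ho_class[OF Ide_in] by (simp add: Ho_def)

lemma ho_Weq:
  assumes "w \<in> Weq M"
  shows "iso_arr (Ho C M) (ho w)"
  using HoC.iso_arrI Ho.localization_inverse[OF assms Arr_hom[OF Weq_Arr[OF assms]]]
    ho_class[OF Arr_hom[OF Weq_Arr[OF assms]]] by (simp add: Ho_def)

lemma ho_iso:
  assumes "f \<in> hom C a b" "iso_arr C f"
  shows "iso_arr (Ho C M) (ho f)"
  using ho_Weq iso_tfib[OF assms] by blast

lemma Weq_isomorphic: "w \<in> hom C a b \<Longrightarrow> w \<in> Weq M \<Longrightarrow> isomorphic (Ho C M) a b"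
  using HoC.isomorphicI[OF ho_in ho_Weq] by blast

lemma isomorphic_Ho: "isomorphic C a b \<Longrightarrow> isomorphic (Ho C M) a b"
  unfolding isomorphic_def[of C] using iso_tfib Weq_isomorphic by blast

end

section \<open>Fibers and points\<close>

locale pointed_model_structure = model_structure C M
  for C :: "('o, 'm, 'z) cat_scheme" (structure) and M :: "'m model" +
  fixes pt :: 'o
  assumes pt_terminal: "is_terminal C pt"
    and pt_cofibrant: "cofibrant C M pt"
    and pullback_exists: "f \<in> hom C a c \<Longrightarrow> g \<in> hom C b c \<Longrightarrow> \<exists>P p q. is_pullback C f g P p q"
begin

definition bang :: "'o \<Rightarrow> 'm" where
  "bang X = (THE f. f \<in> hom C X pt)"

lemma bang_in: "X \<in> Obj C \<Longrightarrow> bang X \<in> hom C X pt"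
  unfolding bang_def by (rule theI') (use pt_terminal in \<open>auto simp: is_terminal_def\<close>)

lemma bang_eq: "f \<in> hom C X pt \<Longrightarrow> g \<in> hom C X pt \<Longrightarrow> f = g"
  using terminal_eq[OF pt_terminal] .

lemma pt_Obj: "pt \<in> Obj C"
  using pt_terminal unfolding is_terminal_def by blast

lemma fibrantD:
  assumes "fibrant C M X"
  shows "X \<in> Obj C" "bang X \<in> Fib M"
proof -
  obtain t f where t: "is_terminal C t" "f \<in> hom C X t" "f \<in> Fib M"
    using assms unfolding fibrant_def by blast
  have b: "bang t \<in> hom C t pt" using bang_in hom_Obj(2)[OF t(2)] by blast
  show X: "X \<in> Obj C" using hom_Obj(1)[OF t(2)] .
  have "bang t \<in> Fib M" using iso_tfib[OF b terminal_iso[OF t(1) pt_terminal b]] by blast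
  then have "bang t \<cdot> f \<in> Fib M" using Fib_Cmp[OF t(2) b t(3)] by blast
  then show "bang X \<in> Fib M" using bang_eq[OF Cmp_in[OF t(2) b] bang_in[OF X]] by simp
qed

lemma fibrantI: "X \<in> Obj C \<Longrightarrow> bang X \<in> Fib M \<Longrightarrow> fibrant C M X"
  unfolding fibrant_def using pt_terminal bang_in by blast

lemma fibrant_if_Fib:
  assumes "f \<in> hom C X Y" "f \<in> Fib M" "fibrant C M Y"
  shows "fibrant C M X"
proof -
  note Y = fibrantD[OF assms(3)]
  have "bang Y \<cdot> f \<in> Fib M" using Fib_Cmp[OF assms(1) bang_in[OF Y(1)] assms(2) Y(2)] .
  then show ?thesis
    using fibrantI bang_eq[OF Cmp_in[OF assms(1) bang_in[OF Y(1)]] bang_in] hom_Obj(1)[OF assms(1)]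
    by simp
qed

lemma point_lift_tfib:
  assumes "f \<in> hom C X Y" "f \<in> Fib M" "f \<in> Weq M" "g \<in> hom C pt Y"
  obtains h where "h \<in> hom C pt X" "f \<cdot> h = g"
proof -
  obtain z c where z: "is_initial C z" and c: "c \<in> hom C z pt" "c \<in> Cof M"
    using pt_cofibrant unfolding cofibrant_def by blast
  obtain u where u: "u \<in> hom C z X" using initial_ex[OF z hom_Obj(1)[OF assms(1)]] .
  have "f \<cdot> u = g \<cdot> c" using initial_eq[OF z] Cmp_in u c assms by blast
  then show thesis
    using has_liftingE[OF lift_tfib[OF c(2) assms(2,3)] c(1) assms(1) u assms(4)] that by blast
qed

lemma retraction_of_tcof:
  assumes "i \<in> hom C X Y" "i \<in> Cof M" "i \<in> Weq M" "fibrant C M X"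
  obtains r where "r \<in> hom C Y X" "r \<cdot> i = Ide C X" "r \<in> Weq M"
proof -
  note X = fibrantD[OF assms(4)]
  note Y = hom_Obj(2)[OF assms(1)]
  have "bang X \<cdot> Ide C X = bang Y \<cdot> i"
    using bang_eq[OF Cmp_in[OF Ide_in[OF X(1)] bang_in[OF X(1)]] Cmp_in[OF assms(1) bang_in[OF Y]]] .
  then obtain r where r: "r \<in> hom C Y X" "r \<cdot> i = Ide C X"
    using lift_tcofE[OF assms(1,2,3) bang_in[OF X(1)] X(2) Ide_in[OF X(1)] bang_in[OF Y]] by blast
  then have "r \<in> Weq M" using Weq_cancel_right[OF assms(1) r(1) assms(3)] Weq_Ide[OF X(1)] by simp
  then show thesis using that r by blast
qed

text \<open>Right properness over a contractible base, in the weak form of an isomorphism in the homotopy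
  category.  With \<open>P = Z \<times> N\<close>, factor \<open>\<delta> = (1, p) : Z \<rightarrow> P\<close> as a trivial cofibration \<open>k\<close> and a
  fibration \<open>e\<close>, which is trivial because the projection of \<open>P\<close> to \<open>Z\<close> is.  Lifting against \<open>k\<close> gives
  a map \<open>\<tau>\<close> transporting a point of \<open>Z\<close> along a second coordinate in \<open>N\<close>.  Over the constant second
  coordinate \<open>n\<close>, \<open>\<tau>\<close> takes values in the fiber, and yields an inverse of the inclusion.\<close>

lemma fiber_over_contractible:
  assumes p: "p \<in> hom C Z N" "p \<in> Fib M" and N: "bang N \<in> Fib M" "bang N \<in> Weq M"
    and n: "n \<in> hom C pt N" and F: "is_pullback C p n F \<iota> t"
  shows "iso_arr (Ho C M) (ho \<iota>)"
proof -
  note ZO = hom_Obj(1)[OF p(1)] and NO = hom_Obj(2)[OF p(1)]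
  note bZ = bang_in[OF ZO] and bN = bang_in[OF NO]
  have \<iota>: "\<iota> \<in> hom C F Z" and t: "t \<in> hom C F pt" and pt: "p \<cdot> \<iota> = n \<cdot> t"
    using pullbackD[OF F] p n by (auto simp: hom_def)
  obtain P b a where P0: "is_pullback C (bang N) (bang Z) P b a"
    using pullback_exists[OF bN bZ] by blast
  have a: "a \<in> hom C P Z" and b: "b \<in> hom C P N"
    using pullbackD[OF P0] bN bZ by (auto simp: hom_def)
  have aw: "a \<in> Fib M" "a \<in> Weq M" using pullback_tfib[OF P0 N] .
  have pair: "\<exists>u \<in> hom C X P. a \<cdot> u = s \<and> b \<cdot> u = s'"
    if "s \<in> hom C X Z" "s' \<in> hom C X N" for X s s'
  proof -
    have "bang N \<cdot> s' = bang Z \<cdot> s"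
      using bang_eq[OF Cmp_in[OF that(2) bN] Cmp_in[OF that(1) bZ]] .
    then show ?thesis
      using pullback_lift[OF P0, of s' X s] that homD(2)[OF bN] homD(2)[OF bZ] by auto
  qed
  have pair_eq: "u = v" if "u \<in> hom C X P" "v \<in> hom C X P" "a \<cdot> u = a \<cdot> v" "b \<cdot> u = b \<cdot> v" for X u v
    using pullback_eq[OF P0] that by blast
  obtain \<delta> where \<delta>: "\<delta> \<in> hom C Z P" "a \<cdot> \<delta> = Ide C Z" "b \<cdot> \<delta> = p"
    using pair[OF Ide_in[OF ZO] p(1)] by blast
  have \<delta>w: "\<delta> \<in> Weq M" using Weq_cancel_left[OF \<delta>(1) a aw(2)] Weq_Ide[OF ZO] \<delta> by simp
  obtain E k e where k: "k \<in> hom C Z E" "k \<in> Cof M" "k \<in> Weq M" and e: "e \<in> hom C E P" "e \<in> Fib M"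
    and ek: "e \<cdot> k = \<delta>"
    using factor_tcof_fib[OF \<delta>(1)] by blast
  have ew: "e \<in> Weq M" using Weq_cancel_right[OF k(1) e(1) k(3)] \<delta>w ek by simp
  have "p \<cdot> Ide C Z = (b \<cdot> e) \<cdot> k" using Cmp_assoc[OF k(1) e(1) b] ek \<delta> Cmp_Ide[OF p(1)] by simp
  then obtain \<tau> where \<tau>: "\<tau> \<in> hom C E Z" "\<tau> \<cdot> k = Ide C Z" "p \<cdot> \<tau> = b \<cdot> e"
    using lift_tcofE[OF k p Ide_in[OF ZO] Cmp_in[OF e(1) b]] by blast
  have \<tau>w: "\<tau> \<in> Weq M" using Weq_cancel_right[OF k(1) \<tau>(1) k(3)] Weq_Ide[OF ZO] \<tau> by simp
  obtain \<nu> where \<nu>: "\<nu> \<in> hom C Z P" "a \<cdot> \<nu> = Ide C Z" "b \<cdot> \<nu> = n \<cdot> bang Z"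
    using pair[OF Ide_in[OF ZO] Cmp_in[OF bZ n]] by blast
  obtain G j \<pi> where G: "is_pullback C e \<nu> G j \<pi>" using pullback_exists[OF e(1) \<nu>(1)] by blast
  have j: "j \<in> hom C G E" and \<pi>: "\<pi> \<in> hom C G Z" and ej: "e \<cdot> j = \<nu> \<cdot> \<pi>"
    using pullbackD[OF G] e \<nu> by (auto simp: hom_def)
  have \<pi>w: "\<pi> \<in> Weq M" using pullback_tfib[OF G e(2) ew] by blast
  have "(a \<cdot> e) \<cdot> j = a \<cdot> (\<nu> \<cdot> \<pi>)" using Cmp_assoc[OF j e(1) a] ej by simp
  also have "\<dots> = \<pi>" using Cmp_assoc[OF \<pi> \<nu>(1) a] \<nu> Ide_Cmp[OF \<pi>] by simp
  finally have jw: "j \<in> Weq M"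
    using Weq_cancel_left[OF j Cmp_in[OF e(1) a] Weq_Cmp[OF e(1) a ew aw(2)]] \<pi>w by simp
  have "e \<cdot> (k \<cdot> \<iota>) = \<nu> \<cdot> \<iota>"
  proof (rule pair_eq[OF Cmp_in[OF Cmp_in[OF \<iota> k(1)] e(1)] Cmp_in[OF \<iota> \<nu>(1)]])
    have 1: "e \<cdot> (k \<cdot> \<iota>) = \<delta> \<cdot> \<iota>" using Cmp_assoc[OF \<iota> k(1) e(1)] ek by simp
    show "a \<cdot> (e \<cdot> (k \<cdot> \<iota>)) = a \<cdot> (\<nu> \<cdot> \<iota>)"
      using 1 Cmp_assoc[OF \<iota> \<delta>(1) a] Cmp_assoc[OF \<iota> \<nu>(1) a] \<delta> \<nu> by simp
    have "b \<cdot> (\<nu> \<cdot> \<iota>) = n \<cdot> (bang Z \<cdot> \<iota>)"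
      using Cmp_assoc[OF \<iota> \<nu>(1) b] \<nu> Cmp_assoc[OF \<iota> bZ n] by simp
    also have "bang Z \<cdot> \<iota> = t" using bang_eq[OF Cmp_in[OF \<iota> bZ] t] .
    finally show "b \<cdot> (e \<cdot> (k \<cdot> \<iota>)) = b \<cdot> (\<nu> \<cdot> \<iota>)"
      using 1 Cmp_assoc[OF \<iota> \<delta>(1) b] \<delta> pt by simp
  qed
  then obtain \<alpha> where \<alpha>: "\<alpha> \<in> hom C F G" "j \<cdot> \<alpha> = k \<cdot> \<iota>" "\<pi> \<cdot> \<alpha> = \<iota>"
    using pullback_lift[OF G, of "k \<cdot> \<iota>" F \<iota>] Cmp_in[OF \<iota> k(1)] \<iota> homD(2)[OF e(1)] homD(2)[OF \<nu>(1)]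
    by auto
  have "p \<cdot> (\<tau> \<cdot> j) = b \<cdot> (e \<cdot> j)" using Cmp_assoc[OF j \<tau>(1) p(1)] \<tau> Cmp_assoc[OF j e(1) b] by simp
  also have "\<dots> = n \<cdot> (bang Z \<cdot> \<pi>)"
    using ej Cmp_assoc[OF \<pi> \<nu>(1) b] \<nu> Cmp_assoc[OF \<pi> bZ n] by simp
  finally obtain \<beta> where \<beta>: "\<beta> \<in> hom C G F" "\<iota> \<cdot> \<beta> = \<tau> \<cdot> j"
    using pullback_lift[OF F, of "\<tau> \<cdot> j" G "bang Z \<cdot> \<pi>"] Cmp_in[OF j \<tau>(1)] Cmp_in[OF \<pi> bZ]
      homD(2)[OF p(1)] homD(2)[OF n] by auto
  have \<beta>\<alpha>: "\<beta> \<cdot> \<alpha> = Ide C F"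
  proof (rule pullback_eq[OF F Cmp_in[OF \<alpha>(1) \<beta>(1)] Ide_in[OF hom_Obj(1)[OF \<iota>]]])
    have "\<iota> \<cdot> (\<beta> \<cdot> \<alpha>) = \<tau> \<cdot> (j \<cdot> \<alpha>)"
      using Cmp_assoc[OF \<alpha>(1) \<beta>(1) \<iota>] \<beta> Cmp_assoc[OF \<alpha>(1) j \<tau>(1)] by simp
    also have "\<dots> = \<iota>" using \<alpha> Cmp_assoc[OF \<iota> k(1) \<tau>(1)] \<tau> Ide_Cmp[OF \<iota>] by simp
    finally show "\<iota> \<cdot> (\<beta> \<cdot> \<alpha>) = \<iota> \<cdot> Ide C F" using Cmp_Ide[OF \<iota>] by simp
    show "t \<cdot> (\<beta> \<cdot> \<alpha>) = t \<cdot> Ide C F"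
      using bang_eq[OF Cmp_in[OF Cmp_in[OF \<alpha>(1) \<beta>(1)] t] Cmp_in[OF Ide_in[OF hom_Obj(1)[OF \<iota>]] t]] .
  qed
  have F': "F \<in> Obj C" using hom_Obj(1)[OF \<iota>] .
  \<comment> \<open>In the homotopy category \<open>\<alpha>\<beta>\<close> is invertible, as \<open>\<pi>\<alpha>\<beta> = \<iota>\<beta> = \<tau>j\<close> is; together with
    \<open>\<beta>\<alpha> = 1\<close> this inverts \<open>\<alpha>\<close>.\<close>
  have "ho \<pi> \<cdot>\<^bsub>Ho C M\<^esub> (ho \<alpha> \<cdot>\<^bsub>Ho C M\<^esub> ho \<beta>) = ho (\<tau> \<cdot> j)"
    using HoC.Cmp_assoc[OF ho_in[OF \<beta>(1)] ho_in[OF \<alpha>(1)] ho_in[OF \<pi>]] ho_Cmp[OF \<alpha>(1) \<pi>]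
      ho_Cmp[OF \<beta>(1) \<iota>] \<alpha> \<beta> by simp
  then have "iso_arr (Ho C M) (ho \<alpha> \<cdot>\<^bsub>Ho C M\<^esub> ho \<beta>)"
    using HoC.iso_cancel_left[OF HoC.Cmp_in[OF ho_in[OF \<beta>(1)] ho_in[OF \<alpha>(1)]] ho_in[OF \<pi>] ho_Weq[OF \<pi>w]]
      ho_Weq[OF Weq_Cmp[OF j \<tau>(1) jw \<tau>w]] by simp
  moreover have "iso_arr (Ho C M) (ho \<beta> \<cdot>\<^bsub>Ho C M\<^esub> ho \<alpha>)"
    using ho_Cmp[OF \<alpha>(1) \<beta>(1)] \<beta>\<alpha> ho_Ide[OF F'] HoC.iso_Ide[of F] F' Ho_Obj by simp
  ultimately have "iso_arr (Ho C M) (ho \<alpha>)"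
    using HoC.two_of_six(1)[OF ho_in[OF \<alpha>(1)] ho_in[OF \<beta>(1)] ho_in[OF \<alpha>(1)]] by blast
  then show ?thesis
    using HoC.iso_Cmp[OF ho_in[OF \<alpha>(1)] ho_in[OF \<pi>] _ ho_Weq[OF \<pi>w]] ho_Cmp[OF \<alpha>(1) \<pi>] \<alpha> by simp
qed

text \<open>The comparison is the inclusion of a fiber of the fibration \<open>Z\<^sub>f\<^sub>u \<rightarrow> X\<^sub>f\<^sub>u\<close> over the contractible
  fiber of \<open>f\<close>.\<close>

lemma fiber_of_composite:
  assumes q: "q \<in> hom C Z X" "q \<in> Fib M" and f: "f \<in> hom C X Y" "f \<in> Fib M" "f \<in> Weq M"
    and u: "u \<in> hom C pt X" and F: "is_pullback C q u F i t"
    and F': "is_pullback C (f \<cdot> q) (f \<cdot> u) F' i' t'"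
    and c: "c \<in> hom C F F'" "i' \<cdot> c = i"
  shows "iso_arr (Ho C M) (ho c)"
proof -
  note fu = Cmp_in[OF u f(1)]
  obtain N tN m where N: "is_pullback C (f \<cdot> u) f N tN m" using pullback_exists[OF fu f(1)] by blast
  have m: "m \<in> hom C N X" and tN: "tN \<in> hom C N pt" and fm: "(f \<cdot> u) \<cdot> tN = f \<cdot> m"
    using pullbackD[OF N] f fu by (auto simp: hom_def)
  have NO: "N \<in> Obj C" using hom_Obj(1)[OF m] .
  have "tN \<in> Fib M" "tN \<in> Weq M" using pullback_tfib[OF pullback_commute[OF N] f(2,3)] .
  then have Nw: "bang N \<in> Fib M" "bang N \<in> Weq M" using bang_eq[OF tN bang_in[OF NO]] by simp_all
  have q': "q \<in> hom C Z (Dom C f)" using q f by (simp add: hom_def)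
  obtain r where r: "r \<in> hom C F' N" "tN \<cdot> r = t'" and R: "is_pullback C m q F' r i'"
    using pullback_unpaste[OF N q' pullback_commute[OF F']] .
  have "(f \<cdot> u) \<cdot> Ide C pt = f \<cdot> u" using Cmp_Ide[OF fu] .
  then obtain n where n: "n \<in> hom C pt N" "m \<cdot> n = u"
    using pullback_lift[OF N, of "Ide C pt" pt u] Ide_in[OF pt_Obj] u homD(2)[OF fu] homD(2)[OF f(1)]
    by auto
  have n': "n \<in> hom C pt (Dom C m)" using n m by (simp add: hom_def)
  obtain d where d: "d \<in> hom C F F'" "i' \<cdot> d = i" and D: "is_pullback C r n F d t"
    using pullback_unpaste[OF pullback_commute[OF R] n'] F n by metis
  have "d = c"
  proof (rule pullback_eq[OF F' d(1) c(1)])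
    show "t' \<cdot> d = t' \<cdot> c"
      using bang_eq[OF Cmp_in[OF d(1) Cmp_in[OF r(1) tN]] Cmp_in[OF c(1) Cmp_in[OF r(1) tN]]] r(2)
      by simp
  qed (use d c in simp)
  moreover have "r \<in> Fib M" using pullback_Fib[OF pullback_commute[OF R] q(2)] .
  ultimately show ?thesis using fiber_over_contractible[OF r(1) _ Nw n(1) D] by simp
qed

subsection \<open>Homotopy-invariant relations between points\<close>

text \<open>These closure properties are what is needed for a relation to contain equality in the homotopy
  category.  They are easy to check for relations about fibers: a map is handled by pulling back, a
  trivial fibration by composing with it.\<close>

definition point_congruence :: "('m \<Rightarrow> 'm \<Rightarrow> bool) \<Rightarrow> bool" where
  "point_congruence R \<longleftrightarrow>
     (\<forall>X u. fibrant C M X \<and> u \<in> hom C pt X \<longrightarrow> R u u) \<and>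
     (\<forall>X u v. fibrant C M X \<and> u \<in> hom C pt X \<and> v \<in> hom C pt X \<and> R u v \<longrightarrow> R v u) \<and>
     (\<forall>X u v w. fibrant C M X \<and> u \<in> hom C pt X \<and> v \<in> hom C pt X \<and> w \<in> hom C pt X \<and>
        R u v \<and> R v w \<longrightarrow> R u w) \<and>
     (\<forall>X Y f u v. fibrant C M X \<and> fibrant C M Y \<and> f \<in> hom C X Y \<and> u \<in> hom C pt X \<and>
        v \<in> hom C pt X \<and> R u v \<longrightarrow> R (f \<cdot> u) (f \<cdot> v)) \<and>
     (\<forall>X Y f u v. fibrant C M X \<and> fibrant C M Y \<and> f \<in> hom C X Y \<and> f \<in> Fib M \<and> f \<in> Weq M \<and>
        u \<in> hom C pt X \<and> v \<in> hom C pt X \<and> R (f \<cdot> u) (f \<cdot> v) \<longrightarrow> R u v)"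

subsection \<open>Fibrant replacement\<close>

definition fibrep :: "'o \<Rightarrow> 'o" where
  "fibrep X = Cod C (factL (tcof_fib M) (bang X))"

definition fibrep_map :: "'o \<Rightarrow> 'm" where
  "fibrep_map X = factL (tcof_fib M) (bang X)"

definition fibrep_arr :: "'m \<Rightarrow> 'm" where
  "fibrep_arr f = factM (tcof_fib M) (bang (Dom C f)) (bang (Cod C f)) f (Ide C pt)"

lemma fibrep_map:
  assumes "X \<in> Obj C"
  shows "fibrep_map X \<in> hom C X (fibrep X)" "fibrep_map X \<in> Weq M" "fibrant C M (fibrep X)"
proof -
  note b = bang_in[OF assms]
  let ?p = "factR (tcof_fib M) (bang X)"
  have p: "?p \<in> hom C (fibrep X) pt" "?p \<in> Fib M"
    and "fibrep_map X \<in> hom C X (fibrep X)" "fibrep_map X \<in> Weq M"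
    using tcof_fib tcof_fib_in b
    unfolding functorial_factorization_def fibrep_def fibrep_map_def hom_def by auto
  then show "fibrep_map X \<in> hom C X (fibrep X)" "fibrep_map X \<in> Weq M" by blast+
  show "fibrant C M (fibrep X)" unfolding fibrant_def using p pt_terminal by blast
qed

lemma fibrep_square:
  assumes "f \<in> hom C X Y"
  shows "is_square C (bang X) (bang Y) f (Ide C pt)"
proof -
  note b = bang_in[OF hom_Obj(1)[OF assms]] bang_in[OF hom_Obj(2)[OF assms]]
  have "bang Y \<cdot> f = Ide C pt \<cdot> bang X"
    using bang_eq[OF Cmp_in[OF assms b(2)] Cmp_in[OF b(1) Ide_in[OF pt_Obj]]] .
  then show ?thesis using b assms Ide_in[OF pt_Obj] unfolding is_square_def by (auto simp: hom_def)
qed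

lemma fibrep_arr_def': "f \<in> hom C X Y \<Longrightarrow> fibrep_arr f = factM (tcof_fib M) (bang X) (bang Y) f (Ide C pt)"
  by (simp add: fibrep_arr_def hom_def)

lemma fibrep_arr:
  assumes "f \<in> hom C X Y"
  shows "fibrep_arr f \<in> hom C (fibrep X) (fibrep Y)"
    "fibrep_arr f \<cdot> fibrep_map X = fibrep_map Y \<cdot> f"
  using tcof_fib fibrep_square[OF assms] fibrep_arr_def'[OF assms]
  unfolding functorial_factorization_def fibrep_def fibrep_map_def by auto

lemma fibrep_arr_Ide: "X \<in> Obj C \<Longrightarrow> fibrep_arr (Ide C X) = Ide C (fibrep X)"
  using tcof_fib bang_in[of X] fibrep_arr_def'[OF Ide_in]
  unfolding functorial_factorization_def fibrep_def by (auto simp: hom_def)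

lemma fibrep_arr_Cmp:
  assumes "f \<in> hom C X Y" "g \<in> hom C Y Z"
  shows "fibrep_arr (g \<cdot> f) = fibrep_arr g \<cdot> fibrep_arr f"
proof -
  have "is_square C (bang X) (bang Y) f (Ide C pt) \<and> is_square C (bang Y) (bang Z) g (Ide C pt)"
    using fibrep_square assms by blast
  then have "factM (tcof_fib M) (bang X) (bang Z) (g \<cdot> f) (Ide C pt \<cdot> Ide C pt) =
      factM (tcof_fib M) (bang Y) (bang Z) g (Ide C pt) \<cdot>
      factM (tcof_fib M) (bang X) (bang Y) f (Ide C pt)"
    using tcof_fib unfolding functorial_factorization_def by blast
  then show ?thesis
    unfolding fibrep_arr_def'[OF assms(1)] fibrep_arr_def'[OF assms(2)]
      fibrep_arr_def'[OF Cmp_in[OF assms]] using Ide_Cmp[OF Ide_in[OF pt_Obj]] by simp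
qed

lemma fibrep_arr_Weq:
  assumes "f \<in> hom C X Y" "f \<in> Weq M"
  shows "fibrep_arr f \<in> Weq M"
proof -
  note X = fibrep_map[OF hom_Obj(1)[OF assms(1)]] and Y = fibrep_map[OF hom_Obj(2)[OF assms(1)]]
  show ?thesis
    using Weq_cancel_right[OF X(1) fibrep_arr(1)[OF assms(1)] X(2)] Weq_Cmp[OF assms(1) Y(1) assms(2) Y(2)]
      fibrep_arr(2)[OF assms(1)] by simp
qed

text \<open>Equality in the homotopy category is itself a congruence, so that the lifting property
  \<open>R_lift\<close> below can be used for it.\<close>

lemma point_congruence_ho: "point_congruence (\<lambda>u v. ho u = ho v)"
proof -
  have reflect: "ho u = ho v" if f: "f \<in> hom C X Y" "f \<in> Weq M" and uv: "u \<in> hom C pt X" "v \<in> hom C pt X"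
    and e: "ho (f \<cdot> u) = ho (f \<cdot> v)" for X Y f u v
  proof -
    obtain g where g: "g \<in> hom (Ho C M) Y X" "g \<cdot>\<^bsub>Ho C M\<^esub> ho f = Ide (Ho C M) X"
      using HoC.iso_arrE[OF ho_Weq[OF f(2)] ho_in[OF f(1)]] .
    have "ho w = g \<cdot>\<^bsub>Ho C M\<^esub> ho (f \<cdot> w)" if "w \<in> hom C pt X" for w
      using HoC.Cmp_assoc[OF ho_in[OF that] ho_in[OF f(1)] g(1)] ho_Cmp[OF that f(1)] g(2)
        HoC.Ide_Cmp[OF ho_in[OF that]] by simp
    then show ?thesis using uv e by simp
  qed
  have preserve: "ho (f \<cdot> u) = ho (f \<cdot> v)"
    if "f \<in> hom C X Y" "u \<in> hom C pt X" "v \<in> hom C pt X" "ho u = ho v" for X Y f u v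
    using ho_Cmp[OF that(2,1)] ho_Cmp[OF that(3,1)] that(4) by simp
  show ?thesis
    unfolding point_congruence_def
  proof (intro conjI allI impI; elim conjE)
    fix X u v w assume "ho u = ho v" "ho v = ho w"
    then show "ho u = ho w" by simp
  next
    fix X u v assume "ho u = ho v"
    then show "ho v = ho u" by simp
  qed (simp, rule preserve, assumption+, rule reflect, assumption+)
qed

end

locale point_relation = pointed_model_structure C M pt
  for C :: "('o, 'm, 'z) cat_scheme" (structure) and M :: "'m model" and pt +
  fixes R :: "'m \<Rightarrow> 'm \<Rightarrow> bool"
  assumes R: "point_congruence R"
begin

lemma R_refl: "fibrant C M X \<Longrightarrow> u \<in> hom C pt X \<Longrightarrow> R u u"
  and R_sym: "fibrant C M X \<Longrightarrow> u \<in> hom C pt X \<Longrightarrow> v \<in> hom C pt X \<Longrightarrow> R u v \<Longrightarrow> R v u"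
  and R_trans: "fibrant C M X \<Longrightarrow> u \<in> hom C pt X \<Longrightarrow> v \<in> hom C pt X \<Longrightarrow> w \<in> hom C pt X \<Longrightarrow>
     R u v \<Longrightarrow> R v w \<Longrightarrow> R u w"
  and R_map: "fibrant C M X \<Longrightarrow> fibrant C M Y \<Longrightarrow> f \<in> hom C X Y \<Longrightarrow> u \<in> hom C pt X \<Longrightarrow>
        v \<in> hom C pt X \<Longrightarrow> R u v \<Longrightarrow> R (f \<cdot> u) (f \<cdot> v)"
  and R_tfib: "fibrant C M X \<Longrightarrow> fibrant C M Y \<Longrightarrow> f \<in> hom C X Y \<Longrightarrow> f \<in> Fib M \<Longrightarrow> f \<in> Weq M \<Longrightarrow>
        u \<in> hom C pt X \<Longrightarrow> v \<in> hom C pt X \<Longrightarrow> R (f \<cdot> u) (f \<cdot> v) \<Longrightarrow> R u v"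
  using R unfolding point_congruence_def by blast+

text \<open>A weak equivalence between fibrant objects is a section of a weak equivalence followed by a
  trivial fibration, and a section reflects every relation that its retraction preserves.\<close>

lemma R_Weq:
  assumes XY: "fibrant C M X" "fibrant C M Y" and f: "f \<in> hom C X Y" "f \<in> Weq M"
    and u: "u \<in> hom C pt X" and v: "v \<in> hom C pt X" and e: "R (f \<cdot> u) (f \<cdot> v)"
  shows "R u v"
proof -
  obtain D i q where i: "i \<in> hom C X D" "i \<in> Cof M" "i \<in> Weq M" and q: "q \<in> hom C D Y" "q \<in> Fib M"
    and qi: "q \<cdot> i = f"
    using factor_tcof_fib[OF f(1)] by blast
  have qw: "q \<in> Weq M" using Weq_cancel_right[OF i(1) q(1) i(3)] f qi by simp
  have D: "fibrant C M D" using fibrant_if_Fib[OF q XY(2)] .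
  obtain r where r: "r \<in> hom C D X" "r \<cdot> i = Ide C X" using retraction_of_tcof[OF i XY(1)] by blast
  have "R (q \<cdot> (i \<cdot> u)) (q \<cdot> (i \<cdot> v))"
    using e Cmp_assoc[OF u i(1) q(1)] Cmp_assoc[OF v i(1) q(1)] qi by simp
  then have "R (i \<cdot> u) (i \<cdot> v)"
    using R_tfib[OF D XY(2) q qw Cmp_in[OF u i(1)] Cmp_in[OF v i(1)]] by blast
  then have "R (r \<cdot> (i \<cdot> u)) (r \<cdot> (i \<cdot> v))"
    using R_map[OF D XY(1) r(1) Cmp_in[OF u i(1)] Cmp_in[OF v i(1)]] by blast
  then show ?thesis
    using Cmp_assoc[OF u i(1) r(1)] Cmp_assoc[OF v i(1) r(1)] r Ide_Cmp[OF u] Ide_Cmp[OF v] by simp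
qed

text \<open>A point lifts strictly along the trivial fibration, and up to \<open>R\<close> along the section.\<close>

lemma R_lift:
  assumes XY: "fibrant C M X" "fibrant C M Y" and f: "f \<in> hom C X Y" "f \<in> Weq M"
    and g: "g \<in> hom C pt Y"
  obtains h where "h \<in> hom C pt X" "R (f \<cdot> h) g"
proof -
  obtain D i q where i: "i \<in> hom C X D" "i \<in> Cof M" "i \<in> Weq M" and q: "q \<in> hom C D Y" "q \<in> Fib M"
    and qi: "q \<cdot> i = f"
    using factor_tcof_fib[OF f(1)] by blast
  have qw: "q \<in> Weq M" using Weq_cancel_right[OF i(1) q(1) i(3)] f qi by simp
  have D: "fibrant C M D" using fibrant_if_Fib[OF q XY(2)] .
  obtain r where r: "r \<in> hom C D X" "r \<cdot> i = Ide C X" "r \<in> Weq M"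
    using retraction_of_tcof[OF i XY(1)] .
  obtain k where k: "k \<in> hom C pt D" "q \<cdot> k = g" using point_lift_tfib[OF q qw g] .
  define h where "h = r \<cdot> k"
  have h: "h \<in> hom C pt X" unfolding h_def using Cmp_in[OF k(1) r(1)] .
  have "r \<cdot> (i \<cdot> h) = r \<cdot> k"
    using Cmp_assoc[OF h i(1) r(1)] r Ide_Cmp[OF h] h_def by simp
  then have "R (r \<cdot> (i \<cdot> h)) (r \<cdot> k)" using R_refl[OF XY(1) h] h_def by simp
  then have "R (i \<cdot> h) k" using R_Weq[OF D XY(1) r(1,3) Cmp_in[OF h i(1)] k(1)] by blast
  then have "R (q \<cdot> (i \<cdot> h)) (q \<cdot> k)" using R_map[OF D XY(2) q(1) Cmp_in[OF h i(1)] k(1)] by blast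
  then have "R (f \<cdot> h) g" using Cmp_assoc[OF h i(1) q(1)] qi k by simp
  then show thesis using that h by blast
qed

text \<open>Arrows of the homotopy category are zigzags up to elementary relations.  A zigzag acts as a
  relation between the points of the fibrant replacements of its ends, modulo \<open>R\<close>: a reversed weak
  equivalence acts as the converse of a forward one.  This action turns out to respect the elementary
  relations.  The target point is passed as a predicate, which is transported backwards.\<close>

primrec transport :: "'m zig \<Rightarrow> ('m \<Rightarrow> bool) \<Rightarrow> 'm \<Rightarrow> bool" where
  "transport (Fwd f) Q u \<longleftrightarrow> Q (fibrep_arr f \<cdot> u)"
| "transport (Bwd w) Q u \<longleftrightarrow>
     (\<exists>u' \<in> hom C pt (fibrep (Dom C w)). R (fibrep_arr w \<cdot> u') u \<and> Q u')"

definition transports :: "'m zig list \<Rightarrow> 'm \<Rightarrow> 'm \<Rightarrow> bool" where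
  "transports p v = foldr transport p (\<lambda>u. R u v)"

lemma transports_simps:
  "transports [] v u = R u v"
  "transports (Fwd f # p) v u = transports p v (fibrep_arr f \<cdot> u)"
  "transports (Bwd w # p) v u =
     (\<exists>u' \<in> hom C pt (fibrep (Dom C w)). R (fibrep_arr w \<cdot> u') u \<and> transports p v u')"
  by (simp_all add: transports_def)

lemma transports_cong:
  assumes "zigzag C (Weq M) X p Y" "v \<in> hom C pt (fibrep Y)"
    "u \<in> hom C pt (fibrep X)" "u' \<in> hom C pt (fibrep X)" "R u u'" "transports p v u"
  shows "transports p v u'"
  using assms
proof (induction arbitrary: u u' rule: zigzag.induct)
  case (Nil X)
  note F = fibrep_map(3)[OF Nil(1)]
  have "R u' v" using R_trans[OF F Nil(4,3,2) R_sym[OF F Nil(3,4,5)]] Nil(6)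
    by (simp add: transports_simps)
  then show ?case by (simp add: transports_simps)
next
  case (Fwd f p Y)
  note f = Arr_hom[OF Fwd(1)]
  note fX = fibrep_map(3)[OF hom_Obj(1)[OF f]] and fY = fibrep_map(3)[OF hom_Obj(2)[OF f]]
  note Rf = fibrep_arr(1)[OF f]
  show ?case
    using Fwd.IH[OF Fwd.prems(1) Cmp_in[OF Fwd.prems(2) Rf] Cmp_in[OF Fwd.prems(3) Rf]
        R_map[OF fX fY Rf Fwd.prems(2,3,4)]] Fwd.prems(5)
    by (simp add: transports_simps)
next
  case (Bwd w p Y)
  note w = Arr_hom[OF Weq_Arr[OF Bwd(1)]]
  note fY = fibrep_map(3)[OF hom_Obj(2)[OF w]]
  note Rf = fibrep_arr(1)[OF w]
  obtain z where z: "z \<in> hom C pt (fibrep (Dom C w))" "R (fibrep_arr w \<cdot> z) u" "transports p v z"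
    using Bwd.prems(5) by (auto simp: transports_simps)
  have "R (fibrep_arr w \<cdot> z) u'"
    using R_trans[OF fY Cmp_in[OF z(1) Rf] Bwd.prems(2,3) z(2) Bwd.prems(4)] .
  then show ?case using z by (auto simp: transports_simps)
qed

text \<open>The two relations that cancel a weak equivalence against its reverse hold because \<open>R\<close> is
  reflected by weak equivalences and because points lift along them up to \<open>R\<close>.\<close>

lemma transports_zig_rel:
  assumes "zig_rel C (Weq M) l r" "zigzag C (Weq M) X (l @ q) Y" "zigzag C (Weq M) X (r @ q) Y"
    and v: "v \<in> hom C pt (fibrep Y)" and u: "u \<in> hom C pt (fibrep X)"
  shows "transports (l @ q) v u = transports (r @ q) v u"
  using assms(1)
proof cases
  case (1 a)
  then have "X = a" using assms(2) Ide_in[of a] by (auto elim!: zigzag_FwdE simp: hom_def)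
  then show ?thesis using 1 fibrep_arr_Ide Ide_Cmp[OF u] by (simp add: transports_simps)
next
  case (2 f a b g c)
  then have "X = a" using assms(2) by (auto elim!: zigzag_FwdE simp: hom_def)
  then have u: "u \<in> hom C pt (fibrep a)" using u by simp
  show ?thesis using 2 fibrep_arr_Cmp[OF 2(3,4)]
      Cmp_assoc[OF u fibrep_arr(1)[OF 2(3)] fibrep_arr(1)[OF 2(4)]] by (simp add: transports_simps)
next
  case (3 w)
  note w = Arr_hom[OF Weq_Arr[OF 3(3)]]
  note Rf = fibrep_arr(1)[OF w]
  note fX = fibrep_map(3)[OF hom_Obj(1)[OF w]] and fY = fibrep_map(3)[OF hom_Obj(2)[OF w]]
  have X: "X = Dom C w" using assms(2) 3 by (auto elim!: zigzag_FwdE)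
  have u: "u \<in> hom C pt (fibrep (Dom C w))" using u X by simp
  have q: "zigzag C (Weq M) (Dom C w) q Y" using assms(3) 3 X by simp
  have "transports q v u" if z: "z \<in> hom C pt (fibrep (Dom C w))"
    "R (fibrep_arr w \<cdot> z) (fibrep_arr w \<cdot> u)" "transports q v z" for z
    using transports_cong[OF q v z(1) u R_Weq[OF fX fY Rf fibrep_arr_Weq[OF w 3(3)] z(1) u z(2)] z(3)] .
  moreover have "R (fibrep_arr w \<cdot> u) (fibrep_arr w \<cdot> u)" using R_refl[OF fY Cmp_in[OF u Rf]] .
  ultimately show ?thesis using 3 u by (auto simp: transports_simps)
next
  case (4 w)
  note w = Arr_hom[OF Weq_Arr[OF 4(3)]]
  note Rf = fibrep_arr(1)[OF w]
  note fX = fibrep_map(3)[OF hom_Obj(1)[OF w]] and fY = fibrep_map(3)[OF hom_Obj(2)[OF w]]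
  have X: "X = Cod C w" using assms(2) 4 by (auto elim!: zigzag_BwdE)
  have u: "u \<in> hom C pt (fibrep (Cod C w))" using u X by simp
  have q: "zigzag C (Weq M) (Cod C w) q Y" using assms(3) 4 X by simp
  obtain z where z: "z \<in> hom C pt (fibrep (Dom C w))" "R (fibrep_arr w \<cdot> z) u"
    using R_lift[OF fX fY Rf fibrep_arr_Weq[OF w 4(3)] u] .
  have "transports q v (fibrep_arr w \<cdot> z')" if "z' \<in> hom C pt (fibrep (Dom C w))"
    "R (fibrep_arr w \<cdot> z') u" "transports q v u" for z'
    using transports_cong[OF q v u Cmp_in[OF that(1) Rf] R_sym[OF fY Cmp_in[OF that(1) Rf] u that(2)] that(3)] .
  moreover have "transports q v u" if "z' \<in> hom C pt (fibrep (Dom C w))"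
    "R (fibrep_arr w \<cdot> z') u" "transports q v (fibrep_arr w \<cdot> z')" for z'
    using transports_cong[OF q v Cmp_in[OF that(1) Rf] u that(2,3)] .
  ultimately show ?thesis using 4 z by (auto simp: transports_simps)
qed

lemma transports_append_cong:
  assumes "\<And>Z u. zigzag C (Weq M) Z l Y \<Longrightarrow> zigzag C (Weq M) Z r Y \<Longrightarrow> u \<in> hom C pt (fibrep Z) \<Longrightarrow>
      transports l v u = transports r v u"
    and "zigzag C (Weq M) X (p @ l) Y" "zigzag C (Weq M) X (p @ r) Y" "u \<in> hom C pt (fibrep X)"
  shows "transports (p @ l) v u = transports (p @ r) v u"
  using assms(2-)
proof (induction p arbitrary: X u)
  case Nil
  then show ?case using assms(1) by simp
next
  case (Cons a p)
  show ?case
  proof (cases a)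
    case (Fwd f)
    then have f: "f \<in> Arr C" "X = Dom C f" and z: "zigzag C (Weq M) (Cod C f) (p @ l) Y"
      "zigzag C (Weq M) (Cod C f) (p @ r) Y"
      using Cons.prems by (auto elim: zigzag_FwdE)
    have u: "u \<in> hom C pt (fibrep (Dom C f))" using Cons.prems f by simp
    show ?thesis
      using Cons.IH[OF z Cmp_in[OF u fibrep_arr(1)[OF Arr_hom[OF f(1)]]]] Fwd
      by (simp add: transports_simps)
  next
    case (Bwd w)
    then have "zigzag C (Weq M) (Dom C w) (p @ l) Y" "zigzag C (Weq M) (Dom C w) (p @ r) Y"
      using Cons.prems by (auto elim: zigzag_BwdE)
    then show ?thesis using Cons.IH Bwd by (auto simp: transports_simps)
  qed
qed

lemma transports_zig_eq:
  assumes "zig_eq C (Weq M) X Y p q" "v \<in> hom C pt (fibrep Y)" "u \<in> hom C pt (fibrep X)"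
  shows "transports p v u = transports q v u"
  using assms(1)
proof (induction rule: zig_eq.induct)
  case (step l r p q)
  show ?case
  proof (rule transports_append_cong[OF _ step(2,3) assms(3)])
    fix Z u assume "zigzag C (Weq M) Z (l @ q) Y" "zigzag C (Weq M) Z (r @ q) Y" "u \<in> hom C pt (fibrep Z)"
    then show "transports (l @ q) v u = transports (r @ q) v u"
      using transports_zig_rel[OF step(1) _ _ assms(2)] by blast
  qed
qed auto

text \<open>Both one-letter zigzags \<open>g\<close> and \<open>g'\<close> act on the map from the point to its fibrant replacement.\<close>

theorem R_if_ho_eq:
  assumes X: "fibrant C M X" and g: "g \<in> hom C pt X" and g': "g' \<in> hom C pt X" and e: "ho g = ho g'"
  shows "R g g'"
proof -
  have z: "zig_eq C (Weq M) pt X [Fwd g] [Fwd g']"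
    using zig_class_eqD[OF e[unfolded ho_class[OF g] ho_class[OF g']]] Ho.zigzag_hom[OF g'] by blast
  note r = fibrep_map[OF pt_Obj] and s = fibrep_map[OF fibrantD(1)[OF X]]
  let ?v = "fibrep_arr g \<cdot> fibrep_map pt"
  have v: "?v \<in> hom C pt (fibrep X)" using Cmp_in[OF r(1) fibrep_arr(1)[OF g]] .
  have "R (fibrep_arr g' \<cdot> fibrep_map pt) ?v"
    using transports_zig_eq[OF z v r(1)] R_refl[OF s(3) v] by (simp add: transports_simps)
  then have "R (fibrep_map X \<cdot> g') (fibrep_map X \<cdot> g)"
    using fibrep_arr(2)[OF g] fibrep_arr(2)[OF g'] by simp
  then have "R g' g" using R_Weq[OF X s(3) s(1,2) g' g] by blast
  then show ?thesis using R_sym[OF X g' g] by blast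
qed

end

context pointed_model_structure
begin

lemma ho_eq_imp:
  assumes "point_congruence R" "fibrant C M X" "g \<in> hom C pt X" "g' \<in> hom C pt X" "ho g = ho g'"
  shows "R g g'"
proof -
  interpret point_relation C M pt R by unfold_locales (rule assms(1))
  show ?thesis using R_if_ho_eq[OF assms(2-)] .
qed

text \<open>By induction along the zigzag, the point is represented in the fibrant replacement of each
  object: forward arrows are applied, and the point is lifted along reversed weak equivalences.\<close>

theorem point_representable:
  assumes X: "fibrant C M X" and x: "x \<in> hom (Ho C M) pt X"
  obtains g where "g \<in> hom C pt X" "x = ho g"
proof -
  interpret point_relation C M pt "\<lambda>u v. ho u = ho v"
    by unfold_locales (rule point_congruence_ho)
  let ?H = "Ho C M"
  have *: "\<exists>h \<in> hom C pt (fibrep Z). ho h = ho (fibrep_map Z) \<cdot>\<^bsub>?H\<^esub> (zig_class C (Weq M) Y Z p \<cdot>\<^bsub>?H\<^esub> y)"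
    if "zigzag C (Weq M) Y p Z" "y \<in> hom ?H pt Y"
      "g \<in> hom C pt (fibrep Y)" "ho g = ho (fibrep_map Y) \<cdot>\<^bsub>?H\<^esub> y" for Y p Z y g
    using that
  proof (induction arbitrary: y g rule: zigzag.induct)
    case (Nil Y)
    then show ?case using HoC.Ide_Cmp[OF Nil(2)] Ho.localization_Ide by (auto simp: Ho_def)
  next
    case (Fwd f p Z)
    note f = Arr_hom[OF Fwd(1)]
    note Y = fibrep_map[OF hom_Obj(1)[OF f]] and Y' = fibrep_map[OF hom_Obj(2)[OF f]]
    note Rf = fibrep_arr[OF f]
    have "ho (fibrep_arr f \<cdot> g) = ho (fibrep_arr f) \<cdot>\<^bsub>?H\<^esub> (ho (fibrep_map (Dom C f)) \<cdot>\<^bsub>?H\<^esub> y)"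
      using ho_Cmp[OF Fwd(5) Rf(1)] Fwd(6) by simp
    also have "\<dots> = ho (fibrep_map (Cod C f)) \<cdot>\<^bsub>?H\<^esub> (ho f \<cdot>\<^bsub>?H\<^esub> y)"
      using HoC.Cmp_assoc[OF Fwd(4) ho_in[OF Y(1)] ho_in[OF Rf(1)]] ho_Cmp[OF Y(1) Rf(1)]
        HoC.Cmp_assoc[OF Fwd(4) ho_in[OF f] ho_in[OF Y'(1)]] ho_Cmp[OF f Y'(1)] Rf(2) by simp
    finally obtain h where h: "h \<in> hom C pt (fibrep Z)"
      "ho h = ho (fibrep_map Z) \<cdot>\<^bsub>?H\<^esub> (zig_class C (Weq M) (Cod C f) Z p \<cdot>\<^bsub>?H\<^esub> (ho f \<cdot>\<^bsub>?H\<^esub> y))"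
      using Fwd.IH[OF HoC.Cmp_in[OF Fwd(4) ho_in[OF f]] Cmp_in[OF Fwd(5) Rf(1)]] by blast
    have c: "zig_class C (Weq M) (Cod C f) Z p \<in> hom ?H (Cod C f) Z"
      unfolding Ho_def Ho.localization_hom using Fwd(2) by blast
    have "zig_class C (Weq M) (Cod C f) Z p \<cdot>\<^bsub>?H\<^esub> ho f = zig_class C (Weq M) (Dom C f) Z (Fwd f # p)"
      using Ho.localization_Cmp[OF Ho.zigzag_hom[OF f] Fwd(2)] ho_class[OF f] by (simp add: Ho_def)
    then show ?case
      using h HoC.Cmp_assoc[OF Fwd(4) ho_in[OF f] c] by auto
  next
    case (Bwd w p Z)
    note w = Arr_hom[OF Weq_Arr[OF Bwd(1)]]
    note Y = fibrep_map[OF hom_Obj(2)[OF w]] and Y' = fibrep_map[OF hom_Obj(1)[OF w]]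
    note Rw = fibrep_arr[OF w]
    let ?b = "zig_class C (Weq M) (Cod C w) (Dom C w) [Bwd w]"
    note inv = Ho.localization_inverse[OF Bwd(1) w, folded ho_class[OF w] Ho_def]
    obtain g' where g': "g' \<in> hom C pt (fibrep (Dom C w))" "ho (fibrep_arr w \<cdot> g') = ho g"
      using R_lift[OF Y'(3) Y(3) Rw(1) fibrep_arr_Weq[OF w Bwd(1)] Bwd(5)] .
    note yb = HoC.Cmp_in[OF Bwd(4) inv(1)]
    have "ho (fibrep_arr w) \<cdot>\<^bsub>?H\<^esub> (ho (fibrep_map (Dom C w)) \<cdot>\<^bsub>?H\<^esub> (?b \<cdot>\<^bsub>?H\<^esub> y))
      = ho (fibrep_map (Cod C w)) \<cdot>\<^bsub>?H\<^esub> (ho w \<cdot>\<^bsub>?H\<^esub> (?b \<cdot>\<^bsub>?H\<^esub> y))"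
      using HoC.Cmp_assoc[OF yb ho_in[OF Y'(1)] ho_in[OF Rw(1)]] ho_Cmp[OF Y'(1) Rw(1)]
        HoC.Cmp_assoc[OF yb ho_in[OF w] ho_in[OF Y(1)]] ho_Cmp[OF w Y(1)] Rw(2) by simp
    also have "\<dots> = ho g"
      using HoC.Cmp_assoc[OF Bwd(4) inv(1,2)] inv(4) HoC.Ide_Cmp[OF Bwd(4)] Bwd(6) by simp
    also have "\<dots> = ho (fibrep_arr w) \<cdot>\<^bsub>?H\<^esub> ho g'"
      using g' ho_Cmp[OF g'(1) Rw(1)] by simp
    finally have e: "ho (fibrep_arr w) \<cdot>\<^bsub>?H\<^esub> (ho (fibrep_map (Dom C w)) \<cdot>\<^bsub>?H\<^esub> (?b \<cdot>\<^bsub>?H\<^esub> y))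
      = ho (fibrep_arr w) \<cdot>\<^bsub>?H\<^esub> ho g'" .
    obtain k where k: "k \<in> hom ?H (fibrep (Cod C w)) (fibrep (Dom C w))"
      "k \<cdot>\<^bsub>?H\<^esub> ho (fibrep_arr w) = Ide ?H (fibrep (Dom C w))"
      using HoC.iso_arrE[OF ho_Weq[OF fibrep_arr_Weq[OF w Bwd(1)]] ho_in[OF Rw(1)]] .
    have "z = k \<cdot>\<^bsub>?H\<^esub> (ho (fibrep_arr w) \<cdot>\<^bsub>?H\<^esub> z)" if "z \<in> hom ?H pt (fibrep (Dom C w))" for z
      using HoC.Cmp_assoc[OF that ho_in[OF Rw(1)] k(1)] k(2) HoC.Ide_Cmp[OF that] by simp
    then have "ho g' = ho (fibrep_map (Dom C w)) \<cdot>\<^bsub>?H\<^esub> (?b \<cdot>\<^bsub>?H\<^esub> y)"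
      using e ho_in[OF g'(1)] HoC.Cmp_in[OF yb ho_in[OF Y'(1)]] by metis
    then obtain h where h: "h \<in> hom C pt (fibrep Z)"
      "ho h = ho (fibrep_map Z) \<cdot>\<^bsub>?H\<^esub> (zig_class C (Weq M) (Dom C w) Z p \<cdot>\<^bsub>?H\<^esub> (?b \<cdot>\<^bsub>?H\<^esub> y))"
      using Bwd.IH[OF yb g'(1)] by blast
    have c: "zig_class C (Weq M) (Dom C w) Z p \<in> hom ?H (Dom C w) Z"
      unfolding Ho_def Ho.localization_hom using Bwd(2) by blast
    have "zig_class C (Weq M) (Dom C w) Z p \<cdot>\<^bsub>?H\<^esub> ?b = zig_class C (Weq M) (Cod C w) Z (Bwd w # p)"
      using Ho.localization_Cmp[OF Ho.zigzag_inv[OF Bwd(1) w] Bwd(2)] by (simp add: Ho_def)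
    then show ?case
      using h HoC.Cmp_assoc[OF Bwd(4) inv(1) c] by auto
  qed
  obtain p where p: "x = zig_class C (Weq M) pt X p" "zigzag C (Weq M) pt p X"
    using x unfolding Ho_def Ho.localization_hom by blast
  note r = fibrep_map[OF pt_Obj] and s = fibrep_map[OF fibrantD(1)[OF X]]
  note one = HoC.Ide_in[of pt, unfolded Ho_Obj, OF pt_Obj]
  have "ho (fibrep_map pt) = ho (fibrep_map pt) \<cdot>\<^bsub>?H\<^esub> Ide ?H pt"
    using HoC.Cmp_Ide[OF ho_in[OF r(1)]] by simp
  from *[OF p(2) one r(1) this] obtain h where h: "h \<in> hom C pt (fibrep X)"
    "ho h = ho (fibrep_map X) \<cdot>\<^bsub>?H\<^esub> x"
    using p HoC.Cmp_Ide[OF x] by auto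
  obtain g where g: "g \<in> hom C pt X" "ho (fibrep_map X \<cdot> g) = ho h" using R_lift[OF X s(3,1,2) h(1)] .
  obtain k where k: "k \<in> hom ?H (fibrep X) X" "k \<cdot>\<^bsub>?H\<^esub> ho (fibrep_map X) = Ide ?H X"
    using HoC.iso_arrE[OF ho_Weq[OF s(2)] ho_in[OF s(1)]] .
  have "z = k \<cdot>\<^bsub>?H\<^esub> (ho (fibrep_map X) \<cdot>\<^bsub>?H\<^esub> z)" if "z \<in> hom ?H pt X" for z
    using HoC.Cmp_assoc[OF that ho_in[OF s(1)] k(1)] k(2) HoC.Ide_Cmp[OF that] by simp
  then have "x = ho g" using g h ho_Cmp[OF g(1) s(1)] x ho_in[OF g(1)] by metis
  then show thesis using that g by blast
qed

end

section \<open>Homotopy invariance of fibers\<close>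

context pointed_model_structure
begin

lemma fiberD:
  assumes "is_pullback C q u F i t" "q \<in> hom C Z X" "u \<in> hom C pt X"
  shows "i \<in> hom C F Z" "t \<in> hom C F pt" "q \<cdot> i = u \<cdot> t"
  using pullbackD[OF assms(1)] assms(2,3) by (auto simp: hom_def)

lemma fiber_lift:
  assumes F: "is_pullback C q u F i t" and q: "q \<in> hom C Z X" and u: "u \<in> hom C pt X"
    and s: "s \<in> hom C S Z" and b: "b \<in> hom C S pt" and e: "q \<cdot> s = u \<cdot> b"
  obtains h where "h \<in> hom C S F" "i \<cdot> h = s"
  using pullback_lift[OF F, unfolded homD(2)[OF q] homD(2)[OF u], OF s b e] by blast

lemma fiber_eq:
  assumes F: "is_pullback C q u F i t" and q: "q \<in> hom C Z X" and u: "u \<in> hom C pt X"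
    and h: "h \<in> hom C S F" "h' \<in> hom C S F" and e: "i \<cdot> h = i \<cdot> h'"
  shows "h = h'"
  using pullback_eq[OF F h e] bang_eq Cmp_in[OF h(1)] Cmp_in[OF h(2)] fiberD(2)[OF F q u] by blast

lemma fiber_of_composite_comparison:
  assumes q: "q \<in> hom C Z X" "q \<in> Fib M" and f: "f \<in> hom C X Y" "f \<in> Fib M" "f \<in> Weq M"
    and u: "u \<in> hom C pt X" and F: "is_pullback C q u F i t"
    and F': "is_pullback C (f \<cdot> q) (f \<cdot> u) F' i' t'"
  obtains c where "c \<in> hom C F F'" "i' \<cdot> c = i" "iso_arr (Ho C M) (ho c)"
proof -
  note d = fiberD[OF F q(1) u]
  have "(f \<cdot> q) \<cdot> i = (f \<cdot> u) \<cdot> t"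
    using Cmp_assoc[OF d(1) q(1) f(1)] Cmp_assoc[OF d(2) u f(1)] d(3) by simp
  then obtain c where c: "c \<in> hom C F F'" "i' \<cdot> c = i"
    using fiber_lift[OF F' Cmp_in[OF q(1) f(1)] Cmp_in[OF u f(1)] d(1,2)] by blast
  then show thesis using that fiber_of_composite[OF q f u F F' c] by blast
qed

text \<open>A fibration over \<open>Y\<close> is pulled back along a map \<open>X \<rightarrow> Y\<close> without changing fibers, and a
  fibration over \<open>X\<close> is composed with a trivial fibration \<open>X \<rightarrow> Y\<close> without changing fibers up to
  equivalence.  Hence the following relation is a congruence.\<close>

definition same_fibers :: "'m \<Rightarrow> 'm \<Rightarrow> bool" where
  "same_fibers u v \<longleftrightarrow> (\<forall>q F i t F' i' t'. q \<in> Fib M \<and> is_pullback C q u F i t \<and>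
     is_pullback C q v F' i' t' \<longrightarrow> isomorphic (Ho C M) F F')"

lemma point_congruence_same_fibers: "point_congruence same_fibers"
  unfolding point_congruence_def
proof (intro conjI allI impI; elim conjE)
  fix X u
  show "same_fibers u u"
    unfolding same_fibers_def using pullback_isomorphic isomorphic_Ho by blast
next
  fix X u v assume "same_fibers u v"
  then show "same_fibers v u"
    unfolding same_fibers_def using HoC.isomorphic_sym by blast
next
  fix X u v w assume v: "v \<in> hom C pt X" and 1: "same_fibers u v" and 2: "same_fibers v w"
    and u: "u \<in> hom C pt X" and w: "w \<in> hom C pt X"
  show "same_fibers u w"
    unfolding same_fibers_def
  proof (intro allI impI; elim conjE)
    fix q F i t F' i' t' assume q: "q \<in> Fib M" "is_pullback C q u F i t" "is_pullback C q w F' i' t'"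
    have "q \<in> hom C (Dom C q) X" using pullbackD[OF q(2)] u Fib_Arr[OF q(1)] by (auto simp: hom_def)
    then obtain G j s where "is_pullback C q v G j s" using pullback_exists v by blast
    then show "isomorphic (Ho C M) F F'"
      using 1 2 q HoC.isomorphic_trans unfolding same_fibers_def by blast
  qed
next
  fix X Y f u v assume f: "f \<in> hom C X Y" and u: "u \<in> hom C pt X" and v: "v \<in> hom C pt X"
    and R: "same_fibers u v"
  show "same_fibers (f \<cdot> u) (f \<cdot> v)"
    unfolding same_fibers_def
  proof (intro allI impI; elim conjE)
    fix q F i t F' i' t' assume q: "q \<in> Fib M" "is_pullback C q (f \<cdot> u) F i t"
      "is_pullback C q (f \<cdot> v) F' i' t'"
    have "q \<in> hom C (Dom C q) Y"
      using pullbackD[OF q(2)] Cmp_in[OF u f] Fib_Arr[OF q(1)] by (auto simp: hom_def)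
    then obtain P p r where P: "is_pullback C q f P p r" using pullback_exists f by blast
    have uv: "u \<in> hom C pt (Dom C f)" "v \<in> hom C pt (Dom C f)" using u v f by (auto simp: hom_def)
    have "r \<in> Fib M" using pullback_Fib[OF P q(1)] .
    moreover obtain j where "is_pullback C r u F j t" using pullback_unpaste[OF P uv(1) q(2)] by blast
    moreover obtain j' where "is_pullback C r v F' j' t'" using pullback_unpaste[OF P uv(2) q(3)] by blast
    ultimately show "isomorphic (Ho C M) F F'" using R unfolding same_fibers_def by blast
  qed
next
  fix X Y f u v assume f: "f \<in> hom C X Y" "f \<in> Fib M" "f \<in> Weq M"
    and u: "u \<in> hom C pt X" and v: "v \<in> hom C pt X" and R: "same_fibers (f \<cdot> u) (f \<cdot> v)"
  show "same_fibers u v"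
    unfolding same_fibers_def
  proof (intro allI impI; elim conjE)
    fix q F i t F' i' t' assume q: "q \<in> Fib M" "is_pullback C q u F i t" "is_pullback C q v F' i' t'"
    have q': "q \<in> hom C (Dom C q) X" using pullbackD[OF q(2)] u Fib_Arr[OF q(1)] by (auto simp: hom_def)
    note fq = Cmp_in[OF q' f(1)]
    obtain G j s where G: "is_pullback C (f \<cdot> q) (f \<cdot> u) G j s"
      using pullback_exists[OF fq Cmp_in[OF u f(1)]] by blast
    obtain G' j' s' where G': "is_pullback C (f \<cdot> q) (f \<cdot> v) G' j' s'"
      using pullback_exists[OF fq Cmp_in[OF v f(1)]] by blast
    have "isomorphic (Ho C M) G G'"
      using R G G' Fib_Cmp[OF q' f(1) q(1) f(2)] unfolding same_fibers_def by blast
    moreover have "isomorphic (Ho C M) F G"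
      using fiber_of_composite_comparison[OF q' q(1) f u q(2) G] HoC.isomorphicI ho_in by metis
    moreover have "isomorphic (Ho C M) F' G'"
      using fiber_of_composite_comparison[OF q' q(1) f v q(3) G'] HoC.isomorphicI ho_in by metis
    ultimately show "isomorphic (Ho C M) F F'"
      using HoC.isomorphic_trans HoC.isomorphic_sym by blast
  qed
qed

theorem fibers_over_homotopic_points:
  assumes X: "fibrant C M X" and u: "u \<in> hom C pt X" and v: "v \<in> hom C pt X" and e: "ho u = ho v"
    and "q \<in> Fib M" "is_pullback C q u F i t" "is_pullback C q v F' i' t'"
  shows "isomorphic (Ho C M) F F'"
  using ho_eq_imp[OF point_congruence_same_fibers X u v e] assms(5-7) unfolding same_fibers_def by blast

text \<open>Here \<open>(\<sigma>, \<alpha>)\<close> is a square from \<open>q\<close> to \<open>q'\<close>.  Quantifying over all choices of the fibers avoids a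
  separate proof that the choice does not matter.\<close>

definition fiber_iso_at :: "'m \<Rightarrow> 'm \<Rightarrow> 'm \<Rightarrow> 'm \<Rightarrow> 'm \<Rightarrow> bool" where
  "fiber_iso_at q q' \<alpha> \<sigma> u \<longleftrightarrow> (\<forall>F i t F' i' t' s. is_pullback C q u F i t \<and>
     is_pullback C q' (\<alpha> \<cdot> u) F' i' t' \<and> s \<in> hom C F F' \<and> i' \<cdot> s = \<sigma> \<cdot> i \<longrightarrow> iso_arr (Ho C M) (ho s))"

definition same_fiber_isos :: "'m \<Rightarrow> 'm \<Rightarrow> bool" where
  "same_fiber_isos u v \<longleftrightarrow> (\<forall>Z X Z' Y q q' \<alpha> \<sigma>. u \<in> hom C pt X \<and> q \<in> hom C Z X \<and> q \<in> Fib M \<and>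
     q' \<in> hom C Z' Y \<and> q' \<in> Fib M \<and> \<alpha> \<in> hom C X Y \<and> \<sigma> \<in> hom C Z Z' \<and> q' \<cdot> \<sigma> = \<alpha> \<cdot> q \<longrightarrow>
     (fiber_iso_at q q' \<alpha> \<sigma> u \<longleftrightarrow> fiber_iso_at q q' \<alpha> \<sigma> v))"

lemma fiber_map:
  assumes q: "q \<in> hom C Z X" and q': "q' \<in> hom C Z' Y" and \<alpha>: "\<alpha> \<in> hom C X Y"
    and \<sigma>: "\<sigma> \<in> hom C Z Z'" and e: "q' \<cdot> \<sigma> = \<alpha> \<cdot> q" and u: "u \<in> hom C pt X"
    and F: "is_pullback C q u F i t" and F': "is_pullback C q' (\<alpha> \<cdot> u) F' i' t'"
  obtains s where "s \<in> hom C F F'" "i' \<cdot> s = \<sigma> \<cdot> i"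
proof -
  note d = fiberD[OF F q u]
  have "q' \<cdot> (\<sigma> \<cdot> i) = \<alpha> \<cdot> (q \<cdot> i)"
    using Cmp_assoc[OF d(1) \<sigma> q'] Cmp_assoc[OF d(1) q \<alpha>] e by simp
  also have "\<dots> = (\<alpha> \<cdot> u) \<cdot> t" using d(3) Cmp_assoc[OF d(2) u \<alpha>] by simp
  finally show thesis
    using fiber_lift[OF F' q' Cmp_in[OF u \<alpha>] Cmp_in[OF d(1) \<sigma>] d(2)] that by blast
qed

lemma fiber_iso_at_pullback:
  assumes q: "q \<in> hom C Z X'" and f: "f \<in> hom C X X'" and \<alpha>: "\<alpha> \<in> hom C X' Y"
    and \<sigma>: "\<sigma> \<in> hom C Z Z'" and u: "u \<in> hom C pt X" and P: "is_pullback C q f P p r"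
  shows "fiber_iso_at q q' \<alpha> \<sigma> (f \<cdot> u) \<longleftrightarrow> fiber_iso_at r q' (\<alpha> \<cdot> f) (\<sigma> \<cdot> p) u"
proof -
  have u': "u \<in> hom C pt (Dom C f)" using u f by (simp add: hom_def)
  have p: "p \<in> hom C P Z" and r: "r \<in> hom C P X" using pullbackD[OF P] q f by (auto simp: hom_def)
  have e: "\<alpha> \<cdot> (f \<cdot> u) = \<alpha> \<cdot> f \<cdot> u" using Cmp_assoc[OF u f \<alpha>] .
  show ?thesis
  proof
    assume L: "fiber_iso_at q q' \<alpha> \<sigma> (f \<cdot> u)"
    show "fiber_iso_at r q' (\<alpha> \<cdot> f) (\<sigma> \<cdot> p) u"
      unfolding fiber_iso_at_def
    proof (intro allI impI; elim conjE)
      fix F i t F' i' t' s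
      assume F: "is_pullback C r u F i t" and F': "is_pullback C q' (\<alpha> \<cdot> f \<cdot> u) F' i' t'"
        and s: "s \<in> hom C F F'" "i' \<cdot> s = \<sigma> \<cdot> p \<cdot> i"
      note i = fiberD(1)[OF F r u]
      have "is_pullback C q (f \<cdot> u) F (p \<cdot> i) t" using pullback_paste[OF P u' F] .
      then show "iso_arr (Ho C M) (ho s)"
        using L F' s e Cmp_assoc[OF i p \<sigma>] unfolding fiber_iso_at_def by metis
    qed
  next
    assume L: "fiber_iso_at r q' (\<alpha> \<cdot> f) (\<sigma> \<cdot> p) u"
    show "fiber_iso_at q q' \<alpha> \<sigma> (f \<cdot> u)"
      unfolding fiber_iso_at_def
    proof (intro allI impI; elim conjE)
      fix F i t F' i' t' s
      assume F: "is_pullback C q (f \<cdot> u) F i t" and F': "is_pullback C q' (\<alpha> \<cdot> (f \<cdot> u)) F' i' t'"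
        and s: "s \<in> hom C F F'" "i' \<cdot> s = \<sigma> \<cdot> i"
      obtain j where j: "j \<in> hom C F P" "p \<cdot> j = i" "is_pullback C r u F j t"
        using pullback_unpaste[OF P u' F] .
      then show "iso_arr (Ho C M) (ho s)"
        using L F' s e Cmp_assoc[OF j(1) p \<sigma>] unfolding fiber_iso_at_def by metis
    qed
  qed
qed

text \<open>To compose with \<open>f\<close>, both fibrations must live over \<open>X\<close>; so \<open>q'\<close> is replaced by its pullback along
  \<open>\<alpha>\<close>, which has the same fibers.\<close>

lemma fiber_iso_at_composite:
  assumes q: "q \<in> hom C Z X" "q \<in> Fib M" and q': "q' \<in> hom C Z' Y" "q' \<in> Fib M"
    and \<alpha>: "\<alpha> \<in> hom C X Y" and \<sigma>: "\<sigma> \<in> hom C Z Z'" "q' \<cdot> \<sigma> = \<alpha> \<cdot> q"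
    and f: "f \<in> hom C X X'" "f \<in> Fib M" "f \<in> Weq M" and u: "u \<in> hom C pt X"
    and P: "is_pullback C q' \<alpha> P m r" and \<sigma>': "\<sigma>' \<in> hom C Z P" "m \<cdot> \<sigma>' = \<sigma>" "r \<cdot> \<sigma>' = q"
  shows "fiber_iso_at q q' \<alpha> \<sigma> u \<longleftrightarrow> fiber_iso_at (f \<cdot> q) (f \<cdot> r) (Ide C X') \<sigma>' (f \<cdot> u)"
proof -
  have m: "m \<in> hom C P Z'" and r: "r \<in> hom C P X" using pullbackD[OF P] q' \<alpha> by (auto simp: hom_def)
  have rf: "r \<in> Fib M" using pullback_Fib[OF P q'(2)] .
  note fu = Cmp_in[OF u f(1)] and fq = Cmp_in[OF q(1) f(1)] and fr = Cmp_in[OF r f(1)]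
  note X' = Ide_in[OF hom_Obj(2)[OF f(1)]]
  have one: "Ide C X' \<cdot> (f \<cdot> u) = f \<cdot> u" using Ide_Cmp[OF fu] .
  have u': "u \<in> hom C pt (Dom C \<alpha>)" using u \<alpha> by (simp add: hom_def)
  have *: "iso_arr (Ho C M) (ho s) \<longleftrightarrow> iso_arr (Ho C M) (ho s')"
    if F: "is_pullback C q u F i t" and G: "is_pullback C q' (\<alpha> \<cdot> u) G j w"
      and s: "s \<in> hom C F G" "j \<cdot> s = \<sigma> \<cdot> i"
      and F': "is_pullback C (f \<cdot> q) (f \<cdot> u) F' i' t'" and G': "is_pullback C (f \<cdot> r) (f \<cdot> u) G' j' w'"
      and s': "s' \<in> hom C F' G'" "j' \<cdot> s' = \<sigma>' \<cdot> i'"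
    for F i t G j w s F' i' t' G' j' w' s'
  proof -
    note i = fiberD[OF F q(1) u] and i' = fiberD[OF F' fq fu] and j' = fiberD[OF G' fr fu]
    obtain l where l: "l \<in> hom C G P" "m \<cdot> l = j" and L: "is_pullback C r u G l w"
      using pullback_unpaste[OF P u' G] .
    obtain c where c: "c \<in> hom C F F'" "i' \<cdot> c = i" "iso_arr (Ho C M) (ho c)"
      using fiber_of_composite_comparison[OF q f u F F'] .
    obtain d where d: "d \<in> hom C G G'" "j' \<cdot> d = l" "iso_arr (Ho C M) (ho d)"
      using fiber_of_composite_comparison[OF r rf f u L G'] .
    note w = fiberD[OF L r u]
    have ls: "l \<cdot> s = \<sigma>' \<cdot> i"
    proof (rule pullback_eq[OF P Cmp_in[OF s(1) l(1)] Cmp_in[OF i(1) \<sigma>'(1)]])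
      show "m \<cdot> (l \<cdot> s) = m \<cdot> (\<sigma>' \<cdot> i)"
        using Cmp_assoc[OF s(1) l(1) m] l s Cmp_assoc[OF i(1) \<sigma>'(1) m] \<sigma>' by simp
      have "r \<cdot> (l \<cdot> s) = u \<cdot> (w \<cdot> s)"
        using Cmp_assoc[OF s(1) l(1) r] w Cmp_assoc[OF s(1) w(2) u] by simp
      also have "w \<cdot> s = t" using bang_eq[OF Cmp_in[OF s(1) w(2)] i(2)] .
      finally show "r \<cdot> (l \<cdot> s) = r \<cdot> (\<sigma>' \<cdot> i)"
        using Cmp_assoc[OF i(1) \<sigma>'(1) r] \<sigma>' i(3) by simp
    qed
    have "s' \<cdot> c = d \<cdot> s"
    proof (rule fiber_eq[OF G' fr fu Cmp_in[OF c(1) s'(1)] Cmp_in[OF s(1) d(1)]])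
      show "j' \<cdot> (s' \<cdot> c) = j' \<cdot> (d \<cdot> s)"
        using Cmp_assoc[OF c(1) s'(1) j'(1)] s' Cmp_assoc[OF c(1) i'(1) \<sigma>'(1)] c
          Cmp_assoc[OF s(1) d(1) j'(1)] d ls by simp
    qed
    then have e: "ho s' \<cdot>\<^bsub>Ho C M\<^esub> ho c = ho d \<cdot>\<^bsub>Ho C M\<^esub> ho s"
      using ho_Cmp[OF c(1) s'(1)] ho_Cmp[OF s(1) d(1)] by simp
    note h = ho_in[OF c(1)] ho_in[OF s'(1)] ho_in[OF s(1)] ho_in[OF d(1)]
    have "iso_arr (Ho C M) (ho d \<cdot>\<^bsub>Ho C M\<^esub> ho s) \<longleftrightarrow> iso_arr (Ho C M) (ho s)"
      using HoC.iso_cancel_left[OF h(3,4) d(3)] HoC.iso_Cmp[OF h(3,4) _ d(3)] by blast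
    moreover have "iso_arr (Ho C M) (ho s' \<cdot>\<^bsub>Ho C M\<^esub> ho c) \<longleftrightarrow> iso_arr (Ho C M) (ho s')"
      using HoC.iso_cancel_right[OF h(1,2) c(3)] HoC.iso_Cmp[OF h(1,2) c(3)] by blast
    ultimately show ?thesis unfolding e by blast
  qed
  have \<sigma>'e: "(f \<cdot> r) \<cdot> \<sigma>' = Ide C X' \<cdot> (f \<cdot> q)"
    using Cmp_assoc[OF \<sigma>'(1) r f(1)] \<sigma>' Ide_Cmp[OF fq] by simp
  show ?thesis
  proof
    assume L: "fiber_iso_at q q' \<alpha> \<sigma> u"
    show "fiber_iso_at (f \<cdot> q) (f \<cdot> r) (Ide C X') \<sigma>' (f \<cdot> u)"
      unfolding fiber_iso_at_def one
    proof (intro allI impI; elim conjE)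
      fix F' i' t' G' j' w' s' assume F': "is_pullback C (f \<cdot> q) (f \<cdot> u) F' i' t'"
        and G': "is_pullback C (f \<cdot> r) (f \<cdot> u) G' j' w'" and s': "s' \<in> hom C F' G'" "j' \<cdot> s' = \<sigma>' \<cdot> i'"
      obtain F i t where F: "is_pullback C q u F i t" using pullback_exists[OF q(1) u] by blast
      obtain G j w where G: "is_pullback C q' (\<alpha> \<cdot> u) G j w"
        using pullback_exists[OF q'(1) Cmp_in[OF u \<alpha>]] by blast
      obtain s where s: "s \<in> hom C F G" "j \<cdot> s = \<sigma> \<cdot> i" using fiber_map[OF q(1) q'(1) \<alpha> \<sigma> u F G] .
      show "iso_arr (Ho C M) (ho s')"
        using *[OF F G s F' G' s'] L F G s unfolding fiber_iso_at_def by blast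
    qed
  next
    assume L: "fiber_iso_at (f \<cdot> q) (f \<cdot> r) (Ide C X') \<sigma>' (f \<cdot> u)"
    show "fiber_iso_at q q' \<alpha> \<sigma> u"
      unfolding fiber_iso_at_def
    proof (intro allI impI; elim conjE)
      fix F i t G j w s assume F: "is_pullback C q u F i t"
        and G: "is_pullback C q' (\<alpha> \<cdot> u) G j w" and s: "s \<in> hom C F G" "j \<cdot> s = \<sigma> \<cdot> i"
      obtain F' i' t' where F': "is_pullback C (f \<cdot> q) (f \<cdot> u) F' i' t'"
        using pullback_exists[OF fq fu] by blast
      obtain G' j' w' where G': "is_pullback C (f \<cdot> r) (f \<cdot> u) G' j' w'"
        using pullback_exists[OF fr fu] by blast
      obtain s' where s': "s' \<in> hom C F' G'" "j' \<cdot> s' = \<sigma>' \<cdot> i'"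
        using fiber_map[OF fq fr X' \<sigma>'(1) \<sigma>'e fu F'] G' one by metis
      show "iso_arr (Ho C M) (ho s)"
        using *[OF F G s F' G' s'] L F' G' s' unfolding fiber_iso_at_def one by blast
    qed
  qed
qed

text \<open>In \<open>same_fiber_isos u v\<close> only \<open>u\<close> is tied to the base of the fibrations; equality of the codomains
  makes the relation symmetric.\<close>

lemma point_congruence_same_fiber_isos:
  "point_congruence (\<lambda>u v. Cod C u = Cod C v \<and> same_fiber_isos u v)"
  unfolding point_congruence_def
proof (intro conjI allI impI; elim conjE)
  fix X u v w assume uv: "u \<in> hom C pt X" "v \<in> hom C pt X" "w \<in> hom C pt X"
  note c = homD(3)[OF uv(1)] homD(3)[OF uv(2)] homD(3)[OF uv(3)]
  have X: "X' = X" if "u \<in> hom C pt X'" for X' using homD(3)[OF that] c by simp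
  assume "same_fiber_isos u v" "same_fiber_isos v w"
  then show "same_fiber_isos u w"
    using uv X unfolding same_fiber_isos_def by metis
next
  fix X u v assume uv: "u \<in> hom C pt X" "v \<in> hom C pt X" and R: "same_fiber_isos u v"
  have "X' = X" if "v \<in> hom C pt X'" for X' using homD(3)[OF that] homD(3)[OF uv(2)] by simp
  then show "same_fiber_isos v u"
    using uv R unfolding same_fiber_isos_def by metis
next
  fix X Y f u v assume f: "f \<in> hom C X Y" and u: "u \<in> hom C pt X" and v: "v \<in> hom C pt X"
    and R: "same_fiber_isos u v"
  show "Cod C (f \<cdot> u) = Cod C (f \<cdot> v)" using homD(3) Cmp_in[OF u f] Cmp_in[OF v f] by metis
  show "same_fiber_isos (f \<cdot> u) (f \<cdot> v)"
    unfolding same_fiber_isos_def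
  proof (intro allI impI; elim conjE)
    fix Z X' Z' Y' q q' \<alpha> \<sigma> assume "f \<cdot> u \<in> hom C pt X'" and q: "q \<in> hom C Z X'" "q \<in> Fib M"
      and q': "q' \<in> hom C Z' Y'" "q' \<in> Fib M" and \<alpha>: "\<alpha> \<in> hom C X' Y'" and \<sigma>: "\<sigma> \<in> hom C Z Z'"
      and e: "q' \<cdot> \<sigma> = \<alpha> \<cdot> q"
    then have "X' = Y" using homD(3) Cmp_in[OF u f] by metis
    then have f': "f \<in> hom C X X'" using f by simp
    obtain P p r where P: "is_pullback C q f P p r" using pullback_exists[OF q(1) f'] by blast
    have p: "p \<in> hom C P Z" and r: "r \<in> hom C P X" and pr: "q \<cdot> p = f \<cdot> r"
      using pullbackD[OF P] q f by (auto simp: hom_def)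
    have "q' \<cdot> (\<sigma> \<cdot> p) = (\<alpha> \<cdot> f) \<cdot> r"
      using Cmp_assoc[OF p \<sigma> q'(1)] e Cmp_assoc[OF p q(1) \<alpha>] pr Cmp_assoc[OF r f' \<alpha>] by simp
    then have "fiber_iso_at r q' (\<alpha> \<cdot> f) (\<sigma> \<cdot> p) u \<longleftrightarrow> fiber_iso_at r q' (\<alpha> \<cdot> f) (\<sigma> \<cdot> p) v"
      using R u r pullback_Fib[OF P q(2)] q' Cmp_in[OF f' \<alpha>] Cmp_in[OF p \<sigma>]
      unfolding same_fiber_isos_def by blast
    then show "fiber_iso_at q q' \<alpha> \<sigma> (f \<cdot> u) \<longleftrightarrow> fiber_iso_at q q' \<alpha> \<sigma> (f \<cdot> v)"
      using fiber_iso_at_pullback[OF q(1) f' \<alpha> \<sigma> u P] fiber_iso_at_pullback[OF q(1) f' \<alpha> \<sigma> v P] by simp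
  qed
next
  fix X Y f u v assume f: "f \<in> hom C X Y" "f \<in> Fib M" "f \<in> Weq M"
    and u: "u \<in> hom C pt X" and v: "v \<in> hom C pt X" and R: "same_fiber_isos (f \<cdot> u) (f \<cdot> v)"
  show "same_fiber_isos u v"
    unfolding same_fiber_isos_def
  proof (intro allI impI; elim conjE)
    fix Z X' Z' Y' q q' \<alpha> \<sigma> assume u': "u \<in> hom C pt X'" and q: "q \<in> hom C Z X'" "q \<in> Fib M"
      and q': "q' \<in> hom C Z' Y'" "q' \<in> Fib M" and \<alpha>: "\<alpha> \<in> hom C X' Y'" and \<sigma>: "\<sigma> \<in> hom C Z Z'"
      and e: "q' \<cdot> \<sigma> = \<alpha> \<cdot> q"
    have X': "X' = X" using homD(3)[OF u'] homD(3)[OF u] by simp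
    note q = q[unfolded X'] and \<alpha> = \<alpha>[unfolded X']
    obtain P m r where P: "is_pullback C q' \<alpha> P m r" using pullback_exists[OF q'(1) \<alpha>] by blast
    have m: "m \<in> hom C P Z'" and r: "r \<in> hom C P X" using pullbackD[OF P] q' \<alpha> by (auto simp: hom_def)
    obtain \<sigma>' where \<sigma>': "\<sigma>' \<in> hom C Z P" "m \<cdot> \<sigma>' = \<sigma>" "r \<cdot> \<sigma>' = q"
      using pullback_lift[OF P, unfolded homD(2)[OF q'(1)] homD(2)[OF \<alpha>], OF \<sigma> q(1) e] .
    have "(f \<cdot> r) \<cdot> \<sigma>' = Ide C Y \<cdot> (f \<cdot> q)"
      using Cmp_assoc[OF \<sigma>'(1) r f(1)] \<sigma>' Ide_Cmp[OF Cmp_in[OF q(1) f(1)]] by simp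
    then have "fiber_iso_at (f \<cdot> q) (f \<cdot> r) (Ide C Y) \<sigma>' (f \<cdot> u) \<longleftrightarrow>
        fiber_iso_at (f \<cdot> q) (f \<cdot> r) (Ide C Y) \<sigma>' (f \<cdot> v)"
      using R Cmp_in[OF u f(1)] Cmp_in[OF q(1) f(1)] Fib_Cmp[OF q(1) f(1) q(2) f(2)] Cmp_in[OF r f(1)]
        Fib_Cmp[OF r f(1) pullback_Fib[OF P q'(2)] f(2)] Ide_in[OF hom_Obj(2)[OF f(1)]] \<sigma>'(1)
      unfolding same_fiber_isos_def by blast
    then show "fiber_iso_at q q' \<alpha> \<sigma> u \<longleftrightarrow> fiber_iso_at q q' \<alpha> \<sigma> v"
      using fiber_iso_at_composite[OF q q' \<alpha> \<sigma> e f u P \<sigma>'] fiber_iso_at_composite[OF q q' \<alpha> \<sigma> e f v P \<sigma>']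
      by simp
  qed
qed (auto simp: hom_def same_fiber_isos_def)

theorem fiber_iso_at_homotopic_points:
  assumes X: "fibrant C M X" and u: "u \<in> hom C pt X" and v: "v \<in> hom C pt X" and e: "ho u = ho v"
    and "q \<in> hom C Z X" "q \<in> Fib M" "q' \<in> hom C Z' Y" "q' \<in> Fib M" "\<alpha> \<in> hom C X Y" "\<sigma> \<in> hom C Z Z'"
    "q' \<cdot> \<sigma> = \<alpha> \<cdot> q" "fiber_iso_at q q' \<alpha> \<sigma> u"
  shows "fiber_iso_at q q' \<alpha> \<sigma> v"
  using ho_eq_imp[OF point_congruence_same_fiber_isos X u v e] u assms(5-)
  unfolding same_fiber_isos_def by blast

end

section \<open>Terminal objects and pullbacks in complete categories\<close>

lemma finite_small:
  assumes "infinite (UNIV :: 'u set)" "finite (A :: 'u set)"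
  shows "small A"
  unfolding small_def lesspoll_def
  using finite_lesspoll_infinite[OF assms] unfolding lesspoll_def .

lemma (in category) terminal_exists:
  assumes "infinite (UNIV :: 'u set)" "small_complete TYPE('u) C"
  shows "\<exists>t. is_terminal C t"
proof -
  let ?J = "\<lparr>Obj = {}, Arr = {}, Dom = id, Cod = id, Cmp = (\<lambda>g f. g), Ide = id\<rparr> :: ('u, 'u) cat"
  have "category ?J" by unfold_locales (auto simp: hom_def)
  moreover have "is_functor ?J C (\<lambda>_. undefined) (\<lambda>_. undefined)"
    by (simp add: is_functor_def hom_def)
  ultimately obtain L p where "is_limit ?J C (\<lambda>_. undefined) (\<lambda>_. undefined) L p"
    using assms(2) finite_small[OF assms(1), of "{}"] unfolding small_complete_def by fastforce
  then have "is_terminal C L"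
    by (simp add: is_limit_def is_cone_def is_terminal_def)
  then show ?thesis by blast
qed

text \<open>A diagram must have its objects and arrows in the universe type, so the cospan is built from five
  distinct elements of it.\<close>

lemma (in category) pullback_exists_if_complete:
  assumes "infinite (UNIV :: 'u set)" "small_complete TYPE('u) C"
    and f: "f \<in> hom C a c" and g: "g \<in> hom C b c"
  shows "\<exists>P p q. is_pullback C f g P p q"
proof -
  obtain e :: "nat \<Rightarrow> 'u" where e: "inj e" using assms(1) infinite_countable_subset by blast
  define x0 x1 x2 x3 x4 where x: "x0 = e 0" "x1 = e 1" "x2 = e 2" "x3 = e 3" "x4 = e 4"
  have [simp]: "x0 \<noteq> x1" "x0 \<noteq> x2" "x0 \<noteq> x3" "x0 \<noteq> x4" "x1 \<noteq> x2" "x1 \<noteq> x3" "x1 \<noteq> x4"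
    "x2 \<noteq> x3" "x2 \<noteq> x4" "x3 \<noteq> x4"
    using e unfolding x by (auto dest: injD)
  note [simp] = this[symmetric]
  define J where "J = (\<lparr>Obj = {x0, x1, x2}, Arr = {x0, x1, x2, x3, x4},
    Dom = (\<lambda>x. if x = x3 then x0 else if x = x4 then x1 else x),
    Cod = (\<lambda>x. if x = x3 \<or> x = x4 then x2 else x),
    Cmp = (\<lambda>v u. if v = x3 \<or> v = x4 then v else u), Ide = id\<rparr> :: ('u, 'u) cat)"
  define Do where "Do x = (if x = x0 then a else if x = x1 then b else c)" for x
  define Da where "Da x = (if x = x3 then f else if x = x4 then g else Ide C (Do x))" for x
  note O = hom_Obj[OF f] hom_Obj[OF g]
  have "category J"
    by unfold_locales (auto simp: J_def hom_def split: if_splits)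
  moreover have "is_functor J C Do Da"
    using f g O Ide_in Cmp_Ide[OF f] Cmp_Ide[OF g] Ide_Cmp[OF f] Ide_Cmp[OF g] Ide_Cmp[OF Ide_in]
    unfolding is_functor_def by (auto simp: J_def hom_def Do_def Da_def split: if_splits)
  moreover have "small (Obj J)" "small (Arr J)" by (simp_all add: J_def finite_small[OF assms(1)])
  ultimately obtain L p where L: "is_limit J C Do Da L p"
    using assms(2) unfolding small_complete_def by metis
  have cone: "is_cone J C Do Da X s \<longleftrightarrow> X \<in> Obj C \<and> s x0 \<in> hom C X a \<and> s x1 \<in> hom C X b \<and>
      s x2 \<in> hom C X c \<and> f \<cdot> s x0 = s x2 \<and> g \<cdot> s x1 = s x2" for X s
    using Ide_Cmp by (auto simp: is_cone_def J_def Do_def Da_def)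
  have p: "p x0 \<in> hom C L a" "p x1 \<in> hom C L b" "f \<cdot> p x0 = g \<cdot> p x1" "p x2 = f \<cdot> p x0"
    using L unfolding is_limit_def cone by auto
  have "is_pullback C f g L (p x0) (p x1)"
  proof (rule pullbackI[OF f g p(1,2,3)])
    fix Z s t assume s: "s \<in> hom C Z a" and t: "t \<in> hom C Z b" and st: "f \<cdot> s = g \<cdot> t"
    define r where "r x = (if x = x0 then s else if x = x1 then t else f \<cdot> s)" for x
    have "is_cone J C Do Da Z r"
      unfolding cone r_def using s t st Cmp_in[OF s f] hom_Obj(1)[OF s] by simp
    then obtain u where "u \<in> hom C Z L" "\<forall>j \<in> Obj J. p j \<cdot> u = r j"
      using L unfolding is_limit_def by blast
    then show "\<exists>u\<in>hom C Z L. p x0 \<cdot> u = s \<and> p x1 \<cdot> u = t"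
      by (intro bexI[of _ u]) (auto simp: J_def r_def)
  next
    fix Z u v assume uv: "u \<in> hom C Z L" "v \<in> hom C Z L" "p x0 \<cdot> u = p x0 \<cdot> v" "p x1 \<cdot> u = p x1 \<cdot> v"
    define r where "r x = p x \<cdot> u" for x
    have *: "p x2 \<cdot> w = f \<cdot> (p x0 \<cdot> w)" "p x2 \<cdot> w = g \<cdot> (p x1 \<cdot> w)" if "w \<in> hom C Z L" for w
      using Cmp_assoc[OF that p(1) f] Cmp_assoc[OF that p(2) g] p by simp_all
    have "is_cone J C Do Da Z r"
      unfolding cone r_def *(1)[OF uv(1)]
      using *[OF uv(1)] Cmp_in[OF uv(1) p(1)] Cmp_in[OF uv(1) p(2)] Cmp_in[OF Cmp_in[OF uv(1) p(1)] f]
        hom_Obj(1)[OF uv(1)] by simp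
    then have "\<exists>!w. w \<in> hom C Z L \<and> (\<forall>j \<in> Obj J. p j \<cdot> w = r j)"
      using L unfolding is_limit_def by blast
    moreover have "\<forall>j \<in> Obj J. p j \<cdot> u = r j" "\<forall>j \<in> Obj J. p j \<cdot> v = r j"
      using uv *(1)[OF uv(1)] *(1)[OF uv(2)] by (auto simp: J_def r_def)
    ultimately show "u = v" using uv(1,2) by blast
  qed
  then show ?thesis by blast
qed

section \<open>Cartesian monoidal model categories\<close>

lemma (in category) pushout_of_initial:
  assumes a: "is_initial C a" and b: "is_initial C b" and h: "h \<in> hom C a b" and k: "k \<in> hom C a c"
    and i: "i \<in> hom C b c"
  shows "is_pushout C h k c i (Ide C c)" "is_pushout C k h c (Ide C c) i"
proof -
  note c = hom_Obj(2)[OF k]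
  note one = Ide_in[OF c]
  have e: "i \<cdot> h = Ide C c \<cdot> k" using initial_eq[OF a Cmp_in[OF h i] Cmp_in[OF k one]] .
  have u: "\<exists>!u. u \<in> hom C c Z \<and> u \<cdot> i = s \<and> u \<cdot> Ide C c = t"
    if s: "s \<in> hom C b Z" and t: "t \<in> hom C c Z" for Z s t
  proof (rule ex1I[of _ t])
    show "t \<in> hom C c Z \<and> t \<cdot> i = s \<and> t \<cdot> Ide C c = t"
      using t initial_eq[OF b Cmp_in[OF i t] s] Cmp_Ide[OF t] by blast
    fix v assume "v \<in> hom C c Z \<and> v \<cdot> i = s \<and> v \<cdot> Ide C c = t"
    then show "v = t" using Cmp_Ide[of v c Z] by simp
  qed
  have op: "hom (op_cat C) x y = hom C y x" "Dom (op_cat C) = Cod C" "Cod (op_cat C) = Dom C"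
      "Arr (op_cat C) = Arr C" "f \<cdot>\<^bsub>op_cat C\<^esub> g = g \<cdot> f" for x y f g
    unfolding op_cat_def hom_def by auto
  note eqs = homD(2,3)[OF h] homD(2,3)[OF k]
  show "is_pushout C h k c i (Ide C c)"
    unfolding is_pushout_def is_pullback_def op eqs
    by (intro conjI allI ballI impI homD(1)[OF h] homD(1)[OF k] HOL.refl i one e u) (assumption | simp)+
  show "is_pushout C k h c (Ide C c) i"
    unfolding is_pushout_def is_pullback_def op eqs
  proof (intro conjI allI ballI impI homD(1)[OF h] homD(1)[OF k] HOL.refl i one e[symmetric])
    fix Z s t assume "s \<in> hom C c Z" "t \<in> hom C b Z"
    then show "\<exists>!u. u \<in> hom C c Z \<and> u \<cdot> Ide C c = s \<and> u \<cdot> i = t"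
      using u[of t Z s] by (simp add: conj_commute)
  qed
qed

locale cartesian_model_category =
  monoidal_category V + pointed_model_structure V M "\<one>\<^bsub>V\<^esub>"
  for V :: "('o, 'm) moncat" (structure) and M :: "'m model" +
  assumes closed: "closed_monoidal V"
    and pushout_product: "pushout_product_axiom V M"
    and V1: "condV1 V M"
begin

lemma to_unit_eq: "to_unit V X = bang X"
  by (simp add: to_unit_def bang_def)

definition proj1 :: "'o \<Rightarrow> 'o \<Rightarrow> 'm" where
  "proj1 X Y = RUnit V X \<cdot> (Ide V X \<odot> bang Y)"

definition proj2 :: "'o \<Rightarrow> 'o \<Rightarrow> 'm" where
  "proj2 X Y = LUnit V Y \<cdot> (bang X \<odot> Ide V Y)"

lemma product: "X \<in> Obj V \<Longrightarrow> Y \<in> Obj V \<Longrightarrow> is_product V X Y (X \<otimes> Y) (proj1 X Y) (proj2 X Y)"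
  using V1 unfolding condV1_def to_unit_eq proj1_def proj2_def by blast

lemma proj_in:
  assumes "X \<in> Obj V" "Y \<in> Obj V"
  shows "proj1 X Y \<in> hom V (X \<otimes> Y) X" "proj2 X Y \<in> hom V (X \<otimes> Y) Y"
  using product[OF assms] unfolding is_product_def by blast+

lemma pair_ex:
  assumes "f \<in> hom V Z X" "g \<in> hom V Z Y"
  obtains u where "u \<in> hom V Z (X \<otimes> Y)" "proj1 X Y \<cdot> u = f" "proj2 X Y \<cdot> u = g"
  using product[OF hom_Obj(2)[OF assms(1)] hom_Obj(2)[OF assms(2)]] assms
  unfolding is_product_def by blast

lemma pair_eq:
  assumes "u \<in> hom V Z (X \<otimes> Y)" "v \<in> hom V Z (X \<otimes> Y)" "X \<in> Obj V" "Y \<in> Obj V"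
    "proj1 X Y \<cdot> u = proj1 X Y \<cdot> v" "proj2 X Y \<cdot> u = proj2 X Y \<cdot> v"
  shows "u = v"
proof -
  note p = proj_in[OF assms(3,4)]
  have "\<exists>!w. w \<in> hom V Z (X \<otimes> Y) \<and> proj1 X Y \<cdot> w = proj1 X Y \<cdot> u \<and> proj2 X Y \<cdot> w = proj2 X Y \<cdot> u"
    using product[OF assms(3,4)] Cmp_in[OF assms(1) p(1)] Cmp_in[OF assms(1) p(2)]
    unfolding is_product_def by blast
  then show ?thesis using assms by metis
qed

lemma proj1_nat:
  assumes f: "f \<in> hom V X X'" and g: "g \<in> hom V Y Y'"
  shows "proj1 X' Y' \<cdot> (f \<odot> g) = f \<cdot> proj1 X Y"
proof -
  note X = hom_Obj[OF f] and Y = hom_Obj[OF g]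
  note b = bang_in[OF Y(1)] bang_in[OF Y(2)]
  note R = RUnit_in[OF X(1), THEN conjunct1] RUnit_in[OF X(2), THEN conjunct1]
  note one = Ide_in[OF X(1)] Ide_in[OF X(2)] Ide_in[OF Unit_in]
  have "proj1 X' Y' \<cdot> (f \<odot> g) = RUnit V X' \<cdot> ((Ide V X' \<odot> bang Y') \<cdot> (f \<odot> g))"
    unfolding proj1_def using Cmp_assoc[OF TenA_in[OF f g] TenA_in[OF one(2) b(2)] R(2)] by simp
  also have "(Ide V X' \<odot> bang Y') \<cdot> (f \<odot> g) = f \<odot> bang Y"
    using TenA_Cmp[OF f one(2) g b(2)] Ide_Cmp[OF f] bang_eq[OF Cmp_in[OF g b(2)] b(1)] by simp
  also have "\<dots> = (f \<odot> Ide V \<one>) \<cdot> (Ide V X \<odot> bang Y)"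
    using TenA_Cmp[OF one(1) f b(1) one(3)] Cmp_Ide[OF f] Ide_Cmp[OF b(1)] by simp
  also have "RUnit V X' \<cdot> \<dots> = (RUnit V X' \<cdot> (f \<odot> Ide V \<one>)) \<cdot> (Ide V X \<odot> bang Y)"
    using Cmp_assoc[OF TenA_in[OF one(1) b(1)] TenA_in[OF f one(3)] R(2)] by simp
  also have "\<dots> = f \<cdot> proj1 X Y"
    unfolding proj1_def RUnit_nat[OF f] using Cmp_assoc[OF TenA_in[OF one(1) b(1)] R(1) f] by simp
  finally show ?thesis .
qed

lemma proj2_nat:
  assumes f: "f \<in> hom V X X'" and g: "g \<in> hom V Y Y'"
  shows "proj2 X' Y' \<cdot> (f \<odot> g) = g \<cdot> proj2 X Y"
proof -
  note X = hom_Obj[OF f] and Y = hom_Obj[OF g]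
  note b = bang_in[OF X(1)] bang_in[OF X(2)]
  note L = LUnit_in[OF Y(1), THEN conjunct1] LUnit_in[OF Y(2), THEN conjunct1]
  note one = Ide_in[OF Y(1)] Ide_in[OF Y(2)] Ide_in[OF Unit_in]
  have "proj2 X' Y' \<cdot> (f \<odot> g) = LUnit V Y' \<cdot> ((bang X' \<odot> Ide V Y') \<cdot> (f \<odot> g))"
    unfolding proj2_def using Cmp_assoc[OF TenA_in[OF f g] TenA_in[OF b(2) one(2)] L(2)] by simp
  also have "(bang X' \<odot> Ide V Y') \<cdot> (f \<odot> g) = bang X \<odot> g"
    using TenA_Cmp[OF f b(2) g one(2)] Ide_Cmp[OF g] bang_eq[OF Cmp_in[OF f b(2)] b(1)] by simp
  also have "\<dots> = (Ide V \<one> \<odot> g) \<cdot> (bang X \<odot> Ide V Y)"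
    using TenA_Cmp[OF b(1) one(3) one(1) g] Cmp_Ide[OF g] Ide_Cmp[OF b(1)] by simp
  also have "LUnit V Y' \<cdot> \<dots> = (LUnit V Y' \<cdot> (Ide V \<one> \<odot> g)) \<cdot> (bang X \<odot> Ide V Y)"
    using Cmp_assoc[OF TenA_in[OF b(1) one(1)] TenA_in[OF one(3) g] L(2)] by simp
  also have "\<dots> = g \<cdot> proj2 X Y"
    unfolding proj2_def LUnit_nat[OF g] using Cmp_assoc[OF TenA_in[OF b(1) one(1)] L(1) g] by simp
  finally show ?thesis .
qed

lemma product_symmetric:
  assumes X: "X \<in> Obj V" and Y: "Y \<in> Obj V"
  shows "isomorphic V (X \<otimes> Y) (Y \<otimes> X)"
proof -
  note p = proj_in[OF X Y] and q = proj_in[OF Y X]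
  obtain u where u: "u \<in> hom V (X \<otimes> Y) (Y \<otimes> X)" "proj1 Y X \<cdot> u = proj2 X Y" "proj2 Y X \<cdot> u = proj1 X Y"
    using pair_ex[OF p(2,1)] .
  obtain v where v: "v \<in> hom V (Y \<otimes> X) (X \<otimes> Y)" "proj1 X Y \<cdot> v = proj2 Y X" "proj2 X Y \<cdot> v = proj1 Y X"
    using pair_ex[OF q(2,1)] .
  have "v \<cdot> u = Ide V (X \<otimes> Y)"
    by (rule pair_eq[OF Cmp_in[OF u(1) v(1)] Ide_in[OF Ten_in[OF X Y]] X Y])
      (use Cmp_assoc[OF u(1) v(1) p(1)] Cmp_assoc[OF u(1) v(1) p(2)] u v Cmp_Ide[OF p(1)] Cmp_Ide[OF p(2)] in simp_all)
  moreover have "u \<cdot> v = Ide V (Y \<otimes> X)"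
    by (rule pair_eq[OF Cmp_in[OF v(1) u(1)] Ide_in[OF Ten_in[OF Y X]] Y X])
      (use Cmp_assoc[OF v(1) u(1) q(1)] Cmp_assoc[OF v(1) u(1) q(2)] u v Cmp_Ide[OF q(1)] Cmp_Ide[OF q(2)] in simp_all)
  ultimately show ?thesis using isomorphicI[OF u(1) iso_arrI[OF u(1) v(1)]] by blast
qed

text \<open>Lift each component separately.\<close>

lemma TenA_has_lifting:
  assumes f: "f \<in> hom V X X'" and g: "g \<in> hom V Y Y'" and lf: "has_lifting V i f" and lg: "has_lifting V i g"
  shows "has_lifting V i (f \<odot> g)"
proof (rule has_liftingI)
  note X = hom_Obj[OF f] and Y = hom_Obj[OF g]
  note p = proj_in[OF X(1) Y(1)] and q = proj_in[OF X(2) Y(2)] and fg = TenA_in[OF f g]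
  fix u v assume i: "i \<in> Arr V" and "u \<in> hom V (Dom V i) (Dom V (f \<odot> g))"
    and "v \<in> hom V (Cod V i) (Cod V (f \<odot> g))" and e: "(f \<odot> g) \<cdot> u = v \<cdot> i"
  then have u: "u \<in> hom V (Dom V i) (X \<otimes> Y)" and v: "v \<in> hom V (Cod V i) (X' \<otimes> Y')"
    using homD[OF fg] by simp_all
  note i = Arr_hom[OF i]
  have e1: "f \<cdot> (proj1 X Y \<cdot> u) = (proj1 X' Y' \<cdot> v) \<cdot> i"
    using Cmp_assoc[OF u p(1) f] proj1_nat[OF f g] Cmp_assoc[OF u fg q(1)] e Cmp_assoc[OF i v q(1)] by simp
  have e2: "g \<cdot> (proj2 X Y \<cdot> u) = (proj2 X' Y' \<cdot> v) \<cdot> i"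
    using Cmp_assoc[OF u p(2) g] proj2_nat[OF f g] Cmp_assoc[OF u fg q(2)] e Cmp_assoc[OF i v q(2)] by simp
  obtain h where h: "h \<in> hom V (Cod V i) X" "h \<cdot> i = proj1 X Y \<cdot> u" "f \<cdot> h = proj1 X' Y' \<cdot> v"
    using has_liftingE[OF lf i f Cmp_in[OF u p(1)] Cmp_in[OF v q(1)] e1] .
  obtain k where k: "k \<in> hom V (Cod V i) Y" "k \<cdot> i = proj2 X Y \<cdot> u" "g \<cdot> k = proj2 X' Y' \<cdot> v"
    using has_liftingE[OF lg i g Cmp_in[OF u p(2)] Cmp_in[OF v q(2)] e2] .
  obtain w where w: "w \<in> hom V (Cod V i) (X \<otimes> Y)" "proj1 X Y \<cdot> w = h" "proj2 X Y \<cdot> w = k"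
    using pair_ex[OF h(1) k(1)] .
  have "w \<cdot> i = u"
    by (rule pair_eq[OF Cmp_in[OF i w(1)] u X(1) Y(1)])
      (use Cmp_assoc[OF i w(1) p(1)] Cmp_assoc[OF i w(1) p(2)] w h k in simp_all)
  moreover have "(f \<odot> g) \<cdot> w = v"
    by (rule pair_eq[OF Cmp_in[OF w(1) fg] v X(2) Y(2)])
      (use Cmp_assoc[OF w(1) fg q(1)] Cmp_assoc[OF w(1) p(1) f] proj1_nat[OF f g]
         Cmp_assoc[OF w(1) fg q(2)] Cmp_assoc[OF w(1) p(2) g] proj2_nat[OF f g] w h k in simp_all)
  ultimately show "\<exists>h\<in>hom V (Cod V i) (Dom V (f \<odot> g)). h \<cdot> i = u \<and> (f \<odot> g) \<cdot> h = v"
    using w(1) homD(2)[OF fg] by auto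
qed

lemma TenA_tfib:
  assumes "f \<in> hom V X X'" "g \<in> hom V Y Y'" "f \<in> Fib M" "f \<in> Weq M" "g \<in> Fib M" "g \<in> Weq M"
  shows "f \<odot> g \<in> Weq M"
  using tfib_if_has_lifting(2)[OF TenA_in[OF assms(1,2)]] TenA_has_lifting[OF assms(1,2)]
    lift_tfib assms(3-) by blast

lemma Ten_initial:
  assumes z: "is_initial V z" and A: "A \<in> Obj V"
  shows "is_initial V (A \<otimes> z)" "is_initial V (z \<otimes> A)"
proof -
  have zO: "z \<in> Obj V" using z unfolding is_initial_def by blast
  show "is_initial V (A \<otimes> z)"
    unfolding is_initial_def
  proof (intro conjI ballI)
    fix Y assume Y: "Y \<in> Obj V"
    have "\<exists>H\<in>Obj V. \<exists>ev\<in>hom V (A \<otimes> H) Y. \<forall>Z\<in>Obj V. \<forall>f\<in>hom V (A \<otimes> Z) Y.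
        \<exists>!g. g \<in> hom V Z H \<and> ev \<cdot> (Ide V A \<odot> g) = f"
      using closed A Y unfolding closed_monoidal_def by blast
    then obtain H ev where H: "H \<in> Obj V" "ev \<in> hom V (A \<otimes> H) Y"
      and u: "\<forall>Z\<in>Obj V. \<forall>f\<in>hom V (A \<otimes> Z) Y. \<exists>!g. g \<in> hom V Z H \<and> ev \<cdot> (Ide V A \<odot> g) = f"
      by blast
    obtain g where g: "g \<in> hom V z H" using initial_ex[OF z H(1)] .
    show "\<exists>!f. f \<in> hom V (A \<otimes> z) Y"
    proof (rule ex1I[of _ "ev \<cdot> (Ide V A \<odot> g)"])
      show "ev \<cdot> (Ide V A \<odot> g) \<in> hom V (A \<otimes> z) Y" using Cmp_in[OF TenA_in[OF Ide_in[OF A] g] H(2)] .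
      fix f assume "f \<in> hom V (A \<otimes> z) Y"
      then obtain g' where "g' \<in> hom V z H" "ev \<cdot> (Ide V A \<odot> g') = f" using u zO by blast
      then show "f = ev \<cdot> (Ide V A \<odot> g)" using initial_eq[OF z g] by blast
    qed
  qed (rule Ten_in[OF A zO])
  show "is_initial V (z \<otimes> A)"
    unfolding is_initial_def
  proof (intro conjI ballI)
    fix Y assume Y: "Y \<in> Obj V"
    have "\<exists>H\<in>Obj V. \<exists>ev\<in>hom V (H \<otimes> A) Y. \<forall>Z\<in>Obj V. \<forall>f\<in>hom V (Z \<otimes> A) Y.
        \<exists>!g. g \<in> hom V Z H \<and> ev \<cdot> (g \<odot> Ide V A) = f"
      using closed A Y unfolding closed_monoidal_def by blast
    then obtain H ev where H: "H \<in> Obj V" "ev \<in> hom V (H \<otimes> A) Y"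
      and u: "\<forall>Z\<in>Obj V. \<forall>f\<in>hom V (Z \<otimes> A) Y. \<exists>!g. g \<in> hom V Z H \<and> ev \<cdot> (g \<odot> Ide V A) = f"
      by blast
    obtain g where g: "g \<in> hom V z H" using initial_ex[OF z H(1)] .
    show "\<exists>!f. f \<in> hom V (z \<otimes> A) Y"
    proof (rule ex1I[of _ "ev \<cdot> (g \<odot> Ide V A)"])
      show "ev \<cdot> (g \<odot> Ide V A) \<in> hom V (z \<otimes> A) Y" using Cmp_in[OF TenA_in[OF g Ide_in[OF A]] H(2)] .
      fix f assume "f \<in> hom V (z \<otimes> A) Y"
      then obtain g' where "g' \<in> hom V z H" "ev \<cdot> (g' \<odot> Ide V A) = f" using u zO by blast
      then show "f = ev \<cdot> (g \<odot> Ide V A)" using initial_eq[OF z g] by blast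
    qed
  qed (rule Ten_in[OF zO A])
qed

text \<open>The pushout-product of \<open>f\<close> with \<open>\<emptyset> \<rightarrow> D\<close> is \<open>f \<otimes> D\<close>, because tensoring with \<open>\<emptyset>\<close> gives initial
  objects.\<close>

lemma tcof_TenA:
  assumes f: "f \<in> hom V A B" "f \<in> Cof M" "f \<in> Weq M" and D: "cofibrant V M D"
  shows "f \<odot> Ide V D \<in> Weq M" "Ide V D \<odot> f \<in> Weq M"
proof -
  obtain z g where z: "is_initial V z" and g: "g \<in> hom V z D" "g \<in> Cof M"
    using D unfolding cofibrant_def by blast
  note A = hom_Obj(1)[OF f(1)] and B = hom_Obj(2)[OF f(1)] and zO = hom_Obj(1)[OF g(1)] and DO = hom_Obj(2)[OF g(1)]
  note one = Ide_in[OF A] Ide_in[OF B] Ide_in[OF zO] Ide_in[OF DO]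
  have F: "f \<in> hom V A B \<inter> Cof M" and G: "g \<in> hom V z D \<inter> Cof M" using f g by blast+
  have push: "u \<in> Weq M" if "f1 \<in> hom V A1 B1 \<inter> Cof M" "g1 \<in> hom V X1 Y1 \<inter> Cof M"
    "is_pushout V (f1 \<odot> Ide V X1) (Ide V A1 \<odot> g1) P i j" "u \<in> hom V P (B1 \<otimes> Y1)"
    "u \<cdot> i = Ide V B1 \<odot> g1" "u \<cdot> j = f1 \<odot> Ide V Y1" "f1 \<in> Weq M \<or> g1 \<in> Weq M"
    for f1 A1 B1 g1 X1 Y1 P i j u
    using pushout_product that unfolding pushout_product_axiom_def by blast
  show "f \<odot> Ide V D \<in> Weq M"
  proof -
    note i1 = Ten_initial(1)[OF z A] and i2 = Ten_initial(1)[OF z B]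
    obtain i where i: "i \<in> hom V (B \<otimes> z) (A \<otimes> D)" using initial_ex[OF i2 Ten_in[OF A DO]] .
    note P = pushout_of_initial(1)[OF i1 i2 TenA_in[OF f(1) one(3)] TenA_in[OF one(1) g(1)] i]
    note u = TenA_in[OF f(1) one(4)]
    show ?thesis
      by (rule push[OF F G P u initial_eq[OF i2 Cmp_in[OF i u] TenA_in[OF one(2) g(1)]] Cmp_Ide[OF u]])
        (use f in blast)
  qed
  show "Ide V D \<odot> f \<in> Weq M"
  proof -
    note i1 = Ten_initial(2)[OF z A] and i2 = Ten_initial(2)[OF z B]
    obtain i where i: "i \<in> hom V (z \<otimes> B) (D \<otimes> A)" using initial_ex[OF i2 Ten_in[OF DO A]] .
    note P = pushout_of_initial(2)[OF i1 i2 TenA_in[OF one(3) f(1)] TenA_in[OF g(1) one(1)] i]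
    note u = TenA_in[OF one(4) f(1)]
    show ?thesis
      by (rule push[OF G F P u Cmp_Ide[OF u] initial_eq[OF i2 Cmp_in[OF i u] TenA_in[OF g(1) one(2)]]])
        (use f in blast)
  qed
qed

text \<open>A weak equivalence is a trivial cofibration followed by a trivial fibration.  The product with
  a cofibrant object preserves the former by the pushout-product axiom, and the latter because it is
  a product.\<close>

lemma Weq_TenA:
  assumes w: "w \<in> hom V A B" "w \<in> Weq M" and D: "cofibrant V M D"
  shows "w \<odot> Ide V D \<in> Weq M" "Ide V D \<odot> w \<in> Weq M"
proof -
  obtain m i q where i: "i \<in> hom V A m" "i \<in> Cof M" "i \<in> Weq M" and q: "q \<in> hom V m B" "q \<in> Fib M"
    and qi: "q \<cdot> i = w" using factor_tcof_fib[OF w(1)] by blast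
  have qw: "q \<in> Weq M" using Weq_cancel_right[OF i(1) q(1) i(3)] w qi by simp
  have DO: "D \<in> Obj V" using D hom_Obj unfolding cofibrant_def by blast
  note one = Ide_in[OF DO] and iso = iso_tfib[OF Ide_in[OF DO] iso_Ide[OF DO]]
  have "w \<odot> Ide V D = (q \<odot> Ide V D) \<cdot> (i \<odot> Ide V D)"
    using TenA_Cmp[OF i(1) q(1) one one] qi Ide_Cmp[OF one] by simp
  then show "w \<odot> Ide V D \<in> Weq M"
    using Weq_Cmp[OF TenA_in[OF i(1) one] TenA_in[OF q(1) one] tcof_TenA(1)[OF i D] TenA_tfib[OF q(1) one q(2) qw iso]]
    by simp
  have "Ide V D \<odot> w = (Ide V D \<odot> q) \<cdot> (Ide V D \<odot> i)"
    using TenA_Cmp[OF one one i(1) q(1)] qi Ide_Cmp[OF one] by simp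
  then show "Ide V D \<odot> w \<in> Weq M"
    using Weq_Cmp[OF TenA_in[OF one i(1)] TenA_in[OF one q(1)] tcof_TenA(2)[OF i D] TenA_tfib[OF one q(1) iso q(2) qw]]
    by simp
qed

subsection \<open>Cofibrant replacement\<close>

lemma initial_some: "is_initial V (SOME z. is_initial V z)"
  using pt_cofibrant unfolding cofibrant_def by (metis someI)

lemma from_initial:
  assumes "X \<in> Obj V"
  shows "from_initial V X \<in> hom V (SOME z. is_initial V z) X"
proof -
  have "\<exists>!f. f \<in> hom V (SOME z. is_initial V z) X"
    using initial_some assms unfolding is_initial_def[of V "SOME z. is_initial V z"] by blast
  then show ?thesis unfolding from_initial_def by (rule theI')
qed

lemma cofrep:
  assumes "X \<in> Obj V"
  shows "cofibrant V M (cofrep V M X)" "cofrep_map V M X \<in> hom V (cofrep V M X) X"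
    "cofrep_map V M X \<in> Fib M" "cofrep_map V M X \<in> Weq M"
proof -
  note f = from_initial[OF assms]
  let ?i = "factL (cof_tfib M) (from_initial V X)"
  have "?i \<in> hom V (SOME z. is_initial V z) (cofrep V M X)" "?i \<in> Cof M"
    and "cofrep_map V M X \<in> hom V (cofrep V M X) X"
    "cofrep_map V M X \<in> Fib M" "cofrep_map V M X \<in> Weq M"
    using cof_tfib cof_tfib_in f
    unfolding functorial_factorization_def cofrep_def cofrep_map_def hom_def by auto
  then show "cofibrant V M (cofrep V M X)" "cofrep_map V M X \<in> hom V (cofrep V M X) X"
    "cofrep_map V M X \<in> Fib M" "cofrep_map V M X \<in> Weq M"
    using initial_some unfolding cofibrant_def by blast+
qed

lemma cofrep_Obj: "X \<in> Obj V \<Longrightarrow> cofrep V M X \<in> Obj V"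
  using hom_Obj(1)[OF cofrep(2)] .

lemma cofrep_square:
  assumes "f \<in> hom V X Y"
  shows "is_square V (from_initial V X) (from_initial V Y) (Ide V (SOME z. is_initial V z)) f"
proof -
  note x = from_initial[OF hom_Obj(1)[OF assms]] and y = from_initial[OF hom_Obj(2)[OF assms]]
  note one = Ide_in[OF hom_Obj(1)[OF x]]
  have "from_initial V Y \<cdot> Ide V (SOME z. is_initial V z) = f \<cdot> from_initial V X"
    using initial_eq[OF initial_some Cmp_in[OF one y] Cmp_in[OF x assms]] .
  then show ?thesis using x y one assms unfolding is_square_def by (simp add: hom_def)
qed

lemma cofrep_arr_eq:
  "f \<in> hom V X Y \<Longrightarrow> cofrep_arr V M f = factM (cof_tfib M) (from_initial V X) (from_initial V Y)
     (Ide V (SOME z. is_initial V z)) f"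
  by (simp add: cofrep_arr_def hom_def)

lemma cofrep_mid:
  "X \<in> Obj V \<Longrightarrow> Cod V (factL (cof_tfib M) (from_initial V X)) = cofrep V M X"
  using cof_tfib from_initial unfolding functorial_factorization_def cofrep_def hom_def by auto

lemma cofrep_arr:
  assumes "f \<in> hom V X Y"
  shows "cofrep_arr V M f \<in> hom V (cofrep V M X) (cofrep V M Y)"
    "cofrep_map V M Y \<cdot> cofrep_arr V M f = f \<cdot> cofrep_map V M X"
proof -
  let ?x = "from_initial V X" and ?y = "from_initial V Y" and ?F = "cof_tfib M"
  have "cofrep_arr V M f \<in> hom V (Cod V (factL ?F ?x)) (Cod V (factL ?F ?y)) \<and>
      factR ?F ?y \<cdot> cofrep_arr V M f = f \<cdot> factR ?F ?x"
    using cof_tfib cofrep_square[OF assms] cofrep_arr_eq[OF assms]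
    unfolding functorial_factorization_def by auto
  then show "cofrep_arr V M f \<in> hom V (cofrep V M X) (cofrep V M Y)"
    "cofrep_map V M Y \<cdot> cofrep_arr V M f = f \<cdot> cofrep_map V M X"
    unfolding cofrep_map_def cofrep_mid[OF hom_Obj(1)[OF assms]] cofrep_mid[OF hom_Obj(2)[OF assms]]
    by blast+
qed

lemma cofrep_arr_Ide:
  assumes "X \<in> Obj V"
  shows "cofrep_arr V M (Ide V X) = Ide V (cofrep V M X)"
proof -
  let ?x = "from_initial V X" and ?F = "cof_tfib M"
  note x = from_initial[OF assms]
  have "factM ?F ?x ?x (Ide V (Dom V ?x)) (Ide V (Cod V ?x)) = Ide V (Cod V (factL ?F ?x))"
    using cof_tfib homD(1)[OF x] unfolding functorial_factorization_def by blast
  then show ?thesis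
    using cofrep_arr_eq[OF Ide_in[OF assms]] unfolding cofrep_mid[OF assms] homD(2,3)[OF x] by simp
qed

lemma cofrep_arr_Cmp:
  assumes "f \<in> hom V X Y" "g \<in> hom V Y Z"
  shows "cofrep_arr V M (g \<cdot> f) = cofrep_arr V M g \<cdot> cofrep_arr V M f"
proof -
  let ?i = "Ide V (SOME z. is_initial V z)"
  have "is_square V (from_initial V X) (from_initial V Y) ?i f \<and> is_square V (from_initial V Y) (from_initial V Z) ?i g"
    using cofrep_square assms by blast
  then have "factM (cof_tfib M) (from_initial V X) (from_initial V Z) (?i \<cdot> ?i) (g \<cdot> f) =
      factM (cof_tfib M) (from_initial V Y) (from_initial V Z) ?i g \<cdot>
      factM (cof_tfib M) (from_initial V X) (from_initial V Y) ?i f"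
    using cof_tfib unfolding functorial_factorization_def by blast
  then show ?thesis
    unfolding cofrep_arr_eq[OF assms(1)] cofrep_arr_eq[OF assms(2)] cofrep_arr_eq[OF Cmp_in[OF assms]]
    using Ide_Cmp[OF Ide_in[OF hom_Obj(1)[OF from_initial[OF hom_Obj(1)[OF assms(1)]]]]] by simp
qed

lemma cofrep_arr_Weq:
  assumes "f \<in> hom V X Y" "f \<in> Weq M"
  shows "cofrep_arr V M f \<in> Weq M"
proof -
  note X = cofrep[OF hom_Obj(1)[OF assms(1)]] and Y = cofrep[OF hom_Obj(2)[OF assms(1)]]
  note f = cofrep_arr[OF assms(1)]
  show ?thesis
    using Weq_cancel_left[OF f(1) Y(2,4)] Weq_Cmp[OF X(2) assms(1) X(4) assms(2)] f(2) by simp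
qed

end

subsection \<open>The product of points of the homotopy category\<close>

lemma zig_eq_map:
  assumes C: "localized_category C S" and D: "localized_category D T" and F: "is_functor C D Fo Fa"
    and FS: "Fa ` S \<subseteq> T" and e: "zig_eq C S X Y p q"
  shows "zig_eq D T (Fo X) (Fo Y) (map (map_zig Fa) p) (map (map_zig Fa) q)"
proof -
  interpret C: localized_category C S by (rule C)
  interpret D: localized_category D T by (rule D)
  have Fhom: "Fa f \<in> hom D (Fo a) (Fo b)" if "f \<in> hom C a b" for f a b
    using F that unfolding is_functor_def by blast
  have zz: "zigzag D T (Fo X) (map (map_zig Fa) p) (Fo Y)" if "zigzag C S X p Y" for X p Y
    using that
  proof (induction rule: zigzag.induct)
    case (Nil X)
    then show ?case using F by (auto simp: is_functor_def intro: zigzag.Nil)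
  next
    case (Fwd f p Y)
    show ?case
      using zigzag_append[OF D.zigzag_hom[OF Fhom[OF C.Arr_hom[OF Fwd(1)]]] Fwd(3)] by simp
  next
    case (Bwd w p Y)
    have "Fa w \<in> T" "w \<in> Arr C" using Bwd(1) FS C.S_Arr by auto
    then show ?case
      using zigzag_append[OF D.zigzag_inv[OF _ Fhom[OF C.Arr_hom]] Bwd(3)] by simp
  qed
  have rel: "zig_rel D T (map (map_zig Fa) l) (map (map_zig Fa) r)" if "zig_rel C S l r" for l r
    using that
  proof cases
    case (1 a)
    then show ?thesis using F zig_rel.intros(1)[of "Fo a" D T] by (simp add: is_functor_def)
  next
    case (2 f a b g c)
    then have "Fa (g \<cdot>\<^bsub>C\<^esub> f) = Fa g \<cdot>\<^bsub>D\<^esub> Fa f" using F unfolding is_functor_def by blast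
    then show ?thesis using 2 zig_rel.intros(2)[OF Fhom Fhom] by simp
  next
    case (3 w)
    then show ?thesis using zig_rel.intros(3)[of "Fa w" T D] FS by auto
  next
    case (4 w)
    then show ?thesis using zig_rel.intros(4)[of "Fa w" T D] FS by auto
  qed
  show ?thesis
    using e
  proof (induction rule: zig_eq.induct)
    case (refl p)
    show ?case by (rule zig_eq.refl[OF zz[OF refl]])
  next
    case (sym p q)
    show ?case by (rule zig_eq.sym[OF sym.IH])
  next
    case (trans p q r)
    show ?case by (rule zig_eq.trans[OF trans.IH])
  next
    case (step l r p q)
    then show ?case
      using zig_eq.step[OF rel[OF step(1)], of "Fo X" "map (map_zig Fa) p" "map (map_zig Fa) q" "Fo Y"]
        zz[OF step(2)] zz[OF step(3)] by simp
  qed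
qed


lemma is_vcatD:
  assumes "is_vcat V A"
  shows "a \<in> vobj A \<Longrightarrow> b \<in> vobj A \<Longrightarrow> vhom A a b \<in> Obj V"
    "a \<in> vobj A \<Longrightarrow> b \<in> vobj A \<Longrightarrow> c \<in> vobj A \<Longrightarrow>
       vcomp A a b c \<in> hom V (vhom A b c \<otimes>\<^bsub>V\<^esub> vhom A a b) (vhom A a c)"
    "a \<in> vobj A \<Longrightarrow> vid A a \<in> hom V \<one>\<^bsub>V\<^esub> (vhom A a a)"
    "a \<in> vobj A \<Longrightarrow> b \<in> vobj A \<Longrightarrow> c \<in> vobj A \<Longrightarrow> d \<in> vobj A \<Longrightarrow>
        vcomp A a b d \<cdot>\<^bsub>V\<^esub> (vcomp A b c d \<odot>\<^bsub>V\<^esub> Ide V (vhom A a b)) =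
        vcomp A a c d \<cdot>\<^bsub>V\<^esub> (Ide V (vhom A c d) \<odot>\<^bsub>V\<^esub> vcomp A a b c)
          \<cdot>\<^bsub>V\<^esub> Assoc V (vhom A c d) (vhom A b c) (vhom A a b)"
    "a \<in> vobj A \<Longrightarrow> b \<in> vobj A \<Longrightarrow>
        vcomp A a b b \<cdot>\<^bsub>V\<^esub> (vid A b \<odot>\<^bsub>V\<^esub> Ide V (vhom A a b)) = LUnit V (vhom A a b)"
    "a \<in> vobj A \<Longrightarrow> b \<in> vobj A \<Longrightarrow>
        vcomp A a a b \<cdot>\<^bsub>V\<^esub> (Ide V (vhom A a b) \<odot>\<^bsub>V\<^esub> vid A a) = RUnit V (vhom A a b)"
  using assms unfolding is_vcat_def by blast+

context cartesian_model_category
begin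

lemma TenA_cofrep_functor:
  assumes "D \<in> Obj V"
  shows "is_functor V V (\<lambda>X. cofrep V M X \<otimes> D) (\<lambda>f. cofrep_arr V M f \<odot> Ide V D)"
    "is_functor V V (\<lambda>X. D \<otimes> cofrep V M X) (\<lambda>f. Ide V D \<odot> cofrep_arr V M f)"
proof -
  note one = Ide_in[OF assms]
  have 1: "cofrep_arr V M (g \<cdot> f) \<odot> Ide V D = (cofrep_arr V M g \<odot> Ide V D) \<cdot> (cofrep_arr V M f \<odot> Ide V D)"
    "Ide V D \<odot> cofrep_arr V M (g \<cdot> f) = (Ide V D \<odot> cofrep_arr V M g) \<cdot> (Ide V D \<odot> cofrep_arr V M f)"
    if "f \<in> hom V a b" "g \<in> hom V b c" for a b c f g
    using TenA_Cmp[OF cofrep_arr(1)[OF that(1)] cofrep_arr(1)[OF that(2)] one one]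
      TenA_Cmp[OF one one cofrep_arr(1)[OF that(1)] cofrep_arr(1)[OF that(2)]]
      cofrep_arr_Cmp[OF that] Ide_Cmp[OF one] by simp_all
  show "is_functor V V (\<lambda>X. cofrep V M X \<otimes> D) (\<lambda>f. cofrep_arr V M f \<odot> Ide V D)"
    unfolding is_functor_def
    using 1(1) TenA_in[OF cofrep_arr(1) one] Ten_in[OF cofrep_Obj assms]
      cofrep_arr_Ide TenA_Ide[OF cofrep_Obj assms] by simp
  show "is_functor V V (\<lambda>X. D \<otimes> cofrep V M X) (\<lambda>f. Ide V D \<odot> cofrep_arr V M f)"
    unfolding is_functor_def
    using 1(2) TenA_in[OF one cofrep_arr(1)] Ten_in[OF assms cofrep_Obj]
      cofrep_arr_Ide TenA_Ide[OF assms cofrep_Obj] by simp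
qed

text \<open>The derived product is defined on all representing strings.  The functors applied to the letters
  preserve weak equivalences, so the strings \<open>[v]\<close> and \<open>[u]\<close> can be used.\<close>

lemma ho_tenA_ho:
  assumes v: "v \<in> hom V X X'" and u: "u \<in> hom V Y Y'"
  shows "ho_tenA V M (ho v) (ho u) = ho (cofrep_arr V M v \<odot> cofrep_arr V M u)"
proof -
  note X = hom_Obj[OF v] and Y = hom_Obj[OF u]
  note QY = cofrep_Obj[OF Y(1)] and QX = cofrep_Obj[OF X(2)]
  note oneY = Ide_in[OF QY] and oneX = Ide_in[OF QX]
  note qv = cofrep_arr(1)[OF v] and qu = cofrep_arr(1)[OF u]
  let ?A = "\<lambda>f. cofrep_arr V M f \<odot> Ide V (cofrep V M Y)"
  let ?B = "\<lambda>g. Ide V (cofrep V M X') \<odot> cofrep_arr V M g"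
  let ?S = "ho_ten V M X Y" and ?m = "ho_ten V M X' Y" and ?T = "ho_ten V M X' Y'"
  have AW: "?A ` Weq M \<subseteq> Weq M" and BW: "?B ` Weq M \<subseteq> Weq M"
    using Weq_TenA(1)[OF cofrep_arr(1) cofrep_arr_Weq cofrep(1)[OF Y(1)]]
      Weq_TenA(2)[OF cofrep_arr(1) cofrep_arr_Weq cofrep(1)[OF X(2)]] Arr_hom[OF Weq_Arr] by blast+
  have A: "zig_eq V (Weq M) ?S ?m (map (map_zig ?A) p) (map (map_zig ?A) q)"
    if "zig_eq V (Weq M) X X' p q" for p q
    using zig_eq_map[OF Ho.localized_category_axioms Ho.localized_category_axioms
        TenA_cofrep_functor(1)[OF QY] AW that] by (simp add: ho_ten_def)
  have B: "zig_eq V (Weq M) ?m ?T (map (map_zig ?B) p) (map (map_zig ?B) q)"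
    if "zig_eq V (Weq M) Y Y' p q" for p q
    using zig_eq_map[OF Ho.localized_category_axioms Ho.localized_category_axioms
        TenA_cofrep_functor(2)[OF QX] BW that] by (simp add: ho_ten_def)
  have Av: "?A v \<in> hom V ?S ?m" and Bu: "?B u \<in> hom V ?m ?T"
    using TenA_in[OF qv oneY] TenA_in[OF oneX qu] by (simp_all add: ho_ten_def)
  have key: "zig_eq V (Weq M) ?S ?T (map (map_zig ?A) p @ map (map_zig ?B) q) r \<longleftrightarrow>
      zig_eq V (Weq M) ?S ?T [Fwd (?A v), Fwd (?B u)] r"
    if p: "zig_eq V (Weq M) X X' [Fwd v] p" and q: "zig_eq V (Weq M) Y Y' [Fwd u] q" for p q r
  proof -
    note a = A[OF p] and b = B[OF q]
    have n: "zigzag V (Weq M) ?S [] ?S" "zigzag V (Weq M) ?T [] ?T"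
      using zigzag.Nil[OF hom_Obj(1)[OF Av]] zigzag.Nil[OF hom_Obj(2)[OF Bu]] .
    have "zig_eq V (Weq M) ?S ?T ([Fwd (?A v)] @ [Fwd (?B u)]) (map (map_zig ?A) p @ [Fwd (?B u)])"
      using zig_eq_append[OF a n(1) Ho.zigzag_hom[OF Bu]] by simp
    moreover have "zig_eq V (Weq M) ?S ?T (map (map_zig ?A) p @ [Fwd (?B u)])
        (map (map_zig ?A) p @ map (map_zig ?B) q)"
      using zig_eq_append[OF b _ n(2), of ?S "map (map_zig ?A) p"] zig_eq_zigzag[OF a] by simp
    ultimately have e: "zig_eq V (Weq M) ?S ?T [Fwd (?A v), Fwd (?B u)] (map (map_zig ?A) p @ map (map_zig ?B) q)"
      using zig_eq.trans by fastforce
    show ?thesis using zig_eq.trans[OF e] zig_eq.trans[OF zig_eq.sym[OF e]] by blast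
  qed
  have "{r. \<exists>p \<in> {p. zig_eq V (Weq M) X X' [Fwd v] p}. \<exists>q \<in> {q. zig_eq V (Weq M) Y Y' [Fwd u] q}.
      zig_eq V (Weq M) ?S ?T (map (map_zig ?A) p @ map (map_zig ?B) q) r} =
      {r. zig_eq V (Weq M) ?S ?T ([Fwd (?A v)] @ [Fwd (?B u)]) r}" (is "?L = ?R")
  proof (intro set_eqI iffI)
    fix r assume "r \<in> ?L"
    then show "r \<in> ?R" using key by auto
  next
    fix r assume "r \<in> ?R"
    moreover have "zig_eq V (Weq M) X X' [Fwd v] [Fwd v]" "zig_eq V (Weq M) Y Y' [Fwd u] [Fwd u]"
      using zig_eq.refl[OF Ho.zigzag_hom[OF v]] zig_eq.refl[OF Ho.zigzag_hom[OF u]] .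
    ultimately show "r \<in> ?L" using key by fastforce
  qed
  then have "ho_tenA V M (ho v) (ho u) = zig_class V (Weq M) ?S ?T ([Fwd (?A v)] @ [Fwd (?B u)])"
    unfolding ho_class[OF v] ho_class[OF u] zig_class_def ho_tenA.simps by simp
  also have "\<dots> = ho (?B u) \<cdot>\<^bsub>Ho V M\<^esub> ho (?A v)"
    using Ho.localization_Cmp[OF Ho.zigzag_hom[OF Av] Ho.zigzag_hom[OF Bu]] ho_class[OF Av] ho_class[OF Bu]
    by (simp add: Ho_def)
  also have "\<dots> = ho (?B u \<cdot> ?A v)" using ho_Cmp[OF Av Bu] by simp
  also have "?B u \<cdot> ?A v = cofrep_arr V M v \<odot> cofrep_arr V M u"
    using TenA_Cmp[OF qv oneX oneY qu] Ide_Cmp[OF qv] Cmp_Ide[OF qu] by simp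
  finally show ?thesis .
qed

definition RUnit_inv :: "'o \<Rightarrow> 'm" where
  "RUnit_inv X = (SOME g. g \<in> hom V X (X \<otimes> \<one>) \<and> g \<cdot> RUnit V X = Ide V (X \<otimes> \<one>) \<and> RUnit V X \<cdot> g = Ide V X)"

lemma RUnit_inv:
  assumes "X \<in> Obj V"
  shows "RUnit_inv X \<in> hom V X (X \<otimes> \<one>)" "RUnit_inv X \<cdot> RUnit V X = Ide V (X \<otimes> \<one>)"
    "RUnit V X \<cdot> RUnit_inv X = Ide V X"
proof -
  note R = RUnit_in[OF assms]
  obtain g where g: "g \<in> hom V X (X \<otimes> \<one>)" "g \<cdot> RUnit V X = Ide V (X \<otimes> \<one>)" "RUnit V X \<cdot> g = Ide V X"
    using iso_arrE[OF R[THEN conjunct2] R[THEN conjunct1]] .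
  have "RUnit_inv X \<in> hom V X (X \<otimes> \<one>) \<and> RUnit_inv X \<cdot> RUnit V X = Ide V (X \<otimes> \<one>) \<and> RUnit V X \<cdot> RUnit_inv X = Ide V X"
    unfolding RUnit_inv_def by (rule someI[of _ g]) (use g in blast)
  then show "RUnit_inv X \<in> hom V X (X \<otimes> \<one>)" "RUnit_inv X \<cdot> RUnit V X = Ide V (X \<otimes> \<one>)"
    "RUnit V X \<cdot> RUnit_inv X = Ide V X" by blast+
qed

lemma RUnit_Unit: "RUnit V \<one> = LUnit V \<one>"
  using bang_eq RUnit_in[OF Unit_in] LUnit_in[OF Unit_in] by blast

lemma ho_unit_inv:
  "ho (cofrep_map V M \<one> \<odot> cofrep_map V M \<one>) \<cdot>\<^bsub>Ho V M\<^esub> ho_unit_inv V M = ho (RUnit_inv \<one>)"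
  "ho_unit_inv V M \<in> hom (Ho V M) \<one> (ho_ten V M \<one> \<one>)"
proof -
  let ?H = "Ho V M" and ?Q = "cofrep V M \<one>" and ?c = "cofrep_map V M \<one>"
  note c = cofrep[OF Unit_in] and Q = cofrep_Obj[OF Unit_in]
  note L = LUnit_in[OF Q, THEN conjunct1] and L1 = LUnit_in[OF Unit_in, THEN conjunct1]
  have Lw: "LUnit V ?Q \<in> Weq M" using iso_tfib[OF L] LUnit_in[OF Q] by blast
  let ?k = "?c \<odot> Ide V ?Q"
  have k: "?k \<in> hom V (?Q \<otimes> ?Q) (\<one> \<otimes> ?Q)" using TenA_in[OF c(2) Ide_in[OF Q]] .
  have kw: "?k \<in> Weq M" using Weq_TenA(1)[OF c(2,4,1)] .
  note ci = Ho.localization_inverse[OF c(4,2), folded ho_class[OF c(2)] Ho_def]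
  note Li = Ho.localization_inverse[OF Lw L, folded ho_class[OF L] Ho_def]
  note ki = Ho.localization_inverse[OF kw k, folded ho_class[OF k] Ho_def]
  let ?bc = "zig_class V (Weq M) \<one> ?Q [Bwd ?c]"
  let ?bL = "zig_class V (Weq M) ?Q (\<one> \<otimes> ?Q) [Bwd (LUnit V ?Q)]"
  let ?bk = "zig_class V (Weq M) (\<one> \<otimes> ?Q) (?Q \<otimes> ?Q) [Bwd ?k]"
  note zc = Ho.zigzag_inv[OF c(4,2)] and zL = Ho.zigzag_inv[OF Lw L] and zk = Ho.zigzag_inv[OF kw k]
  have inv: "ho_unit_inv V M = ?bk \<cdot>\<^bsub>?H\<^esub> (?bL \<cdot>\<^bsub>?H\<^esub> ?bc)"
    using Ho.localization_Cmp[OF zc zL] Ho.localization_Cmp[OF zigzag_append[OF zc zL] zk]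
    by (simp add: Ho_def ho_unit_inv_def ho_ten_def)
  have cc: "?c \<odot> ?c \<in> hom V (?Q \<otimes> ?Q) (\<one> \<otimes> \<one>)" using TenA_in[OF c(2,2)] .
  note bLc = HoC.Cmp_in[OF ci(1) Li(1)]
  note all = HoC.Cmp_in[OF bLc ki(1)]
  show i: "ho_unit_inv V M \<in> hom ?H \<one> (ho_ten V M \<one> \<one>)"
    unfolding inv ho_ten_def using all .
  have "LUnit V \<one> \<cdot> (?c \<odot> ?c) = ?c \<cdot> (LUnit V ?Q \<cdot> ?k)"
    using bang_eq[OF Cmp_in[OF cc L1] Cmp_in[OF Cmp_in[OF k L] c(2)]] .
  then have "ho (LUnit V \<one>) \<cdot>\<^bsub>?H\<^esub> ho (?c \<odot> ?c) = ho ?c \<cdot>\<^bsub>?H\<^esub> (ho (LUnit V ?Q) \<cdot>\<^bsub>?H\<^esub> ho ?k)"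
    using ho_Cmp[OF cc L1] ho_Cmp[OF k L] ho_Cmp[OF Cmp_in[OF k L] c(2)] by simp
  then have "ho (LUnit V \<one>) \<cdot>\<^bsub>?H\<^esub> (ho (?c \<odot> ?c) \<cdot>\<^bsub>?H\<^esub> ho_unit_inv V M) =
      (ho ?c \<cdot>\<^bsub>?H\<^esub> (ho (LUnit V ?Q) \<cdot>\<^bsub>?H\<^esub> ho ?k)) \<cdot>\<^bsub>?H\<^esub> (?bk \<cdot>\<^bsub>?H\<^esub> (?bL \<cdot>\<^bsub>?H\<^esub> ?bc))"
    using HoC.Cmp_assoc[OF all ho_in[OF cc] ho_in[OF L1]] by (simp add: inv)
  also have "\<dots> = ho ?c \<cdot>\<^bsub>?H\<^esub> (ho (LUnit V ?Q) \<cdot>\<^bsub>?H\<^esub> (ho ?k \<cdot>\<^bsub>?H\<^esub> (?bk \<cdot>\<^bsub>?H\<^esub> (?bL \<cdot>\<^bsub>?H\<^esub> ?bc))))"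
    using HoC.Cmp_assoc[OF all HoC.Cmp_in[OF ki(2) Li(2)] ci(2)] HoC.Cmp_assoc[OF all ki(2) Li(2)] by simp
  also have "ho ?k \<cdot>\<^bsub>?H\<^esub> (?bk \<cdot>\<^bsub>?H\<^esub> (?bL \<cdot>\<^bsub>?H\<^esub> ?bc)) = ?bL \<cdot>\<^bsub>?H\<^esub> ?bc"
    using HoC.Cmp_assoc[OF bLc ki(1,2)] ki(4) HoC.Ide_Cmp[OF bLc] by simp
  also have "ho (LUnit V ?Q) \<cdot>\<^bsub>?H\<^esub> (?bL \<cdot>\<^bsub>?H\<^esub> ?bc) = ?bc"
    using HoC.Cmp_assoc[OF ci(1) Li(1,2)] Li(4) HoC.Ide_Cmp[OF ci(1)] by simp
  also have "ho ?c \<cdot>\<^bsub>?H\<^esub> ?bc = Ide ?H \<one>" by (rule ci(4))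
  finally have e: "ho (LUnit V \<one>) \<cdot>\<^bsub>?H\<^esub> (ho (?c \<odot> ?c) \<cdot>\<^bsub>?H\<^esub> ho_unit_inv V M) = Ide ?H \<one>" .
  note R = RUnit_inv[OF Unit_in]
  have "ho (RUnit_inv \<one>) \<cdot>\<^bsub>?H\<^esub> ho (LUnit V \<one>) = Ide ?H (\<one> \<otimes> \<one>)"
    using ho_Cmp[OF L1 R(1)] R(2) ho_Ide[OF Ten_in[OF Unit_in Unit_in]] RUnit_Unit by simp
  then show "ho (?c \<odot> ?c) \<cdot>\<^bsub>?H\<^esub> ho_unit_inv V M = ho (RUnit_inv \<one>)"
    using HoC.left_right_inverse_eq[OF ho_in[OF L1] ho_in[OF R(1)] _ _ e]
      HoC.Cmp_in[OF i[unfolded ho_ten_def] ho_in[OF cc]] by simp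
qed

subsection \<open>Precomposition with a point\<close>

text \<open>Composition of a generalized element \<open>h : S \<rightarrow> A(b, c)\<close> with a point \<open>u : 1 \<rightarrow> A(a, b)\<close>.  Taking \<open>S = 1\<close>
  gives composition of points, and a fiber as \<open>S\<close> gives the maps between fibers.\<close>

definition act :: "('u, 'o, 'm) vcat \<Rightarrow> 'u \<Rightarrow> 'u \<Rightarrow> 'u \<Rightarrow> 'm \<Rightarrow> 'm \<Rightarrow> 'm" where
  "act A a b c h u = vcomp A a b c \<cdot> ((h \<odot> u) \<cdot> RUnit_inv (Dom V h))"

lemma RUnit_inv_nat:
  assumes "s \<in> hom V X Y"
  shows "(s \<odot> Ide V \<one>) \<cdot> RUnit_inv X = RUnit_inv Y \<cdot> s"
proof -
  note X = RUnit_inv[OF hom_Obj(1)[OF assms]] and Y = RUnit_inv[OF hom_Obj(2)[OF assms]]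
  note RX = RUnit_in[OF hom_Obj(1)[OF assms], THEN conjunct1]
    and RY = RUnit_in[OF hom_Obj(2)[OF assms], THEN conjunct1]
  have s1: "s \<odot> Ide V \<one> \<in> hom V (X \<otimes> \<one>) (Y \<otimes> \<one>)" using TenA_in[OF assms Ide_in[OF Unit_in]] .
  note w = Cmp_in[OF X(1) s1]
  have "(s \<odot> Ide V \<one>) \<cdot> RUnit_inv X = RUnit_inv Y \<cdot> (RUnit V Y \<cdot> ((s \<odot> Ide V \<one>) \<cdot> RUnit_inv X))"
    using Cmp_assoc[OF w RY Y(1)] Y(2) Ide_Cmp[OF w] by simp
  also have "RUnit V Y \<cdot> ((s \<odot> Ide V \<one>) \<cdot> RUnit_inv X) = s \<cdot> (RUnit V X \<cdot> RUnit_inv X)"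
    using Cmp_assoc[OF X(1) s1 RY] RUnit_nat[OF assms] Cmp_assoc[OF X(1) RX assms] by simp
  also have "\<dots> = s" using X(3) Cmp_Ide[OF assms] by simp
  finally show ?thesis .
qed

end

locale vcat_on = cartesian_model_category V M
  for V :: "('o, 'm) moncat" (structure) and M :: "'m model" +
  fixes A :: "('u, 'o, 'm) vcat"
  assumes vcat: "is_vcat V A"
begin

lemmas vcatD = is_vcatD[OF vcat]

lemma act_eq: "h \<in> hom V S X \<Longrightarrow> act A a b c h u = vcomp A a b c \<cdot> ((h \<odot> u) \<cdot> RUnit_inv S)"
  by (simp add: act_def hom_def)

lemma act_in:
  assumes "a \<in> vobj A" "b \<in> vobj A" "c \<in> vobj A"
    and h: "h \<in> hom V S (vhom A b c)" and u: "u \<in> hom V \<one> (vhom A a b)"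
  shows "act A a b c h u \<in> hom V S (vhom A a c)"
  unfolding act_eq[OF h]
  using Cmp_in[OF Cmp_in[OF RUnit_inv(1)[OF hom_Obj(1)[OF h]] TenA_in[OF h u]] vcatD(2)[OF assms(1-3)]] .

lemma act_Cmp:
  assumes "a \<in> vobj A" "b \<in> vobj A" "c \<in> vobj A"
    and h: "h \<in> hom V S (vhom A b c)" and u: "u \<in> hom V \<one> (vhom A a b)" and s: "s \<in> hom V T S"
  shows "act A a b c (h \<cdot> s) u = act A a b c h u \<cdot> s"
proof -
  note r = RUnit_inv(1)[OF hom_Obj(1)[OF h]] and r' = RUnit_inv(1)[OF hom_Obj(1)[OF s]]
  note one = Ide_in[OF Unit_in] and hu = TenA_in[OF h u]
  have "(h \<cdot> s) \<odot> u = (h \<odot> u) \<cdot> (s \<odot> Ide V \<one>)" using TenA_Cmp[OF s h one u] Cmp_Ide[OF u] by simp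
  then have "((h \<cdot> s) \<odot> u) \<cdot> RUnit_inv T = (h \<odot> u) \<cdot> (RUnit_inv S \<cdot> s)"
    using Cmp_assoc[OF r' TenA_in[OF s one] hu] RUnit_inv_nat[OF s] by simp
  also have "\<dots> = ((h \<odot> u) \<cdot> RUnit_inv S) \<cdot> s" using Cmp_assoc[OF s r hu] .
  finally show ?thesis
    unfolding act_eq[OF h] act_eq[OF Cmp_in[OF s h]]
    using Cmp_assoc[OF s Cmp_in[OF r hu] vcatD(2)[OF assms(1-3)]] by simp
qed

lemma act_id:
  assumes "b \<in> vobj A" "c \<in> vobj A" and h: "h \<in> hom V S (vhom A b c)"
  shows "act A b b c h (vid A b) = h"
proof -
  note r = RUnit_inv[OF hom_Obj(1)[OF h]] and X = hom_Obj(2)[OF h]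
  note i = vcatD(3)[OF assms(1)] and one = Ide_in[OF Unit_in] and v = vcatD(2)[OF assms(1,1,2)]
  note h1 = TenA_in[OF h one] and R = RUnit_in[OF hom_Obj(1)[OF h], THEN conjunct1]
  have "h \<odot> vid A b = (Ide V (vhom A b c) \<odot> vid A b) \<cdot> (h \<odot> Ide V \<one>)"
    using TenA_Cmp[OF h Ide_in[OF X] one i] Ide_Cmp[OF h] Cmp_Ide[OF i] by simp
  then have "act A b b c h (vid A b) =
      vcomp A b b c \<cdot> ((Ide V (vhom A b c) \<odot> vid A b) \<cdot> ((h \<odot> Ide V \<one>) \<cdot> RUnit_inv S))"
    unfolding act_eq[OF h] using Cmp_assoc[OF r(1) h1 TenA_in[OF Ide_in[OF X] i]] by simp
  also have "\<dots> = RUnit V (vhom A b c) \<cdot> ((h \<odot> Ide V \<one>) \<cdot> RUnit_inv S)"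
    using Cmp_assoc[OF Cmp_in[OF r(1) h1] TenA_in[OF Ide_in[OF X] i] v] vcatD(6)[OF assms(1,2)] by simp
  also have "\<dots> = h \<cdot> (RUnit V S \<cdot> RUnit_inv S)"
    using Cmp_assoc[OF r(1) h1 RUnit_in[OF X, THEN conjunct1]] RUnit_nat[OF h] Cmp_assoc[OF r(1) R h] by simp
  also have "\<dots> = h" using r(3) Cmp_Ide[OF h] by simp
  finally show ?thesis .
qed

lemma act_act:
  assumes a: "a \<in> vobj A" and b: "b \<in> vobj A" and c: "c \<in> vobj A" and d: "d \<in> vobj A"
    and h: "h \<in> hom V S (vhom A c d)" and v: "v \<in> hom V \<one> (vhom A b c)" and u: "u \<in> hom V \<one> (vhom A a b)"
  shows "act A a b d (act A b c d h v) u = act A a c d h (act A a b c v u)"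
proof -
  note S = hom_Obj(1)[OF h] and X = hom_Obj(2)[OF h] and Y = hom_Obj(2)[OF v] and Z = hom_Obj(2)[OF u]
  let ?r = "RUnit_inv S" and ?l = "RUnit_inv \<one>"
  note r = RUnit_inv[OF S] and l = RUnit_inv[OF Unit_in]
  note one = Ide_in[OF Unit_in] and oneS = Ide_in[OF S]
  note R = RUnit_in[OF S, THEN conjunct1]
  note hv = TenA_in[OF h v] and vu = TenA_in[OF v u]
  note m = vcatD(2)[OF b c d] and n = vcatD(2)[OF a b d] and m' = vcatD(2)[OF a b c] and n' = vcatD(2)[OF a c d]
  note as = Assoc_in[OF X Y Z, THEN conjunct1] and as1 = Assoc_in[OF S Unit_in Unit_in, THEN conjunct1]
  note r1 = TenA_in[OF r(1) one]
  have lhs: "act A b c d h v \<odot> u =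
      (vcomp A b c d \<odot> Ide V (vhom A a b)) \<cdot> (((h \<odot> v) \<odot> u) \<cdot> (?r \<odot> Ide V \<one>))"
    unfolding act_eq[OF h]
    using TenA_Cmp[OF Cmp_in[OF r(1) hv] m u Ide_in[OF Z]] TenA_Cmp[OF r(1) hv one u]
      Cmp_Ide[OF u] Ide_Cmp[OF u] by simp
  have mm: "vcomp A b c d \<odot> Ide V (vhom A a b) \<in> hom V ((vhom A c d \<otimes> vhom A b c) \<otimes> vhom A a b) (vhom A b d \<otimes> vhom A a b)"
    using TenA_in[OF m Ide_in[OF Z]] .
  have hvu: "(h \<odot> v) \<odot> u \<in> hom V ((S \<otimes> \<one>) \<otimes> \<one>) ((vhom A c d \<otimes> vhom A b c) \<otimes> vhom A a b)"
    using TenA_in[OF hv u] .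
  have hvu': "h \<odot> (v \<odot> u) \<in> hom V (S \<otimes> (\<one> \<otimes> \<one>)) (vhom A c d \<otimes> (vhom A b c \<otimes> vhom A a b))"
    using TenA_in[OF h vu] .
  let ?w = "(?r \<odot> Ide V \<one>) \<cdot> ?r"
  note w = Cmp_in[OF r(1) r1]
  \<comment> \<open>The triangle axiom identifies both ways of inserting two units.\<close>
  have tri: "Assoc V S \<one> \<one> \<cdot> ?w = (Ide V S \<odot> ?l) \<cdot> ?r"
  proof -
    note L = LUnit_in[OF Unit_in, THEN conjunct1]
    note SL = TenA_in[OF oneS L] and Sl = TenA_in[OF oneS l(1)] and aw = Cmp_in[OF w as1]
    have "(Ide V S \<odot> ?l) \<cdot> (Ide V S \<odot> LUnit V \<one>) = Ide V (S \<otimes> (\<one> \<otimes> \<one>))"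
      using TenA_Cmp[OF oneS oneS L l(1)] l(2) RUnit_Unit Ide_Cmp[OF oneS] TenA_Ide[OF S Ten_in[OF Unit_in Unit_in]]
      by simp
    then have "Assoc V S \<one> \<one> \<cdot> ?w = (Ide V S \<odot> ?l) \<cdot> ((Ide V S \<odot> LUnit V \<one>) \<cdot> (Assoc V S \<one> \<one> \<cdot> ?w))"
      using Cmp_assoc[OF aw SL Sl] Ide_Cmp[OF aw] by simp
    also have "(Ide V S \<odot> LUnit V \<one>) \<cdot> (Assoc V S \<one> \<one> \<cdot> ?w) = (RUnit V S \<odot> Ide V \<one>) \<cdot> ?w"
      using Cmp_assoc[OF w as1 SL] triangle[OF S Unit_in] by simp
    also have "\<dots> = ((RUnit V S \<odot> Ide V \<one>) \<cdot> (?r \<odot> Ide V \<one>)) \<cdot> ?r"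
      using Cmp_assoc[OF r(1) r1 TenA_in[OF R one]] by simp
    also have "(RUnit V S \<odot> Ide V \<one>) \<cdot> (?r \<odot> Ide V \<one>) = Ide V (S \<otimes> \<one>)"
      using TenA_Cmp[OF r(1) R one one] r(3) Ide_Cmp[OF one] TenA_Ide[OF S Unit_in] by simp
    also have "Ide V (S \<otimes> \<one>) \<cdot> ?r = ?r" using Ide_Cmp[OF r(1)] .
    finally show ?thesis .
  qed
  have "act A a b d (act A b c d h v) u = vcomp A a b d \<cdot>
      (((vcomp A b c d \<odot> Ide V (vhom A a b)) \<cdot> (((h \<odot> v) \<odot> u) \<cdot> (?r \<odot> Ide V \<one>))) \<cdot> ?r)"
    unfolding act_eq[OF act_in[OF b c d h v]] lhs ..
  also have "\<dots> = vcomp A a b d \<cdot> ((vcomp A b c d \<odot> Ide V (vhom A a b)) \<cdot> (((h \<odot> v) \<odot> u) \<cdot> ?w))"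
    using Cmp_assoc[OF r(1) Cmp_in[OF r1 hvu] mm] Cmp_assoc[OF r(1) r1 hvu] by simp
  also have "\<dots> = (vcomp A a b d \<cdot> (vcomp A b c d \<odot> Ide V (vhom A a b))) \<cdot> (((h \<odot> v) \<odot> u) \<cdot> ?w)"
    using Cmp_assoc[OF Cmp_in[OF w hvu] mm n] .
  also have "\<dots> = (vcomp A a c d \<cdot> (Ide V (vhom A c d) \<odot> vcomp A a b c)
          \<cdot> Assoc V (vhom A c d) (vhom A b c) (vhom A a b)) \<cdot> (((h \<odot> v) \<odot> u) \<cdot> ?w)"
    using vcatD(4)[OF a b c d] by simp
  also have "\<dots> = vcomp A a c d \<cdot> ((Ide V (vhom A c d) \<odot> vcomp A a b c) \<cdot>
      (Assoc V (vhom A c d) (vhom A b c) (vhom A a b) \<cdot> (((h \<odot> v) \<odot> u) \<cdot> ?w)))"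
  proof -
    note x = TenA_in[OF Ide_in[OF X] m'] and y = Cmp_in[OF w hvu]
    show ?thesis
      using Cmp_assoc[OF y as Cmp_in[OF x n']] Cmp_assoc[OF Cmp_in[OF y as] x n'] by simp
  qed
  also have "Assoc V (vhom A c d) (vhom A b c) (vhom A a b) \<cdot> (((h \<odot> v) \<odot> u) \<cdot> ?w)
      = (h \<odot> (v \<odot> u)) \<cdot> ((Ide V S \<odot> ?l) \<cdot> ?r)"
    using Cmp_assoc[OF w hvu as] Assoc_nat[OF h v u] Cmp_assoc[OF w as1 hvu'] tri by simp
  also have "(Ide V (vhom A c d) \<odot> vcomp A a b c) \<cdot> ((h \<odot> (v \<odot> u)) \<cdot> ((Ide V S \<odot> ?l) \<cdot> ?r))
      = (h \<odot> act A a b c v u) \<cdot> ?r"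
  proof -
    note x = TenA_in[OF Ide_in[OF X] m'] and y = TenA_in[OF oneS l(1)]
    have "h \<odot> act A a b c v u = (Ide V (vhom A c d) \<odot> vcomp A a b c) \<cdot> ((h \<odot> (v \<odot> u)) \<cdot> (Ide V S \<odot> ?l))"
      unfolding act_eq[OF v]
      using TenA_Cmp[OF h Ide_in[OF X] Cmp_in[OF l(1) vu] m'] TenA_Cmp[OF oneS h l(1) vu]
        Cmp_Ide[OF h] Ide_Cmp[OF h] by simp
    then show ?thesis
      using Cmp_assoc[OF r(1) Cmp_in[OF y hvu'] x] Cmp_assoc[OF r(1) y hvu'] by simp
  qed
  finally show ?thesis unfolding act_eq[OF h] .
qed

text \<open>Composition in the category of components is computed by composing representing points: the
  cofibrant replacements in the derived product cancel against the comparison and the unit.\<close>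

lemma pi0_comp_points:
  assumes a: "a \<in> vobj A" and b: "b \<in> vobj A" and c: "c \<in> vobj A"
    and v: "v \<in> hom V \<one> (vhom A b c)" and u: "u \<in> hom V \<one> (vhom A a b)"
  shows "pi0_comp V M A a b c (ho v) (ho u) = ho (act A a b c v u)"
proof -
  let ?H = "Ho V M" and ?c = "cofrep_map V M \<one>"
  note m = vcatD(2)[OF a b c] and X = hom_Obj(2)[OF v] and Y = hom_Obj(2)[OF u]
  let ?k = "cofrep_map V M (vhom A b c) \<odot> cofrep_map V M (vhom A a b)"
  let ?q = "cofrep_arr V M v \<odot> cofrep_arr V M u"
  note k = TenA_in[OF cofrep(2)[OF X] cofrep(2)[OF Y]]
  note q = TenA_in[OF cofrep_arr(1)[OF v] cofrep_arr(1)[OF u]]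
  note cc = TenA_in[OF cofrep(2)[OF Unit_in] cofrep(2)[OF Unit_in]]
  note vu = TenA_in[OF v u] and i = ho_unit_inv(2)[unfolded ho_ten_def] and r = RUnit_inv(1)[OF Unit_in]
  have "?k \<cdot> ?q = (v \<odot> u) \<cdot> (?c \<odot> ?c)"
    using TenA_Cmp[OF cofrep_arr(1)[OF v] cofrep(2)[OF X] cofrep_arr(1)[OF u] cofrep(2)[OF Y]]
      TenA_Cmp[OF cofrep(2)[OF Unit_in] v cofrep(2)[OF Unit_in] u] cofrep_arr(2)[OF v] cofrep_arr(2)[OF u] by simp
  then have kq: "ho ?k \<cdot>\<^bsub>?H\<^esub> ho ?q = ho (v \<odot> u) \<cdot>\<^bsub>?H\<^esub> ho (?c \<odot> ?c)"
    using ho_Cmp[OF q k] ho_Cmp[OF cc vu] by simp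
  have "pi0_comp V M A a b c (ho v) (ho u) =
      ((ho (vcomp A a b c) \<cdot>\<^bsub>?H\<^esub> ho ?k) \<cdot>\<^bsub>?H\<^esub> ho ?q) \<cdot>\<^bsub>?H\<^esub> ho_unit_inv V M"
    by (simp add: pi0_comp_def ho_ten_comparison_def ho_tenA_ho[OF v u])
  also have "\<dots> = ho (vcomp A a b c) \<cdot>\<^bsub>?H\<^esub> ((ho ?k \<cdot>\<^bsub>?H\<^esub> ho ?q) \<cdot>\<^bsub>?H\<^esub> ho_unit_inv V M)"
    using HoC.Cmp_assoc[OF ho_in[OF q] ho_in[OF k] ho_in[OF m]]
      HoC.Cmp_assoc[OF i HoC.Cmp_in[OF ho_in[OF q] ho_in[OF k]] ho_in[OF m]] by simp
  also have "(ho ?k \<cdot>\<^bsub>?H\<^esub> ho ?q) \<cdot>\<^bsub>?H\<^esub> ho_unit_inv V M = ho (v \<odot> u) \<cdot>\<^bsub>?H\<^esub> ho (RUnit_inv \<one>)"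
    unfolding kq using HoC.Cmp_assoc[OF i ho_in[OF cc] ho_in[OF vu]] ho_unit_inv(1) by simp
  also have "ho (vcomp A a b c) \<cdot>\<^bsub>?H\<^esub> \<dots> = ho (act A a b c v u)"
    unfolding act_eq[OF v] using ho_Cmp[OF r vu] ho_Cmp[OF Cmp_in[OF r vu] m] by simp
  finally show ?thesis .
qed

end

section \<open>Enriched categories\<close>

lemma VCat_Obj: "A \<in> Obj (VCat V) \<longleftrightarrow> is_vcat V A \<and> small (vobj A)"
  by (simp add: VCat_def)

lemma VCat_hom: "F \<in> hom (VCat V) A B \<longleftrightarrow>
    is_vfun V F \<and> vsrc F = A \<and> vtgt F = B \<and> small (vobj A) \<and> small (vobj B)"
  by (auto simp: VCat_def hom_def)

lemma VCat_Cmp: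
  "a \<in> vobj (vsrc F) \<Longrightarrow> vfo (G \<cdot>\<^bsub>VCat V\<^esub> F) a = vfo G (vfo F a)"
  "a \<in> vobj (vsrc F) \<Longrightarrow> b \<in> vobj (vsrc F) \<Longrightarrow>
     vfh (G \<cdot>\<^bsub>VCat V\<^esub> F) a b = vfh G (vfo F a) (vfo F b) \<cdot>\<^bsub>V\<^esub> vfh F a b"
  by (simp_all add: VCat_def)

lemma is_vfunD:
  assumes "is_vfun V F" "vsrc F = A" "vtgt F = B"
  shows "is_vcat V A" "is_vcat V B" "a \<in> vobj A \<Longrightarrow> vfo F a \<in> vobj B"
    "a \<in> vobj A \<Longrightarrow> b \<in> vobj A \<Longrightarrow> vfh F a b \<in> hom V (vhom A a b) (vhom B (vfo F a) (vfo F b))"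
    "a \<in> vobj A \<Longrightarrow> b \<in> vobj A \<Longrightarrow> c \<in> vobj A \<Longrightarrow> vfh F a c \<cdot>\<^bsub>V\<^esub> vcomp A a b c =
        vcomp B (vfo F a) (vfo F b) (vfo F c) \<cdot>\<^bsub>V\<^esub> (vfh F b c \<odot>\<^bsub>V\<^esub> vfh F a b)"
    "a \<in> vobj A \<Longrightarrow> vfh F a a \<cdot>\<^bsub>V\<^esub> vid A a = vid B (vfo F a)"
    "a \<notin> vobj A \<Longrightarrow> vfo F a = undefined"
    "\<not> (a \<in> vobj A \<and> b \<in> vobj A) \<Longrightarrow> vfh F a b = undefined"
  using assms unfolding is_vfun_def Let_def by blast+

definition full_subcat :: "('u, 'o, 'm) vcat \<Rightarrow> 'u set \<Rightarrow> ('u, 'o, 'm) vcat" where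
  "full_subcat A S = \<lparr>vobj = S,
     vhom = (\<lambda>a b. if a \<in> S \<and> b \<in> S then vhom A a b else undefined),
     vcomp = (\<lambda>a b c. if a \<in> S \<and> b \<in> S \<and> c \<in> S then vcomp A a b c else undefined),
     vid = (\<lambda>a. if a \<in> S then vid A a else undefined)\<rparr>"

definition inclusion :: "('o, 'm) moncat \<Rightarrow> ('u, 'o, 'm) vcat \<Rightarrow> 'u set \<Rightarrow> ('u, 'o, 'm) vfun" where
  "inclusion V A S = \<lparr>vsrc = full_subcat A S, vtgt = A,
     vfo = (\<lambda>a. if a \<in> S then a else undefined),
     vfh = (\<lambda>a b. if a \<in> S \<and> b \<in> S then Ide V (vhom A a b) else undefined)\<rparr>"

text \<open>The object \<open>undefined\<close> stands for an arbitrary element of the universe.\<close>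

definition terminal_vcat :: "('o, 'm) moncat \<Rightarrow> 'o \<Rightarrow> ('u, 'o, 'm) vcat" where
  "terminal_vcat V t = \<lparr>vobj = {undefined},
     vhom = (\<lambda>a b. if a = undefined \<and> b = undefined then t else undefined),
     vcomp = (\<lambda>a b c. if a = undefined \<and> b = undefined \<and> c = undefined
       then (THE f. f \<in> hom V (t \<otimes>\<^bsub>V\<^esub> t) t) else undefined),
     vid = (\<lambda>a. if a = undefined then (THE f. f \<in> hom V \<one>\<^bsub>V\<^esub> t) else undefined)\<rparr>"

definition to_terminal_vcat :: "('o, 'm) moncat \<Rightarrow> 'o \<Rightarrow> ('u, 'o, 'm) vcat \<Rightarrow> ('u, 'o, 'm) vfun" where
  "to_terminal_vcat V t A = \<lparr>vsrc = A, vtgt = terminal_vcat V t, vfo = (\<lambda>a. undefined),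
     vfh = (\<lambda>a b. if a \<in> vobj A \<and> b \<in> vobj A then (THE f. f \<in> hom V (vhom A a b) t) else undefined)\<rparr>"

lemma small_subset: "S \<subseteq> T \<Longrightarrow> small T \<Longrightarrow> small S"
  unfolding small_def using lesspoll_trans1 subset_imp_lepoll by blast

context monoidal_category
begin

lemma full_subcat_vcat:
  assumes "is_vcat V A" "S \<subseteq> vobj A"
  shows "is_vcat V (full_subcat A S)"
  using assms unfolding is_vcat_def full_subcat_def by (simp add: subset_iff)

lemma inclusion_vfun:
  assumes A: "is_vcat V A" and S: "S \<subseteq> vobj A"
  shows "is_vfun V (inclusion V A S)"
proof -
  have h: "vhom A a b \<in> Obj V" if "a \<in> S" "b \<in> S" for a b
    using is_vcatD(1)[OF A] S that by blast
  have c: "vcomp A a b c \<in> hom V (vhom A b c \<otimes> vhom A a b) (vhom A a c)"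
    if "a \<in> S" "b \<in> S" "c \<in> S" for a b c
    using is_vcatD(2)[OF A] S that by blast
  have i: "vid A a \<in> hom V \<one> (vhom A a a)" if "a \<in> S" for a
    using is_vcatD(3)[OF A] S that by blast
  show ?thesis
    unfolding is_vfun_def Let_def
    using A full_subcat_vcat[OF A S] S h Ide_in[OF h] TenA_Ide[OF h h] Ide_Cmp[OF c] Cmp_Ide[OF c] Ide_Cmp[OF i]
    by (auto simp: inclusion_def full_subcat_def)
qed

lemma corestrict_vfun:
  assumes F: "is_vfun V F" and S: "vfo F ` vobj (vsrc F) \<subseteq> S" "S \<subseteq> vobj (vtgt F)"
  shows "is_vfun V (F\<lparr>vtgt := full_subcat (vtgt F) S\<rparr>)"
proof -
  have B: "is_vcat V (vtgt F)" using F unfolding is_vfun_def Let_def by blast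
  show ?thesis
    using F S full_subcat_vcat[OF B S(2)] unfolding is_vfun_def Let_def
    by (simp add: full_subcat_def image_subset_iff)
qed

lemma inclusion_corestrict:
  assumes F: "is_vfun V F" and S: "vfo F ` vobj (vsrc F) \<subseteq> S"
  shows "inclusion V (vtgt F) S \<cdot>\<^bsub>VCat V\<^esub> F\<lparr>vtgt := full_subcat (vtgt F) S\<rparr> = F"
proof -
  note d = is_vfunD[OF F HOL.refl HOL.refl]
  have "Ide V (vhom (vtgt F) (vfo F a) (vfo F b)) \<cdot> vfh F a b = vfh F a b"
    if "a \<in> vobj (vsrc F)" "b \<in> vobj (vsrc F)" for a b
    using Ide_Cmp[OF d(4)[OF that]] .
  then show ?thesis
    using S d(7,8) by (intro vfun.equality ext) (auto simp: VCat_def inclusion_def image_subset_iff)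
qed

lemma terminal_The:
  assumes "is_terminal V t" "X \<in> Obj V"
  shows "(THE f. f \<in> hom V X t) \<in> hom V X t"
  by (rule theI') (use assms in \<open>auto simp: is_terminal_def\<close>)

lemma terminal_vcat:
  assumes t: "is_terminal V t"
  shows "is_vcat V (terminal_vcat V t)"
proof -
  have tO: "t \<in> Obj V" using t unfolding is_terminal_def by blast
  note c = terminal_The[OF t Ten_in[OF tO tO]] and i = terminal_The[OF t Unit_in]
  note one = Ide_in[OF tO] and as = Assoc_in[OF tO tO tO, THEN conjunct1]
  let ?c = "THE f. f \<in> hom V (t \<otimes> t) t" and ?i = "THE f. f \<in> hom V \<one> t"
  have "?c \<cdot> (?c \<odot> Ide V t) = ?c \<cdot> (Ide V t \<odot> ?c) \<cdot> Assoc V t t t"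
    using terminal_eq[OF t Cmp_in[OF TenA_in[OF c one] c] Cmp_in[OF as Cmp_in[OF TenA_in[OF one c] c]]] .
  moreover have "?c \<cdot> (?i \<odot> Ide V t) = LUnit V t"
    using terminal_eq[OF t Cmp_in[OF TenA_in[OF i one] c]] LUnit_in[OF tO] by blast
  moreover have "?c \<cdot> (Ide V t \<odot> ?i) = RUnit V t"
    using terminal_eq[OF t Cmp_in[OF TenA_in[OF one i] c]] RUnit_in[OF tO] by blast
  ultimately show ?thesis
    using tO c i unfolding is_vcat_def terminal_vcat_def by simp
qed

lemma to_terminal_vcat:
  assumes t: "is_terminal V t" and A: "is_vcat V A"
  shows "is_vfun V (to_terminal_vcat V t A)"
proof -
  have tO: "t \<in> Obj V" using t unfolding is_terminal_def by blast
  note c = terminal_The[OF t Ten_in[OF tO tO]] and i = terminal_The[OF t Unit_in]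
  have h: "vhom A a b \<in> Obj V" if "a \<in> vobj A" "b \<in> vobj A" for a b
    using is_vcatD(1)[OF A that] .
  have m: "vcomp A a b c \<in> hom V (vhom A b c \<otimes> vhom A a b) (vhom A a c)"
    if "a \<in> vobj A" "b \<in> vobj A" "c \<in> vobj A" for a b c
    using is_vcatD(2)[OF A that] .
  have j: "vid A a \<in> hom V \<one> (vhom A a a)" if "a \<in> vobj A" for a
    using is_vcatD(3)[OF A that] .
  let ?t = "\<lambda>X. THE f. f \<in> hom V X t"
  note T = terminal_The[OF t h]
  have "?t (vhom A a c) \<cdot> vcomp A a b c = ?t (t \<otimes> t) \<cdot> (?t (vhom A b c) \<odot> ?t (vhom A a b))"
    if "a \<in> vobj A" "b \<in> vobj A" "c \<in> vobj A" for a b c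
    using terminal_eq[OF t Cmp_in[OF m[OF that] T[OF that(1,3)]]
      Cmp_in[OF TenA_in[OF T[OF that(2,3)] T[OF that(1,2)]] terminal_The[OF t Ten_in[OF tO tO]]]] .
  moreover have "?t (vhom A a a) \<cdot> vid A a = ?t \<one>" if "a \<in> vobj A" for a
    using terminal_eq[OF t Cmp_in[OF j[OF that] T[OF that that]] i] .
  ultimately show ?thesis
    unfolding is_vfun_def Let_def using A terminal_vcat[OF t] T
    by (simp add: to_terminal_vcat_def terminal_vcat_def)
qed

lemma terminal_vcat_terminal:
  assumes t: "is_terminal V t" and u: "infinite (UNIV :: 'u set)"
  shows "is_terminal (VCat V) (terminal_vcat V t :: ('u, 'o, 'm) vcat)"
  unfolding is_terminal_def
proof (intro conjI ballI)
  let ?T = "terminal_vcat V t :: ('u, 'o, 'm) vcat"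
  have sT: "small (vobj ?T)" by (simp add: terminal_vcat_def finite_small[OF u])
  then show "?T \<in> Obj (VCat V)" using terminal_vcat[OF t] by (simp add: VCat_Obj)
  fix A :: "('u, 'o, 'm) vcat" assume "A \<in> Obj (VCat V)"
  then have A: "is_vcat V A" "small (vobj A)" by (simp_all add: VCat_Obj)
  let ?F = "to_terminal_vcat V t A"
  have "?F \<in> hom (VCat V) A ?T"
    using to_terminal_vcat[OF t A(1)] A sT by (simp add: VCat_hom to_terminal_vcat_def)
  moreover have "G = ?F" if "G \<in> hom (VCat V) A ?T" for G
  proof -
    have G: "is_vfun V G" "vsrc G = A" "vtgt G = ?T" using that by (simp_all add: VCat_hom)
    note d = is_vfunD[OF G]
    have "vfo G a = undefined" for a using d(3)[of a] d(7)[of a] by (auto simp: terminal_vcat_def)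
    moreover have "vfh G a b = (THE f. f \<in> hom V (vhom A a b) t)" if ab: "a \<in> vobj A" "b \<in> vobj A" for a b
    proof -
      have "vhom A a b \<in> Obj V" using is_vcatD(1)[OF A(1) ab] .
      moreover have "vfh G a b \<in> hom V (vhom A a b) t"
        using d(4)[OF ab] d(3)[OF ab(1)] d(3)[OF ab(2)] by (simp add: terminal_vcat_def)
      ultimately show ?thesis using terminal_eq[OF t _ terminal_The[OF t]] by blast
    qed
    ultimately show ?thesis
      using G d(8) by (intro vfun.equality ext) (auto simp: to_terminal_vcat_def)
  qed
  ultimately show "\<exists>!F. F \<in> hom (VCat V) A ?T" by blast
qed

end

section \<open>Weak equivalences of enriched categories\<close>

locale canonical_vcat = monoidal_category V + model_structure V M
  for V :: "('o, 'm) moncat" (structure) and M :: "'m model" +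
  fixes K :: "('u, 'o, 'm) vfun model"
  assumes canonical: "canonical_model_structure V M K"
    and universe: "infinite (UNIV :: 'u set)"
    and terminal: "\<exists>t. is_terminal V t"
begin

sublocale K: model_structure "VCat V" K
  using canonical unfolding canonical_model_structure_def by blast

lemma fibrant_vcat_iff: "A \<in> Obj (VCat V) \<Longrightarrow> fibrant (VCat V) K A \<longleftrightarrow>
    (\<forall>a \<in> vobj A. \<forall>b \<in> vobj A. fibrant V M (vhom A a b))"
  using canonical unfolding canonical_model_structure_def by blast

lemma Weq_hom:
  assumes "F \<in> hom (VCat V) A B" "F \<in> Weq K" "a \<in> vobj A" "b \<in> vobj A"
  shows "vfh F a b \<in> Weq M"
proof -
  have "DK_equivalence V M F"
    using canonical assms(1,2) unfolding canonical_model_structure_def hom_def by blast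
  then show ?thesis using assms unfolding DK_equivalence_def VCat_hom by blast
qed

lemma Weq_isomorphic_hom:
  assumes "F \<in> hom (VCat V) A B" "F \<in> Weq K" "a \<in> vobj A" "b \<in> vobj A"
  shows "isomorphic (Ho V M) (vhom A a b) (vhom B (vfo F a) (vfo F b))"
  using assms(1) Weq_isomorphic[OF _ Weq_hom[OF assms]] is_vfunD(4)[of V F A B, OF _ _ _ assms(3,4)]
  unfolding VCat_hom by blast

text \<open>Let \<open>j : A \<rightarrow> R\<close> be a fibrant replacement and \<open>R'\<close> the full subcategory of \<open>R\<close> on the
  image of \<open>j\<close>; it is fibrant, since fibrancy only depends on the hom-objects.  Factor \<open>f = q i\<close> with \<open>i\<close>
  a trivial cofibration and \<open>q\<close> a trivial fibration.  Then \<open>A \<rightarrow> R'\<close> extends along \<open>i\<close> to some \<open>r\<close>, whose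
  composite with the inclusion into \<open>R\<close> is a weak equivalence.  So \<open>g b\<close> is found by lifting \<open>b\<close> along
  \<open>q\<close>, applying \<open>r\<close>, and choosing a preimage under \<open>j\<close>; on hom-objects \<open>q\<close>, \<open>r\<close> and \<open>j\<close> are weak
  equivalences.\<close>

theorem Weq_adjoint_on_objects:
  assumes F: "F \<in> hom (VCat V) A B" "F \<in> Weq K"
  shows "\<exists>g. \<forall>b \<in> vobj B. g b \<in> vobj A \<and> (\<forall>a \<in> vobj A.
     isomorphic (Ho V M) (vhom B b (vfo F a)) (vhom A (g b) a) \<and>
     isomorphic (Ho V M) (vhom B (vfo F a) b) (vhom A a (g b)))"
proof -
  obtain t where t: "is_terminal V t" using terminal by blast
  let ?T = "terminal_vcat V t :: ('u, 'o, 'm) vcat" and ?C = "VCat V :: (('u, 'o, 'm) vcat, ('u, 'o, 'm) vfun) cat"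
  note T = terminal_vcat_terminal[OF t universe]
  obtain a where a: "a \<in> hom ?C A ?T" using K.terminal_ex[OF T K.hom_Obj(1)[OF F(1)]] .
  obtain R j p where j: "j \<in> hom ?C A R" "j \<in> Cof K" "j \<in> Weq K" and p: "p \<in> hom ?C R ?T" "p \<in> Fib K"
    using K.factor_tcof_fib[OF a] by metis
  have R: "R \<in> Obj ?C" using K.hom_Obj(2)[OF j(1)] .
  have "fibrant ?C K R" unfolding fibrant_def using T p by blast
  then have Rfib: "fibrant V M (vhom R x y)" if "x \<in> vobj R" "y \<in> vobj R" for x y
    using fibrant_vcat_iff[OF R] that by blast
  define S where "S = vfo j ` vobj A"
  let ?R' = "full_subcat R S" and ?u = "inclusion V R S" and ?j' = "j\<lparr>vtgt := full_subcat R S\<rparr>"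
  have jv: "is_vfun V j" "vsrc j = A" "vtgt j = R" using j(1) by (simp_all add: VCat_hom)
  note jd = is_vfunD[OF jv]
  have S: "S \<subseteq> vobj R" unfolding S_def using jd(3) by blast
  have R': "is_vcat V R" "small (vobj R)" using R by (simp_all add: VCat_Obj)
  have sS: "small S" using small_subset[OF S R'(2)] .
  have u: "?u \<in> hom ?C ?R' R"
    using inclusion_vfun[OF R'(1) S] sS R' by (simp add: VCat_hom inclusion_def full_subcat_def)
  have SA: "vfo j ` vobj (vsrc j) \<subseteq> S" using jv by (simp add: S_def)
  have j': "?j' \<in> hom ?C A ?R'"
    using corestrict_vfun[OF jv(1) SA] S jv j(1) sS by (simp add: VCat_hom full_subcat_def)
  have uj: "?u \<cdot>\<^bsub>?C\<^esub> ?j' = j" using inclusion_corestrict[OF jv(1) SA] jv by simp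
  have "fibrant V M (vhom ?R' x y)" if "x \<in> vobj ?R'" "y \<in> vobj ?R'" for x y
    using that Rfib S by (auto simp: full_subcat_def)
  then have "fibrant ?C K ?R'" using fibrant_vcat_iff[OF K.hom_Obj(2)[OF j']] by blast
  then obtain t' \<phi> where t': "is_terminal ?C t'" and \<phi>: "\<phi> \<in> hom ?C ?R' t'" "\<phi> \<in> Fib K"
    unfolding fibrant_def by blast
  obtain D i q where i: "i \<in> hom ?C A D" "i \<in> Cof K" "i \<in> Weq K" and q: "q \<in> hom ?C D B" "q \<in> Fib K"
    and qi: "q \<cdot>\<^bsub>?C\<^esub> i = F"
    using K.factor_tcof_fib[OF F(1)] .
  have qw: "q \<in> Weq K" using K.Weq_cancel_right[OF i(1) q(1) i(3)] F qi by simp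
  obtain \<psi> where \<psi>: "\<psi> \<in> hom ?C D t'" using K.terminal_ex[OF t' K.hom_Obj(2)[OF i(1)]] .
  obtain r where r: "r \<in> hom ?C D ?R'" "r \<cdot>\<^bsub>?C\<^esub> i = ?j'"
    using K.lift_tcofE[OF i \<phi> j' \<psi> K.terminal_eq[OF t' K.Cmp_in[OF j' \<phi>(1)] K.Cmp_in[OF i(1) \<psi>]]] .
  note ur = K.Cmp_in[OF r(1) u]
  have "(?u \<cdot>\<^bsub>?C\<^esub> r) \<cdot>\<^bsub>?C\<^esub> i = j" using K.Cmp_assoc[OF i(1) r(1) u] r(2) uj by simp
  then have urw: "?u \<cdot>\<^bsub>?C\<^esub> r \<in> Weq K" using K.Weq_cancel_right[OF i(1) ur i(3)] j by simp
  have iv: "is_vfun V i" "vsrc i = A" "vtgt i = D" and qv: "is_vfun V q" "vsrc q = D" "vtgt q = B"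
    and rv: "is_vfun V r" "vsrc r = D" "vtgt r = ?R'"
    using i(1) q(1) r(1) by (simp_all add: VCat_hom)
  note id = is_vfunD[OF iv] and rd = is_vfunD[OF rv]
  have rS: "vfo r c \<in> S" if "c \<in> vobj D" for c using rd(3)[OF that] by (simp add: full_subcat_def)
  have urc: "vfo (?u \<cdot>\<^bsub>?C\<^esub> r) c = vfo r c" if "c \<in> vobj D" for c
    using VCat_Cmp(1)[where F = r and G = "?u" and V = V, of c] rv that rS[OF that] by (simp add: inclusion_def)
  have ri: "vfo (?u \<cdot>\<^bsub>?C\<^esub> r) (vfo i x) = vfo j x" if "x \<in> vobj A" for x
    using VCat_Cmp(1)[where F = i and G = r and V = V, of x] r(2) iv that urc[OF id(3)[OF that]] by simp
  have qix: "vfo q (vfo i x) = vfo F x" if "x \<in> vobj A" for x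
    using VCat_Cmp(1)[where F = i and G = q and V = V, of x] qi iv that by simp
  have "vfo q ` vobj (vsrc q) = vobj (vtgt q)"
    using canonical q qw unfolding canonical_model_structure_def hom_def by blast
  then have qs: "vobj B = vfo q ` vobj D" using qv by simp
  have "\<exists>c. c \<in> vobj D \<and> vfo q c = b" if "b \<in> vobj B" for b
    using that unfolding qs by (elim imageE) blast
  then obtain l where l: "\<And>b. b \<in> vobj B \<Longrightarrow> l b \<in> vobj D \<and> vfo q (l b) = b"
    by metis
  have "\<exists>x. x \<in> vobj A \<and> vfo j x = vfo r c" if "c \<in> vobj D" for c
    using rS[OF that] unfolding S_def by (elim imageE) metis
  then obtain m where m: "\<And>c. c \<in> vobj D \<Longrightarrow> m c \<in> vobj A \<and> vfo j (m c) = vfo r c"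
    by metis
  show ?thesis
  proof (rule exI[of _ "\<lambda>b. m (l b)"], intro ballI conjI)
    fix b assume b: "b \<in> vobj B"
    let ?c = "l b"
    have c: "?c \<in> vobj D" "vfo q ?c = b" using l[OF b] by blast+
    show g: "m ?c \<in> vobj A" using m[OF c(1)] by blast
    have mc: "vfo (?u \<cdot>\<^bsub>?C\<^esub> r) ?c = vfo j (m ?c)" using urc[OF c(1)] m[OF c(1)] by simp
    fix x assume x: "x \<in> vobj A"
    note ix = id(3)[OF x]
    note e = Weq_isomorphic_hom[OF q(1) qw] Weq_isomorphic_hom[OF ur urw] Weq_isomorphic_hom[OF j(1,3)]
    note chain = HoC.isomorphic_trans[OF HoC.isomorphic_sym HoC.isomorphic_trans[OF _ HoC.isomorphic_sym]]
    show "isomorphic (Ho V M) (vhom B b (vfo F x)) (vhom A (m ?c) x)"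
      using chain[OF e(1)[OF c(1) ix] e(2)[OF c(1) ix], of "vhom A (m ?c) x"] e(3)[OF g x]
      by (simp add: c(2) mc ri[OF x] qix[OF x])
    show "isomorphic (Ho V M) (vhom B (vfo F x) b) (vhom A x (m ?c))"
      using chain[OF e(1)[OF ix c(1)] e(2)[OF ix c(1)], of "vhom A x (m ?c)"] e(3)[OF x g]
      by (simp add: c(2) mc ri[OF x] qix[OF x])
  qed
qed

end

section \<open>Euler characteristic under weak equivalences\<close>

text \<open>The row of \<open>b\<close> restricted along \<open>f\<close> is the row of \<open>g b\<close>; so summing \<open>w\<close> over the preimages under \<open>f\<close>
  gives a weighting.\<close>

lemma weighting_push:
  assumes fin: "finite (vobj A)" "finite (vobj B)"
    and f: "\<And>a. a \<in> vobj A \<Longrightarrow> f a \<in> vobj B" and g: "\<And>b. b \<in> vobj B \<Longrightarrow> g b \<in> vobj A"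
    and adj: "\<And>a b. a \<in> vobj A \<Longrightarrow> b \<in> vobj B \<Longrightarrow> mu (vhom B b (f a)) = mu (vhom A (g b) a)"
    and w: "is_weighting mu A w"
  shows "is_weighting mu B (\<lambda>b. \<Sum>a | a \<in> vobj A \<and> f a = b. w a)"
    "(\<Sum>b\<in>vobj B. \<Sum>a | a \<in> vobj A \<and> f a = b. w a) = (\<Sum>a\<in>vobj A. w a)"
proof -
  have group: "(\<Sum>b\<in>vobj B. \<Sum>a | a \<in> vobj A \<and> f a = b. h a) = (\<Sum>a\<in>vobj A. h a)"
    for h :: "_ \<Rightarrow> 'k::{ring, monoid_mult}"
    using sum.group[OF fin, of f h] f by blast
  show "(\<Sum>b\<in>vobj B. \<Sum>a | a \<in> vobj A \<and> f a = b. w a) = (\<Sum>a\<in>vobj A. w a)" by (rule group)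
  show "is_weighting mu B (\<lambda>b. \<Sum>a | a \<in> vobj A \<and> f a = b. w a)"
    unfolding is_weighting_def
  proof
    fix b assume b: "b \<in> vobj B"
    have "(\<Sum>b'\<in>vobj B. mu (vhom B b b') * (\<Sum>a | a \<in> vobj A \<and> f a = b'. w a)) =
        (\<Sum>b'\<in>vobj B. \<Sum>a | a \<in> vobj A \<and> f a = b'. mu (vhom B b (f a)) * w a)"
      by (simp add: sum_distrib_left)
    also have "\<dots> = (\<Sum>a\<in>vobj A. mu (vhom B b (f a)) * w a)" by (rule group)
    also have "\<dots> = (\<Sum>a\<in>vobj A. mu (vhom A (g b) a) * w a)" using adj b by simp
    also have "\<dots> = 1" using w g[OF b] unfolding is_weighting_def by blast
    finally show "(\<Sum>b'\<in>vobj B. mu (vhom B b b') * (\<Sum>a | a \<in> vobj A \<and> f a = b'. w a)) = 1" .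
  qed
qed

lemma coweighting_push:
  assumes fin: "finite (vobj A)" "finite (vobj B)"
    and f: "\<And>a. a \<in> vobj A \<Longrightarrow> f a \<in> vobj B" and g: "\<And>b. b \<in> vobj B \<Longrightarrow> g b \<in> vobj A"
    and adj: "\<And>a b. a \<in> vobj A \<Longrightarrow> b \<in> vobj B \<Longrightarrow> mu (vhom B (f a) b) = mu (vhom A a (g b))"
    and v: "is_coweighting mu A v"
  shows "is_coweighting mu B (\<lambda>b. \<Sum>a | a \<in> vobj A \<and> f a = b. v a)"
  unfolding is_coweighting_def
proof
  have group: "(\<Sum>b\<in>vobj B. \<Sum>a | a \<in> vobj A \<and> f a = b. h a) = (\<Sum>a\<in>vobj A. h a)"
    for h :: "_ \<Rightarrow> 'k::{ring, monoid_mult}"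
    using sum.group[OF fin, of f h] f by blast
  fix b assume b: "b \<in> vobj B"
  have "(\<Sum>b'\<in>vobj B. (\<Sum>a | a \<in> vobj A \<and> f a = b'. v a) * mu (vhom B b' b)) =
      (\<Sum>b'\<in>vobj B. \<Sum>a | a \<in> vobj A \<and> f a = b'. v a * mu (vhom B (f a) b))"
    by (simp add: sum_distrib_right)
  also have "\<dots> = (\<Sum>a\<in>vobj A. v a * mu (vhom B (f a) b))" by (rule group)
  also have "\<dots> = (\<Sum>a\<in>vobj A. v a * mu (vhom A a (g b)))" using adj b by simp
  also have "\<dots> = 1" using v g[OF b] unfolding is_coweighting_def by blast
  finally show "(\<Sum>b'\<in>vobj B. (\<Sum>a | a \<in> vobj A \<and> f a = b'. v a) * mu (vhom B b' b)) = 1" .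
qed

lemma euler_char_push:
  assumes A: "admits_euler_char W mu A" and B: "finite (vobj B)" "measurable_vcat W B"
    and f: "\<And>a. a \<in> vobj A \<Longrightarrow> f a \<in> vobj B" and g: "\<And>b. b \<in> vobj B \<Longrightarrow> g b \<in> vobj A"
    and "\<And>a b. a \<in> vobj A \<Longrightarrow> b \<in> vobj B \<Longrightarrow> mu (vhom B b (f a)) = mu (vhom A (g b) a)"
    and "\<And>a b. a \<in> vobj A \<Longrightarrow> b \<in> vobj B \<Longrightarrow> mu (vhom B (f a) b) = mu (vhom A a (g b))"
  shows "admits_euler_char W mu B" "euler_char mu B = euler_char mu A"
proof -
  obtain w v where fin: "finite (vobj A)" and w: "is_weighting mu A w" and v: "is_coweighting mu A v"
    using A unfolding admits_euler_char_def by blast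
  note pw = weighting_push[OF fin B(1) f g assms(6) w] and pv = coweighting_push[OF fin B(1) f g assms(7) v]
  show ad: "admits_euler_char W mu B" unfolding admits_euler_char_def using B pw(1) pv by blast
  show "euler_char mu B = euler_char mu A"
    using euler_char_eq(1)[OF ad pw(1)] euler_char_eq(1)[OF A w] pw(2) by simp
qed

context canonical_vcat
begin

theorem euler_char_Weq:
  assumes meas: "monoidal_measure V M W mu" and F: "F \<in> hom (VCat V) A B" "F \<in> Weq K"
    and A: "finite (vobj A)" "measurable_vcat W A" and B: "finite (vobj B)" "measurable_vcat W B"
    and ad: "admits_euler_char W mu A \<or> admits_euler_char W mu B"
  shows "admits_euler_char W mu A \<and> admits_euler_char W mu B \<and> euler_char mu A = euler_char mu B"
proof -
  have iso: "mu X = mu Y" if "isomorphic (Ho V M) X Y" "X \<in> W" "Y \<in> W" for X Y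
    using meas that unfolding monoidal_measure_def by blast
  have f: "vfo F a \<in> vobj B" if "a \<in> vobj A" for a
    using F(1) is_vfunD(3)[of V F A B, OF _ _ _ that] by (simp add: VCat_hom)
  obtain g where g: "b \<in> vobj B \<Longrightarrow> g b \<in> vobj A"
    and 1: "b \<in> vobj B \<Longrightarrow> a \<in> vobj A \<Longrightarrow> isomorphic (Ho V M) (vhom B b (vfo F a)) (vhom A (g b) a)"
    and 2: "b \<in> vobj B \<Longrightarrow> a \<in> vobj A \<Longrightarrow> isomorphic (Ho V M) (vhom B (vfo F a) b) (vhom A a (g b))" for a b
    using Weq_adjoint_on_objects[OF F] by metis
  have adj: "mu (vhom B b (vfo F a)) = mu (vhom A (g b) a)" "mu (vhom B (vfo F a) b) = mu (vhom A a (g b))"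
    if "a \<in> vobj A" "b \<in> vobj B" for a b
    using iso[OF 1[OF that(2,1)]] iso[OF 2[OF that(2,1)]] A(2) B(2) f[OF that(1)] g[OF that(2)] that
    unfolding measurable_vcat_def by blast+
  show ?thesis
  proof (cases "admits_euler_char W mu A")
    case True
    then show ?thesis using euler_char_push[OF True B f g adj] by simp
  next
    case False
    then have ad: "admits_euler_char W mu B" using ad by blast
    show ?thesis using euler_char_push[OF ad A g f adj(2)[symmetric] adj(1)[symmetric]] ad by simp
  qed
qed

end

section \<open>Fibers of enriched functors\<close>

context vcat_on
begin

lemma LUnit_inverse:
  assumes "X \<in> Obj V"
  obtains l where "l \<in> hom V X (\<one> \<otimes> X)" "l \<cdot> LUnit V X = Ide V (\<one> \<otimes> X)"
    "\<And>w. w \<in> hom V \<one> X \<Longrightarrow> l \<cdot> w = (Ide V \<one> \<odot> w) \<cdot> RUnit_inv \<one>"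
proof -
  note L = LUnit_in[OF assms]
  obtain l where l: "l \<in> hom V X (\<one> \<otimes> X)" "l \<cdot> LUnit V X = Ide V (\<one> \<otimes> X)"
    using iso_arrE[OF L[THEN conjunct2] L[THEN conjunct1]] .
  have "l \<cdot> w = (Ide V \<one> \<odot> w) \<cdot> RUnit_inv \<one>" if w: "w \<in> hom V \<one> X" for w
  proof -
    note r = RUnit_inv[OF Unit_in] and L1 = LUnit_in[OF Unit_in, THEN conjunct1]
    note iw = TenA_in[OF Ide_in[OF Unit_in] w]
    note c = Cmp_in[OF r(1) iw]
    have "LUnit V X \<cdot> ((Ide V \<one> \<odot> w) \<cdot> RUnit_inv \<one>) = w \<cdot> (LUnit V \<one> \<cdot> RUnit_inv \<one>)"
      using Cmp_assoc[OF r(1) iw L[THEN conjunct1]] LUnit_nat[OF w] Cmp_assoc[OF r(1) L1 w] by simp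
    also have "\<dots> = w" using r(3) RUnit_Unit Cmp_Ide[OF w] by simp
    finally have "l \<cdot> w = l \<cdot> (LUnit V X \<cdot> ((Ide V \<one> \<odot> w) \<cdot> RUnit_inv \<one>))" by simp
    also have "\<dots> = (Ide V \<one> \<odot> w) \<cdot> RUnit_inv \<one>"
      using Cmp_assoc[OF c L[THEN conjunct1] l(1)] l(2) Ide_Cmp[OF c] by simp
    finally show ?thesis .
  qed
  then show thesis using that l by blast
qed

lemma act_vid_left:
  assumes a: "a \<in> vobj A" and b: "b \<in> vobj A" and u: "u \<in> hom V \<one> (vhom A a b)"
  shows "act A a b b (vid A b) u = u"
proof -
  note i = vcatD(3)[OF b] and one = Ide_in[OF Unit_in] and X = hom_Obj(2)[OF u]
  note oneX = Ide_in[OF X] and r = RUnit_inv[OF Unit_in] and m = vcatD(2)[OF a b b]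
  note L = LUnit_in[OF X, THEN conjunct1] and L1 = LUnit_in[OF Unit_in, THEN conjunct1]
  note iX = TenA_in[OF i oneX] and ou = TenA_in[OF one u]
  have "vid A b \<odot> u = (vid A b \<odot> Ide V (vhom A a b)) \<cdot> (Ide V \<one> \<odot> u)"
    using TenA_Cmp[OF one i u oneX] Cmp_Ide[OF i] Ide_Cmp[OF u] by simp
  then have "act A a b b (vid A b) u = LUnit V (vhom A a b) \<cdot> ((Ide V \<one> \<odot> u) \<cdot> RUnit_inv \<one>)"
    unfolding act_eq[OF i]
    using Cmp_assoc[OF r(1) ou iX] Cmp_assoc[OF Cmp_in[OF r(1) ou] iX m] vcatD(5)[OF a b] by simp
  also have "\<dots> = u \<cdot> (LUnit V \<one> \<cdot> RUnit_inv \<one>)"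
    using Cmp_assoc[OF r(1) ou L] LUnit_nat[OF u] Cmp_assoc[OF r(1) L1 u] by simp
  also have "\<dots> = u" using r(3) RUnit_Unit Cmp_Ide[OF u] by simp
  finally show ?thesis .
qed

end

locale local_fibration = cartesian_model_category V M
  for V :: "('o, 'm) moncat" (structure) and M :: "'m model" +
  fixes F :: "('u, 'o, 'm) vfun" and E B :: "('u, 'o, 'm) vcat"
  assumes F: "is_vfun V F" "vsrc F = E" "vtgt F = B"
    and F_Fib: "x \<in> vobj E \<Longrightarrow> y \<in> vobj E \<Longrightarrow> vfh F x y \<in> Fib M"
    and E_fibrant: "x \<in> vobj E \<Longrightarrow> y \<in> vobj E \<Longrightarrow> fibrant V M (vhom E x y)"
begin

lemmas FD = is_vfunD[OF F]

sublocale E: vcat_on V M E by unfold_locales (rule FD)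
sublocale B: vcat_on V M B by unfold_locales (rule FD)

lemma vfun_act:
  assumes "a \<in> vobj E" "b \<in> vobj E" "c \<in> vobj E"
    and h: "h \<in> hom V S (vhom E b c)" and u: "u \<in> hom V \<one> (vhom E a b)"
  shows "vfh F a c \<cdot> act E a b c h u =
    act B (vfo F a) (vfo F b) (vfo F c) (vfh F b c \<cdot> h) (vfh F a b \<cdot> u)"
proof -
  note f = FD(4)[OF assms(1,3)] and g = FD(4)[OF assms(2,3)] and k = FD(4)[OF assms(1,2)]
  note r = RUnit_inv(1)[OF hom_Obj(1)[OF h]] and hu = TenA_in[OF h u] and gk = TenA_in[OF g k]
  note m = E.vcatD(2)[OF assms(1-3)]
    and m' = B.vcatD(2)[OF FD(3)[OF assms(1)] FD(3)[OF assms(2)] FD(3)[OF assms(3)]]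
  note c = Cmp_in[OF r hu]
  have "vfh F a c \<cdot> act E a b c h u = (vfh F a c \<cdot> vcomp E a b c) \<cdot> ((h \<odot> u) \<cdot> RUnit_inv S)"
    unfolding E.act_eq[OF h] using Cmp_assoc[OF c m f] .
  also have "\<dots> = vcomp B (vfo F a) (vfo F b) (vfo F c) \<cdot>
      (((vfh F b c \<odot> vfh F a b) \<cdot> (h \<odot> u)) \<cdot> RUnit_inv S)"
    using FD(5)[OF assms(1-3)] Cmp_assoc[OF c gk m'] Cmp_assoc[OF r hu gk] by simp
  also have "(vfh F b c \<odot> vfh F a b) \<cdot> (h \<odot> u) = (vfh F b c \<cdot> h) \<odot> (vfh F a b \<cdot> u)"
    using TenA_Cmp[OF h g u k] by simp
  finally show ?thesis unfolding B.act_eq[OF Cmp_in[OF h g]] .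
qed

text \<open>For a loop \<open>v\<close> in the component of the identity, all points \<open>w\<close> of \<open>E(z, z)\<close> are treated at once:
  precomposition with \<open>w\<close> is the map of fibers over \<open>w\<close> of a map from \<open>G \<times> E(z, z)\<close>, fibered over
  \<open>E(z, z)\<close>, to \<open>E(z, y)\<close>, and it is the identity at \<open>w = 1\<^sub>z\<close>.\<close>

lemma fiber_loop_iso:
  assumes z: "z \<in> vobj E" and y: "y \<in> vobj E"
    and v: "v \<in> hom V \<one> (vhom E z z)" and vid: "ho v = ho (vid E z)"
    and h: "h \<in> hom V \<one> (vhom B (vfo F z) (vfo F y))"
    and G: "is_pullback V (vfh F z y) h G i t"
    and G': "is_pullback V (vfh F z y) (act B (vfo F z) (vfo F z) (vfo F y) h (vfh F z z \<cdot> v)) G' i' t'"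
    and s: "s \<in> hom V G G'" "i' \<cdot> s = act E z z y i v"
  shows "iso_arr (Ho V M) (ho s)"
proof -
  let ?X = "vhom E z z" and ?p = "vfh F z y" and ?pz = "vfh F z z" and ?c = "vfo F z" and ?d = "vfo F y"
  note c = FD(3)[OF z] and d = FD(3)[OF y]
  note p = FD(4)[OF z y] and pz = FD(4)[OF z z]
  note X = E.vcatD(1)[OF z z] and e = E.vcatD(3)[OF z]
  note G1 = fiberD[OF G p h]
  note GO = hom_Obj(1)[OF G1(1)]
  note oneX = Ide_in[OF X] and oneG = Ide_in[OF GO] and one = Ide_in[OF Unit_in]
  note m = E.vcatD(2)[OF z z y] and mB = B.vcatD(2)[OF c c d]
  obtain l where l: "l \<in> hom V ?X (\<one> \<otimes> ?X)" "l \<cdot> LUnit V ?X = Ide V (\<one> \<otimes> ?X)"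
    and lw: "\<And>w. w \<in> hom V \<one> ?X \<Longrightarrow> l \<cdot> w = (Ide V \<one> \<odot> w) \<cdot> RUnit_inv \<one>"
    by (rule E.LUnit_inverse[OF X], blast)
  have tG: "bang G = t" using bang_eq[OF bang_in[OF GO] G1(2)] .
  have "t \<in> Fib M" using pullback_Fib[OF G F_Fib[OF z y]] .
  then have bG: "bang G \<in> Fib M" using tG by simp
  note pr = proj_in[OF GO X] and bGi = bang_in[OF GO] and bXi = bang_in[OF X]
  \<comment> \<open>The projection of \<open>G \<times> E(z, z)\<close> to \<open>E(z, z)\<close> is a pullback of \<open>G \<rightarrow> 1\<close>, hence a fibration.\<close>
  have "is_pullback V (bang G) (bang ?X) (G \<otimes> ?X) (proj1 G ?X) (proj2 G ?X)"
  proof (rule pullbackI[OF bGi bXi pr])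
    show "bang G \<cdot> proj1 G ?X = bang ?X \<cdot> proj2 G ?X"
      using bang_eq[OF Cmp_in[OF pr(1) bGi] Cmp_in[OF pr(2) bXi]] .
    show "\<exists>u\<in>hom V Z (G \<otimes> ?X). proj1 G ?X \<cdot> u = s \<and> proj2 G ?X \<cdot> u = t"
      if "s \<in> hom V Z G" "t \<in> hom V Z ?X" for Z s t
      using pair_ex[OF that] by metis
    show "u = w" if "u \<in> hom V Z (G \<otimes> ?X)" "w \<in> hom V Z (G \<otimes> ?X)" "proj1 G ?X \<cdot> u = proj1 G ?X \<cdot> w"
      "proj2 G ?X \<cdot> u = proj2 G ?X \<cdot> w" for Z u w
      using pair_eq[OF that(1,2) GO X that(3,4)] .
  qed
  then have qf: "proj2 G ?X \<in> Fib M" using pullback_Fib bG by blast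
  define \<alpha> where "\<alpha> = vcomp B ?c ?c ?d \<cdot> ((h \<odot> ?pz) \<cdot> l)"
  define \<sigma> where "\<sigma> = vcomp E z z y \<cdot> (i \<odot> Ide V ?X)"
  note hp = TenA_in[OF h pz] and iX = TenA_in[OF G1(1) oneX]
  have \<alpha>: "\<alpha> \<in> hom V ?X (vhom B ?c ?d)" unfolding \<alpha>_def using Cmp_in[OF Cmp_in[OF l(1) hp] mB] .
  have \<sigma>: "\<sigma> \<in> hom V (G \<otimes> ?X) (vhom E z y)" unfolding \<sigma>_def using Cmp_in[OF iX m] .
  have \<alpha>w: "\<alpha> \<cdot> w = act B ?c ?c ?d h (?pz \<cdot> w)" if w: "w \<in> hom V \<one> ?X" for w
  proof -
    note ow = TenA_in[OF one w] and r = RUnit_inv(1)[OF Unit_in]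
    have "\<alpha> \<cdot> w = vcomp B ?c ?c ?d \<cdot> ((h \<odot> ?pz) \<cdot> (l \<cdot> w))"
      unfolding \<alpha>_def using Cmp_assoc[OF w Cmp_in[OF l(1) hp] mB] Cmp_assoc[OF w l(1) hp] by simp
    also have "(h \<odot> ?pz) \<cdot> (l \<cdot> w) = ((h \<odot> ?pz) \<cdot> (Ide V \<one> \<odot> w)) \<cdot> RUnit_inv \<one>"
      unfolding lw[OF w] using Cmp_assoc[OF r ow hp] .
    also have "(h \<odot> ?pz) \<cdot> (Ide V \<one> \<odot> w) = h \<odot> (?pz \<cdot> w)"
      using TenA_Cmp[OF one h w pz] Cmp_Ide[OF h] by simp
    finally show ?thesis unfolding B.act_eq[OF h] .
  qed
  have square: "?p \<cdot> \<sigma> = \<alpha> \<cdot> proj2 G ?X"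
  proof -
    note pp = TenA_in[OF p pz] and bX = TenA_in[OF bGi oneX] and L = LUnit_in[OF X, THEN conjunct1]
    have "?p \<cdot> \<sigma> = (?p \<cdot> vcomp E z z y) \<cdot> (i \<odot> Ide V ?X)"
      unfolding \<sigma>_def using Cmp_assoc[OF iX m p] .
    also have "\<dots> = vcomp B ?c ?c ?d \<cdot> ((?p \<odot> ?pz) \<cdot> (i \<odot> Ide V ?X))"
      using FD(5)[OF z z y] Cmp_assoc[OF iX pp mB] by simp
    also have "(?p \<odot> ?pz) \<cdot> (i \<odot> Ide V ?X) = (h \<cdot> bang G) \<odot> ?pz"
      using TenA_Cmp[OF G1(1) p oneX pz] G1(3) tG Cmp_Ide[OF pz] by simp
    also have "\<dots> = (h \<odot> ?pz) \<cdot> (bang G \<odot> Ide V ?X)"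
      using TenA_Cmp[OF bGi h oneX pz] Cmp_Ide[OF pz] by simp
    also have "\<dots> = ((h \<odot> ?pz) \<cdot> l) \<cdot> proj2 G ?X"
    proof -
      have "l \<cdot> proj2 G ?X = bang G \<odot> Ide V ?X"
        unfolding proj2_def using Cmp_assoc[OF bX L l(1)] l(2) Ide_Cmp[OF bX] by simp
      then show ?thesis using Cmp_assoc[OF pr(2) l(1) hp] by simp
    qed
    also have "vcomp B ?c ?c ?d \<cdot> \<dots> = \<alpha> \<cdot> proj2 G ?X"
      unfolding \<alpha>_def using Cmp_assoc[OF pr(2) Cmp_in[OF l(1) hp] mB] by simp
    finally show ?thesis .
  qed
  let ?r = "RUnit_inv G"
  note r = RUnit_inv[OF GO]
  have fib: "is_pullback V (proj2 G ?X) w G ((Ide V G \<odot> w) \<cdot> ?r) t" if w: "w \<in> hom V \<one> ?X" for w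
  proof -
    let ?k = "(Ide V G \<odot> w) \<cdot> ?r"
    note gw = TenA_in[OF oneG w] and pu = proj_in[OF GO Unit_in]
    note k = Cmp_in[OF r(1) gw]
    have "proj2 G ?X \<cdot> ?k = w \<cdot> (proj2 G \<one> \<cdot> ?r)"
      using Cmp_assoc[OF r(1) gw pr(2)] proj2_nat[OF oneG w] Cmp_assoc[OF r(1) pu(2) w] by simp
    then have k2: "proj2 G ?X \<cdot> ?k = w \<cdot> t" using bang_eq[OF Cmp_in[OF r(1) pu(2)] G1(2)] by simp
    have "proj1 G \<one> = RUnit V G"
      unfolding proj1_def
      using bang_eq[OF bang_in[OF Unit_in] one] TenA_Ide[OF GO Unit_in]
        Cmp_Ide[OF RUnit_in[OF GO, THEN conjunct1]] by simp
    then have k1: "proj1 G ?X \<cdot> ?k = Ide V G"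
      using Cmp_assoc[OF r(1) gw pr(1)] proj1_nat[OF oneG w] Cmp_assoc[OF r(1) pu(1) oneG] r(3)
        Ide_Cmp[OF oneG] by simp
    show ?thesis
    proof (rule pullbackI[OF pr(2) w k G1(2) k2])
      fix Z x x' assume x: "x \<in> hom V Z (G \<otimes> ?X)" and x': "x' \<in> hom V Z \<one>" and xx: "proj2 G ?X \<cdot> x = w \<cdot> x'"
      let ?u = "proj1 G ?X \<cdot> x"
      note u = Cmp_in[OF x pr(1)]
      have tu: "t \<cdot> ?u = x'" using bang_eq[OF Cmp_in[OF u G1(2)] x'] .
      have "?k \<cdot> ?u = x"
      proof (rule pair_eq[OF Cmp_in[OF u k] x GO X])
        show "proj1 G ?X \<cdot> (?k \<cdot> ?u) = proj1 G ?X \<cdot> x"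
          using Cmp_assoc[OF u k pr(1)] k1 Ide_Cmp[OF u] by simp
        show "proj2 G ?X \<cdot> (?k \<cdot> ?u) = proj2 G ?X \<cdot> x"
          using Cmp_assoc[OF u k pr(2)] k2 Cmp_assoc[OF u G1(2) w] tu xx by simp
      qed
      then show "\<exists>u\<in>hom V Z G. ?k \<cdot> u = x \<and> t \<cdot> u = x'" using u tu by blast
    next
      fix Z u u' assume uu: "u \<in> hom V Z G" "u' \<in> hom V Z G" "?k \<cdot> u = ?k \<cdot> u'"
      have "u = proj1 G ?X \<cdot> (?k \<cdot> u)" using Cmp_assoc[OF uu(1) k pr(1)] Ide_Cmp[OF uu(1)] by (simp only: k1)
      also have "\<dots> = proj1 G ?X \<cdot> (?k \<cdot> u')" by (simp only: uu(3))
      also have "\<dots> = u'" using Cmp_assoc[OF uu(2) k pr(1)] Ide_Cmp[OF uu(2)] by (simp only: k1)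
      finally show "u = u'" .
    qed
  qed
  have \<sigma>w: "\<sigma> \<cdot> ((Ide V G \<odot> w) \<cdot> ?r) = act E z z y i w" if w: "w \<in> hom V \<one> ?X" for w
  proof -
    note gw = TenA_in[OF oneG w]
    have "\<sigma> \<cdot> ((Ide V G \<odot> w) \<cdot> ?r) = vcomp E z z y \<cdot> (((i \<odot> Ide V ?X) \<cdot> (Ide V G \<odot> w)) \<cdot> ?r)"
      unfolding \<sigma>_def using Cmp_assoc[OF Cmp_in[OF r(1) gw] iX m] Cmp_assoc[OF r(1) gw iX] by simp
    also have "(i \<odot> Ide V ?X) \<cdot> (Ide V G \<odot> w) = i \<odot> w"
      using TenA_Cmp[OF oneG G1(1) w oneX] Cmp_Ide[OF G1(1)] Ide_Cmp[OF w] by simp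
    finally show ?thesis unfolding E.act_eq[OF G1(1)] .
  qed
  have "fiber_iso_at (proj2 G ?X) ?p \<alpha> \<sigma> (vid E z)"
    unfolding fiber_iso_at_def
  proof (intro allI impI; elim conjE)
    fix H j t1 H' j' t2 r'
    assume H: "is_pullback V (proj2 G ?X) (vid E z) H j t1"
      and H': "is_pullback V ?p (\<alpha> \<cdot> vid E z) H' j' t2" and r': "r' \<in> hom V H H'" "j' \<cdot> r' = \<sigma> \<cdot> j"
    have \<alpha>e: "\<alpha> \<cdot> vid E z = h"
      unfolding \<alpha>w[OF e] FD(6)[OF z] using B.act_id[OF c d h] .
    note H' = H'[unfolded \<alpha>e]
    note jj = fiberD[OF H pr(2) e] and jj' = fiberD[OF H' p h]
    note K = fib[OF e]
    note kd = fiberD[OF K pr(2) e]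
    obtain a where a: "a \<in> hom V G H" "j \<cdot> a = (Ide V G \<odot> vid E z) \<cdot> ?r" "t1 \<cdot> a = t"
      using pullback_lift[OF H, unfolded homD(2)[OF pr(2)] homD(2)[OF e], OF kd(1,2,3)] .
    have ai: "iso_arr V a" using pullback_comparison_iso[OF K H a] .
    note ra = Cmp_in[OF a(1) r'(1)]
    have "j' \<cdot> (r' \<cdot> a) = \<sigma> \<cdot> (j \<cdot> a)"
      using Cmp_assoc[OF a(1) r'(1) jj'(1)] r'(2) Cmp_assoc[OF a(1) jj(1) \<sigma>] by simp
    then have "j' \<cdot> (r' \<cdot> a) = i" unfolding a(2) \<sigma>w[OF e] using E.act_id[OF z y G1(1)] by simp
    moreover have "t2 \<cdot> (r' \<cdot> a) = t" using bang_eq[OF Cmp_in[OF ra jj'(2)] G1(2)] .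
    ultimately have "iso_arr V (r' \<cdot> a)" using pullback_comparison_iso[OF G H' ra] by blast
    then have "iso_arr V r'" using iso_cancel_right[OF a(1) r'(1) ai] by blast
    then show "iso_arr (Ho V M) (ho r')" using ho_iso[OF r'(1)] by blast
  qed
  then have "fiber_iso_at (proj2 G ?X) ?p \<alpha> \<sigma> v"
    using fiber_iso_at_homotopic_points[OF E_fibrant[OF z z] e v vid[symmetric] pr(2) qf p F_Fib[OF z y] \<alpha> \<sigma> square]
    by blast
  then show ?thesis
    unfolding fiber_iso_at_def \<alpha>w[OF v]
    using fib[OF v] G' s(1) s(2)[folded \<sigma>w[OF v]] by blast
qed

text \<open>Precomposition with \<open>u\<close>, with \<open>u'\<close> and with \<open>u\<close> again gives three maps of fibers such that both
  composites of consecutive ones are isomorphisms in the homotopy category; the two-out-of-six property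
  applies.\<close>

theorem fibers_along_equivalence:
  assumes x: "x \<in> vobj E" and x': "x' \<in> vobj E" and y: "y \<in> vobj E"
    and u: "u \<in> hom V \<one> (vhom E x x')" and u': "u' \<in> hom V \<one> (vhom E x' x)"
    and u'u: "ho (act E x x' x u' u) = ho (vid E x)" and uu': "ho (act E x' x x' u u') = ho (vid E x')"
    and h: "h \<in> hom V \<one> (vhom B (vfo F x') (vfo F y))"
    and G0: "is_pullback V (vfh F x' y) h G0 i0 t0"
    and G1: "is_pullback V (vfh F x y) (act B (vfo F x) (vfo F x') (vfo F y) h (vfh F x x' \<cdot> u)) G1 i1 t1"
  shows "isomorphic (Ho V M) G0 G1"
proof -
  let ?a = "vfo F x" and ?a' = "vfo F x'" and ?d = "vfo F y"
  note a = FD(3)[OF x] and a' = FD(3)[OF x'] and d = FD(3)[OF y]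
  let ?g = "vfh F x x' \<cdot> u" and ?g' = "vfh F x' x \<cdot> u'"
  note p = FD(4)[OF x y] and p' = FD(4)[OF x' y]
  note g = Cmp_in[OF u FD(4)[OF x x']] and g' = Cmp_in[OF u' FD(4)[OF x' x]]
  let ?h1 = "act B ?a ?a' ?d h ?g"
  note h1 = B.act_in[OF a a' d h g]
  let ?h2 = "act B ?a' ?a ?d ?h1 ?g'"
  note h2 = B.act_in[OF a' a d h1 g']
  let ?h3 = "act B ?a ?a' ?d ?h2 ?g"
  note h3 = B.act_in[OF a a' d h2 g]
  obtain G2 i2 t2 where G2: "is_pullback V (vfh F x' y) ?h2 G2 i2 t2" using pullback_exists[OF p' h2] by blast
  obtain G3 i3 t3 where G3: "is_pullback V (vfh F x y) ?h3 G3 i3 t3" using pullback_exists[OF p h3] by blast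
  have step: "\<exists>s \<in> hom V G G'. i' \<cdot> s = act E b c y i w"
    if b: "b \<in> vobj E" and c: "c \<in> vobj E" and w: "w \<in> hom V \<one> (vhom E b c)"
      and k: "k \<in> hom V \<one> (vhom B (vfo F c) ?d)" and G: "is_pullback V (vfh F c y) k G i t"
      and G': "is_pullback V (vfh F b y) (act B (vfo F b) (vfo F c) ?d k (vfh F b c \<cdot> w)) G' i' t'"
    for b c w k G i t G' i' t'
  proof -
    note pb = FD(4)[OF b y] and pc = FD(4)[OF c y] and w' = Cmp_in[OF w FD(4)[OF b c]]
    note i = fiberD[OF G pc k] and ai = E.act_in[OF b c y fiberD(1)[OF G pc k] w]
    note b' = FD(3)[OF b] and c' = FD(3)[OF c]
    have "vfh F b y \<cdot> act E b c y i w = act B (vfo F b) (vfo F c) ?d k (vfh F b c \<cdot> w) \<cdot> t"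
      using vfun_act[OF b c y i(1) w] i(3) B.act_Cmp[OF b' c' d k w' i(2)] by simp
    then show ?thesis
      using fiber_lift[OF G' pb B.act_in[OF b' c' d k w'] ai i(2)] by metis
  qed
  obtain f where f: "f \<in> hom V G0 G1" "i1 \<cdot> f = act E x x' y i0 u" using step[OF x x' u h G0 G1] by blast
  obtain f' where f': "f' \<in> hom V G1 G2" "i2 \<cdot> f' = act E x' x y i1 u'" using step[OF x' x u' h1 G1 G2] by blast
  obtain f'' where f'': "f'' \<in> hom V G2 G3" "i3 \<cdot> f'' = act E x x' y i2 u" using step[OF x x' u h2 G2 G3] by blast
  note i0 = fiberD(1)[OF G0 p' h] and i1 = fiberD(1)[OF G1 p h1] and i2 = fiberD(1)[OF G2 p' h2]
    and i3 = fiberD(1)[OF G3 p h3]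
  have 1: "iso_arr (Ho V M) (ho (f' \<cdot> f))"
  proof (rule fiber_loop_iso[OF x' y _ uu' h G0 _ Cmp_in[OF f(1) f'(1)]])
    show "act E x' x x' u u' \<in> hom V \<one> (vhom E x' x')" using E.act_in[OF x' x x' u u'] .
    show "is_pullback V (vfh F x' y) (act B ?a' ?a' ?d h (vfh F x' x' \<cdot> act E x' x x' u u')) G2 i2 t2"
      unfolding vfun_act[OF x' x x' u u'] using G2 B.act_act[OF a' a a' d h g g'] by simp
    have "i2 \<cdot> (f' \<cdot> f) = act E x' x y (i1 \<cdot> f) u'"
      using Cmp_assoc[OF f(1) f'(1) i2] f'(2) E.act_Cmp[OF x' x y i1 u' f(1)] by simp
    then show "i2 \<cdot> (f' \<cdot> f) = act E x' x' y i0 (act E x' x x' u u')"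
      using f(2) E.act_act[OF x' x x' y i0 u u'] by simp
  qed
  have 2: "iso_arr (Ho V M) (ho (f'' \<cdot> f'))"
  proof (rule fiber_loop_iso[OF x y _ u'u h1 G1 _ Cmp_in[OF f'(1) f''(1)]])
    show "act E x x' x u' u \<in> hom V \<one> (vhom E x x)" using E.act_in[OF x x' x u' u] .
    show "is_pullback V (vfh F x y) (act B ?a ?a ?d ?h1 (vfh F x x \<cdot> act E x x' x u' u)) G3 i3 t3"
      unfolding vfun_act[OF x x' x u' u] using G3 B.act_act[OF a a' a d h1 g' g] by simp
    have "i3 \<cdot> (f'' \<cdot> f') = act E x x' y (i2 \<cdot> f') u"
      using Cmp_assoc[OF f'(1) f''(1) i3] f''(2) E.act_Cmp[OF x x' y i2 u f'(1)] by simp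
    then show "i3 \<cdot> (f'' \<cdot> f') = act E x x y i1 (act E x x' x u' u)"
      using f'(2) E.act_act[OF x x' x y i1 u' u] by simp
  qed
  have "iso_arr (Ho V M) (ho f)"
    using HoC.two_of_six(1)[OF ho_in[OF f(1)] ho_in[OF f'(1)] ho_in[OF f''(1)]] 1 2
      ho_Cmp[OF f(1) f'(1)] ho_Cmp[OF f'(1) f''(1)] by simp
  then show ?thesis using HoC.isomorphicI[OF ho_in[OF f(1)]] by blast
qed

end

section \<open>Euler characteristic of a fibration\<close>

lemma (in category) coproduct_singleton:
  assumes f: "f \<in> hom C X P" and iso: "iso_arr C f"
  shows "is_coproduct C {i} (\<lambda>_. X) P (\<lambda>_. f)"
proof -
  obtain g where g: "g \<in> hom C P X" "g \<cdot> f = Ide C X" "f \<cdot> g = Ide C P" using iso_arrE[OF iso f] .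
  have "\<exists>!u. u \<in> hom C P Y \<and> u \<cdot> f = t" if t: "t \<in> hom C X Y" for Y t
  proof (rule ex1I[of _ "t \<cdot> g"])
    show "t \<cdot> g \<in> hom C P Y \<and> (t \<cdot> g) \<cdot> f = t"
      using Cmp_in[OF g(1) t] Cmp_assoc[OF f g(1) t] g(2) Cmp_Ide[OF t] by simp
    fix u assume u: "u \<in> hom C P Y \<and> u \<cdot> f = t"
    then have "t \<cdot> g = u \<cdot> (f \<cdot> g)" using Cmp_assoc[OF g(1) f, of u Y] by simp
    then show "u = t \<cdot> g" using g(3) Cmp_Ide[of u P Y] u by simp
  qed
  then show ?thesis
    unfolding is_coproduct_def using f hom_Obj(2)[OF f] by simp
qed

lemma coproduct_reindex:
  assumes e: "bij_betw e I J" and P: "is_coproduct C J X P inc"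
  shows "is_coproduct C I (\<lambda>i. X (e i)) P (\<lambda>i. inc (e i))"
proof -
  have J: "J = e ` I" and inj: "inj_on e I" using e unfolding bij_betw_def by auto
  let ?d = "the_inv_into I e"
  have d: "?d (e i) = i" if "i \<in> I" for i using the_inv_into_f_f[OF inj that] .
  have univ: "\<forall>Y \<in> Obj C. \<forall>t. (\<forall>j \<in> J. t j \<in> hom C (X j) Y) \<longrightarrow>
        (\<exists>!u. u \<in> hom C P Y \<and> (\<forall>j \<in> J. u \<cdot>\<^bsub>C\<^esub> inc j = t j))"
    using P unfolding is_coproduct_def by (elim conjE)
  have "\<exists>!u. u \<in> hom C P Y \<and> (\<forall>i \<in> I. u \<cdot>\<^bsub>C\<^esub> inc (e i) = t i)"
    if Y: "Y \<in> Obj C" and t: "\<forall>i \<in> I. t i \<in> hom C (X (e i)) Y" for Y t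
  proof -
    have "\<forall>j \<in> J. t (?d j) \<in> hom C (X j) Y" unfolding J using t d by simp
    then have "\<exists>!u. u \<in> hom C P Y \<and> (\<forall>j \<in> J. u \<cdot>\<^bsub>C\<^esub> inc j = t (?d j))"
      using univ[rule_format, OF Y, of "\<lambda>j. t (?d j)"] by simp
    moreover have "(\<forall>j \<in> J. u \<cdot>\<^bsub>C\<^esub> inc j = t (?d j)) \<longleftrightarrow> (\<forall>i \<in> I. u \<cdot>\<^bsub>C\<^esub> inc (e i) = t i)" for u
      unfolding J using d by simp
    ultimately show ?thesis by simp
  qed
  then show ?thesis using P unfolding is_coproduct_def J by simp
qed

locale measured_category = cartesian_model_category V M
  for V :: "('o, 'm) moncat" (structure) and M :: "'m model" +
  fixes W :: "'o set" and mu :: "'o \<Rightarrow> 'k::{ring, monoid_mult}"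
  assumes meas: "monoidal_measure V M W mu"
    and pres: "preserves_fibrations V M W mu"
    and W3: "condW3 V M W"
begin

text \<open>Closure under coproducts of one-element families is closure under isomorphism.\<close>

lemma mu_iso:
  assumes X: "X \<in> W" and iso: "isomorphic (Ho V M) X Y"
  shows "Y \<in> W" "mu Y = mu X"
proof -
  obtain f where f: "f \<in> hom (Ho V M) X Y" "iso_arr (Ho V M) f"
    using iso unfolding isomorphic_def by blast
  have "\<forall>(I :: nat set) X P inc. finite I \<and> is_coproduct (Ho V M) I X P inc \<longrightarrow>
        (P \<in> W \<longleftrightarrow> (\<forall>i \<in> I. X i \<in> W))"
    using meas unfolding monoidal_measure_def by (elim conjE)
  then show Y: "Y \<in> W"
    using HoC.coproduct_singleton[OF f, of "0::nat"] X by (metis finite.emptyI finite.insertI)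
  have "\<forall>X \<in> W. \<forall>Y \<in> W. isomorphic (Ho V M) X Y \<longrightarrow> mu X = mu Y"
    using meas unfolding monoidal_measure_def by (elim conjE)
  then show "mu Y = mu X" using X Y iso by simp
qed

lemma W_Obj: "X \<in> W \<Longrightarrow> X \<in> Obj V"
  using meas unfolding monoidal_measure_def by (elim conjE) (rule subsetD)

lemma W_unit: "\<one> \<in> W" "mu \<one> = 1"
proof -
  show "\<one> \<in> W" using meas unfolding monoidal_measure_def by (elim conjE)
  show "mu \<one> = 1" using meas unfolding monoidal_measure_def by (elim conjE)
qed

lemma mu_commute:
  assumes "X \<in> W" "Y \<in> W"
  shows "mu X * mu Y = mu Y * mu X"
proof -
  have t: "ho_ten V M X Y \<in> W" "mu (ho_ten V M X Y) = mu X * mu Y" "mu (ho_ten V M Y X) = mu Y * mu X"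
    using meas assms unfolding monoidal_measure_def by blast+
  have "isomorphic (Ho V M) (ho_ten V M X Y) (ho_ten V M Y X)"
    unfolding ho_ten_def
    using isomorphic_Ho[OF product_symmetric[OF cofrep_Obj cofrep_Obj]] W_Obj assms by blast
  then show ?thesis using mu_iso(2)[OF t(1)] t(2,3) by simp
qed

text \<open>The components of \<open>Y\<close> are indexed by numbers, and each is given a point.  The additivity of the
  measure on \<open>Y\<close> is obtained from the identity fibration: a coproduct in \<open>V\<close> need not be one in the
  homotopy category.\<close>

lemma component_decomposition:
  assumes Y: "Y \<in> W" "fibrant V M Y"
  obtains I :: "nat set" and Bc \<gamma> where "finite I"
    "\<forall>i \<in> I. Bc i \<in> W \<and> \<gamma> i \<in> hom V \<one> Y" "mu Y = (\<Sum>i\<in>I. mu (Bc i))"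
    "\<forall>E p F j. p \<in> hom V E Y \<and> p \<in> Fib M \<and> E \<in> W \<and> (\<forall>b F j. is_fiber V p b F j \<longrightarrow> F \<in> W) \<and>
       (\<forall>i \<in> I. is_fiber V p (\<gamma> i) (F i) (j i)) \<longrightarrow> mu E = (\<Sum>i\<in>I. mu (Bc i) * mu (F i))"
proof -
  obtain Xc inc where fin: "finite (pi0 V M Y)" and co: "is_coproduct V (pi0 V M Y) Xc Y inc"
    and comp: "\<forall>x \<in> pi0 V M Y. Xc x \<in> W \<and> connected_obj V M (Xc x) \<and>
       (\<forall>g \<in> hom V \<one> Y. ho g = x \<longrightarrow> (\<exists>h \<in> hom V \<one> (Xc x). inc x \<cdot> h = g))"
    using W3 Y(1) unfolding condW3_def by (drule_tac bspec[OF _ Y(1)]) blast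
  have "\<exists>h. h \<in> hom V \<one> (Xc x)" if x: "x \<in> pi0 V M Y" for x
  proof -
    obtain g where "g \<in> hom V \<one> Y" "x = ho g"
      using point_representable[OF Y(2), of x] x unfolding pi0_def by blast
    then show ?thesis using comp[rule_format, OF x] by blast
  qed
  then obtain h where h: "x \<in> pi0 V M Y \<Longrightarrow> h x \<in> hom V \<one> (Xc x)" for x by metis
  let ?n = "card (pi0 V M Y)"
  obtain e where e: "bij_betw e {0..<?n} (pi0 V M Y)" using ex_bij_betw_nat_finite[OF fin] by blast
  define I where "I = {0..<?n}"
  have eI: "e i \<in> pi0 V M Y" if "i \<in> I" for i using bij_betwE[OF e] that by (simp add: I_def)
  define Bc b where "Bc = (\<lambda>i. Xc (e i))" and "b = (\<lambda>i. h (e i))"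
  define \<gamma> where "\<gamma> i = inc (e i) \<cdot> b i" for i
  have co': "is_coproduct V I Bc Y (\<lambda>i. inc (e i))"
    unfolding Bc_def I_def using coproduct_reindex[OF e co] .
  have inc: "inc (e i) \<in> hom V (Bc i) Y" if "i \<in> I" for i using co' that unfolding is_coproduct_def by blast
  have bi: "b i \<in> hom V \<one> (Bc i)" if "i \<in> I" for i using h[OF eI[OF that]] by (simp add: b_def Bc_def)
  have Bi: "Bc i \<in> W" "connected_obj V M (Bc i)" if "i \<in> I" for i
    using comp eI[OF that] by (simp_all add: Bc_def)
  have fI: "finite I" by (simp add: I_def)
  have \<gamma>: "\<gamma> i \<in> hom V \<one> Y" if "i \<in> I" for i unfolding \<gamma>_def using Cmp_in[OF bi[OF that] inc[OF that]] .
  have total: "\<forall>E p F j. p \<in> hom V E Y \<and> p \<in> Fib M \<and> E \<in> W \<and>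
       (\<forall>b F j. is_fiber V p b F j \<longrightarrow> F \<in> W) \<and> (\<forall>i \<in> I. is_fiber V p (\<gamma> i) (F i) (j i)) \<longrightarrow>
       mu E = (\<Sum>i\<in>I. mu (Bc i) * mu (F i))"
  proof (intro allI impI; elim conjE)
    fix E p F j assume p: "p \<in> hom V E Y" "p \<in> Fib M" "E \<in> W"
      and w: "\<forall>b F j. is_fiber V p b F j \<longrightarrow> F \<in> W" and F: "\<forall>i \<in> I. is_fiber V p (\<gamma> i) (F i) (j i)"
    have "finite I \<and> is_coproduct V I Bc Y (\<lambda>i. inc (e i)) \<and> (\<forall>i \<in> I. connected_obj V M (Bc i) \<and>
        Bc i \<in> W \<and> b i \<in> hom V \<one> (Bc i) \<and> is_fiber V p (inc (e i) \<cdot> b i) (F i) (j i))"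
      using fI co' Bi bi F unfolding \<gamma>_def by simp
    moreover have "p \<in> hom V E Y \<and> p \<in> Fib M \<and> E \<in> W \<and> Y \<in> W \<and> (\<forall>b F j. is_fiber V p b F j \<longrightarrow> F \<in> W)"
      using p w Y(1) by simp
    ultimately show "mu E = (\<Sum>i\<in>I. mu (Bc i) * mu (F i))"
      using pres[unfolded preserves_fibrations_def, rule_format, of p E Y I Bc "\<lambda>i. inc (e i)" b F j]
      by simp
  qed
  note YO = W_Obj[OF Y(1)]
  note one = Ide_in[OF YO]
  have idW: "F \<in> W" if F: "is_fiber V (Ide V Y) c F j" for c F j
  proof -
    have c: "c \<in> hom V \<one> Y" using F one unfolding is_fiber_def by (simp add: hom_def)
    obtain t where "is_pullback V (Ide V Y) c F j t" using F unfolding is_fiber_def by blast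
    then have "isomorphic (Ho V M) \<one> F"
      using isomorphic_Ho[OF pullback_isomorphic[OF pullback_Ide[OF c]]] by blast
    then show ?thesis using mu_iso(1)[OF W_unit(1)] by blast
  qed
  have idF: "is_fiber V (Ide V Y) (\<gamma> i) \<one> (\<gamma> i)" if "i \<in> I" for i
    using pullback_Ide[OF \<gamma>[OF that]] \<gamma>[OF that] homD(3)[OF one] unfolding is_fiber_def by metis
  have idfib: "Ide V Y \<in> Fib M" using iso_tfib[OF one iso_Ide[OF YO]] by blast
  have "mu Y = (\<Sum>i\<in>I. mu (Bc i) * mu \<one>)"
    using total[rule_format, of "Ide V Y" Y "\<lambda>_. \<one>" \<gamma>] one idfib Y(1) idW idF by simp
  then have "mu Y = (\<Sum>i\<in>I. mu (Bc i))" using W_unit(2) by simp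
  then show thesis using that[OF fI _ _ total] Bi(1) \<gamma> by simp
qed

end

subsection \<open>Points and arrows of the category of components\<close>

lemma pi0_cat_hom:
  "f \<in> hom (pi0_cat V M A) a b \<longleftrightarrow>
     (\<exists>x. f = (a, b, x) \<and> a \<in> vobj A \<and> b \<in> vobj A \<and> x \<in> pi0 V M (vhom A a b))"
  by (cases f) (auto simp: pi0_cat_def hom_def)

lemma groupoid_connected_hom:
  assumes G: "is_groupoid C" and Z: "zigzag_connected C" and a: "a \<in> Obj C" "b \<in> Obj C"
  shows "hom C a b \<noteq> {}"
proof -
  interpret category C using G unfolding is_groupoid_def by blast
  have inv: "hom C y x \<noteq> {}" if "hom C x y \<noteq> {}" for x y
    using that G iso_arrE unfolding is_groupoid_def by (metis all_not_in_conv homD(1))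
  have "(a, b) \<in> {(x, y). hom C x y \<noteq> {} \<or> hom C y x \<noteq> {}}\<^sup>*"
    using Z a unfolding zigzag_connected_def by blast
  then show ?thesis
  proof (induction rule: rtrancl_induct)
    case base
    then show ?case using Ide_in[OF a(1)] by blast
  next
    case (step y z)
    then have "hom C y z \<noteq> {}" using inv by blast
    then obtain f g where "f \<in> hom C a y" "g \<in> hom C y z" using step.IH by blast
    then show ?case using Cmp_in by blast
  qed
qed

context vcat_on
begin

lemma equivalence_points:
  assumes fib: "\<forall>x \<in> vobj A. \<forall>y \<in> vobj A. fibrant V M (vhom A x y)"
    and G: "is_groupoid (pi0_cat V M A)" and a: "a \<in> vobj A" and b: "b \<in> vobj A"
    and e: "e \<in> pi0 V M (vhom A a b)"
  obtains u u' where "u \<in> hom V \<one> (vhom A a b)" "u' \<in> hom V \<one> (vhom A b a)" "e = ho u"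
    "ho (act A a b a u' u) = ho (vid A a)" "ho (act A b a b u u') = ho (vid A b)"
proof -
  let ?P = "pi0_cat V M A"
  interpret P: category ?P using G unfolding is_groupoid_def by blast
  have f: "(a, b, e) \<in> hom ?P a b" using a b e by (simp add: pi0_cat_hom)
  have "iso_arr ?P (a, b, e)" using G P.homD(1)[OF f] unfolding is_groupoid_def by blast
  then obtain g where g: "g \<in> hom ?P b a" "g \<cdot>\<^bsub>?P\<^esub> (a, b, e) = Ide ?P a" "(a, b, e) \<cdot>\<^bsub>?P\<^esub> g = Ide ?P b"
    using P.iso_arrE[OF _ f] by metis
  obtain d where d: "g = (b, a, d)" "d \<in> pi0 V M (vhom A b a)" using g(1) unfolding pi0_cat_hom by blast
  obtain u where u: "u \<in> hom V \<one> (vhom A a b)" "e = ho u"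
    using point_representable[OF fib[rule_format, OF a b]] e unfolding pi0_def by blast
  obtain u' where u': "u' \<in> hom V \<one> (vhom A b a)" "d = ho u'"
    using point_representable[OF fib[rule_format, OF b a]] d unfolding pi0_def by blast
  have "ho (act A a b a u' u) = ho (vid A a)" "ho (act A b a b u u') = ho (vid A b)"
    using g(2,3) pi0_comp_points[OF a b a u'(1) u(1)] pi0_comp_points[OF b a b u(1) u'(1)]
    unfolding d(1) u(2) u'(2) by (simp_all add: pi0_cat_def)
  then show thesis using that u u' by blast
qed

text \<open>Apply the comparison of fibers to the functor from \<open>A\<close> to the terminal category, whose fibers on
  hom-objects are the hom-objects themselves.\<close>

lemma isomorphic_if_connected:
  assumes fib: "\<forall>x \<in> vobj A. \<forall>y \<in> vobj A. fibrant V M (vhom A x y)"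
    and G: "is_groupoid (pi0_cat V M A)" and conn: "connected_vcat V M A"
    and a: "a \<in> vobj A" and b: "b \<in> vobj A" and c: "c \<in> vobj A"
  shows "isomorphic (Ho V M) (vhom A b c) (vhom A a c)"
proof -
  let ?T = "terminal_vcat V \<one> :: ('u, 'o, 'm) vcat" and ?F = "to_terminal_vcat V \<one> A"
  have "hom (pi0_cat V M A) a b \<noteq> {}"
    using groupoid_connected_hom[OF G conn[unfolded connected_vcat_def]] a b by (simp add: pi0_cat_def)
  then obtain e where e: "e \<in> pi0 V M (vhom A a b)" unfolding ex_in_conv[symmetric] pi0_cat_hom by blast
  obtain u u' where u: "u \<in> hom V \<one> (vhom A a b)" "u' \<in> hom V \<one> (vhom A b a)"
    and inv: "ho (act A a b a u' u) = ho (vid A a)" "ho (act A b a b u u') = ho (vid A b)"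
    using equivalence_points[OF fib G a b e] by metis
  have F: "is_vfun V ?F" "vsrc ?F = A" "vtgt ?F = ?T"
    using to_terminal_vcat[OF pt_terminal vcat] by (simp_all add: to_terminal_vcat_def)
  have Fh: "vfh ?F x y = bang (vhom A x y)" if "x \<in> vobj A" "y \<in> vobj A" for x y
    using that by (simp add: to_terminal_vcat_def bang_def)
  interpret F: local_fibration V M ?F A ?T
    by unfold_locales (use F Fh fib fibrantD(2) in auto)
  have one: "h = Ide V \<one>" if "h \<in> hom V \<one> \<one>" for h using bang_eq[OF that Ide_in[OF Unit_in]] .
  have hT: "vhom ?T (vfo ?F x) (vfo ?F y) = \<one>" for x y by (simp add: to_terminal_vcat_def terminal_vcat_def)
  have fibre: "is_pullback V (vfh ?F x c) (Ide V \<one>) (vhom A x c) (Ide V (vhom A x c)) (bang (vhom A x c))"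
    if x: "x \<in> vobj A" for x
    unfolding Fh[OF x c] using pullback_commute[OF pullback_Ide[OF bang_in[OF vcatD(1)[OF x c]]]] .
  let ?h = "act ?T (vfo ?F a) (vfo ?F b) (vfo ?F c) (Ide V \<one>) (vfh ?F a b \<cdot> u)"
  have idT: "Ide V \<one> \<in> hom V \<one> (vhom ?T (vfo ?F b) (vfo ?F c))" unfolding hT using Ide_in[OF Unit_in] .
  have "?h \<in> hom V \<one> (vhom ?T (vfo ?F a) (vfo ?F c))"
    using F.B.act_in[OF F.FD(3)[OF a] F.FD(3)[OF b] F.FD(3)[OF c] idT Cmp_in[OF u(1) F.FD(4)[OF a b]]] .
  then have h: "?h = Ide V \<one>" unfolding hT using one by blast
  show ?thesis
    using F.fibers_along_equivalence[OF a b c u inv idT fibre[OF b], unfolded h, OF fibre[OF a]] .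
qed

end

context cartesian_model_category
begin

lemma vfiber_hom:
  assumes p: "is_vfun V p" "vsrc p = E" "vtgt p = B" and x: "x \<in> vobj E" "vfo p x = b" and y: "y \<in> vobj E" "vfo p y = b"
  shows "\<exists>j t. is_pullback V (vfh p x y) (vid B b) (vhom (vfiber V p b) x y) j t"
proof -
  note d = is_vfunD[OF p]
  have b: "b \<in> vobj B" using d(3)[OF x(1)] x(2) by simp
  have f: "vfh p x y \<in> hom V (vhom E x y) (vhom B b b)" using d(4)[OF x(1) y(1)] x y by simp
  have i: "vid B b \<in> hom V \<one> (vhom B b b)" using is_vcatD(3)[OF d(2) b] .
  obtain F j t where "is_pullback V (vfh p x y) (vid B b) F j t" using pullback_exists[OF f i] by blast
  then have "case (F, j, t) of (F, j, t) \<Rightarrow> is_pullback V (vfh p x y) (vid (vtgt p) b) F j t"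
    using p(3) by simp
  then have "case fiber_pb V p b x y of (F, j, t) \<Rightarrow> is_pullback V (vfh p x y) (vid (vtgt p) b) F j t"
    unfolding fiber_pb_def by (rule someI)
  moreover have "vhom (vfiber V p b) x y = fst (fiber_pb V p b x y)"
    using x y p by (simp add: vfiber_def Let_def)
  ultimately show ?thesis using p(3) by (auto split: prod.splits)
qed

lemma vfiber_vobj: "vsrc p = E \<Longrightarrow> vobj (vfiber V p b) = {x \<in> vobj E. vfo p x = b}"
  by (simp add: vfiber_def Let_def)

end

context local_fibration
begin

text \<open>Lift the class of \<open>\<gamma>\<close> to an equivalence \<open>u : x \<rightarrow> x'\<close> and precompose with it.  The point \<open>Fu\<close> is
  only homotopic to \<open>\<gamma>\<close>, but homotopic points have equivalent fibers.\<close>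

theorem fiber_transport:
  assumes iso: "is_isofibration (pi0_cat V M E) (pi0_cat V M B) (vfo F) (pi0_arr V M F)"
    and GE: "is_groupoid (pi0_cat V M E)" and GB: "is_groupoid (pi0_cat V M B)"
    and Bf: "\<forall>x \<in> vobj B. \<forall>y \<in> vobj B. fibrant V M (vhom B x y)"
    and x: "x \<in> vobj E" and b: "b \<in> vobj B" and \<gamma>: "\<gamma> \<in> hom V \<one> (vhom B (vfo F x) b)"
  obtains x' where "x' \<in> vobj E" "vfo F x' = b"
    "\<forall>y G j. y \<in> vobj E \<and> vfo F y = b \<and> is_fiber V (vfh F x y) \<gamma> G j \<longrightarrow>
       isomorphic (Ho V M) (vhom (vfiber V F b) x' y) G"
proof -
  let ?PE = "pi0_cat V M E" and ?PB = "pi0_cat V M B" and ?a = "vfo F x"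
  note a = FD(3)[OF x]
  have g: "(?a, b, ho \<gamma>) \<in> Arr ?PB" using a b ho_in[OF \<gamma>] by (simp add: pi0_cat_def pi0_def)
  moreover have "iso_arr ?PB (?a, b, ho \<gamma>)" using GB g unfolding is_groupoid_def by blast
  moreover have "Dom ?PB (?a, b, ho \<gamma>) = ?a" "x \<in> Obj ?PE" using x by (simp_all add: pi0_cat_def)
  ultimately obtain f where f: "f \<in> Arr ?PE" "Dom ?PE f = x" "pi0_arr V M F f = (?a, b, ho \<gamma>)"
    using iso unfolding is_isofibration_def by metis
  obtain x' e where fe: "f = (x, x', e)" "x' \<in> vobj E" "e \<in> pi0 V M (vhom E x x')"
    using f(1,2) by (auto simp: pi0_cat_def)
  have x'b: "vfo F x' = b" and e\<gamma>: "ho (vfh F x x') \<cdot>\<^bsub>Ho V M\<^esub> e = ho \<gamma>" using f(3) fe(1) by simp_all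
  note x' = fe(2)
  obtain u u' where u: "u \<in> hom V \<one> (vhom E x x')" "u' \<in> hom V \<one> (vhom E x' x)" and eu: "e = ho u"
    and inv: "ho (act E x x' x u' u) = ho (vid E x)" "ho (act E x' x x' u u') = ho (vid E x')"
    using E.equivalence_points[OF _ GE x x' fe(3)] E_fibrant by metis
  let ?g = "vfh F x x' \<cdot> u"
  have pxx: "vfh F x x' \<in> hom V (vhom E x x') (vhom B ?a b)" using FD(4)[OF x x'] x'b by simp
  have g: "?g \<in> hom V \<one> (vhom B ?a b)" using Cmp_in[OF u(1) pxx] .
  have g\<gamma>: "ho ?g = ho \<gamma>" using e\<gamma> eu ho_Cmp[OF u(1) pxx] by simp
  have "isomorphic (Ho V M) (vhom (vfiber V F b) x' y) G"
    if y: "y \<in> vobj E" "vfo F y = b" and G: "is_fiber V (vfh F x y) \<gamma> G j" for y G j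
  proof -
    obtain t where G: "is_pullback V (vfh F x y) \<gamma> G j t" using G unfolding is_fiber_def by blast
    obtain i s where H: "is_pullback V (vfh F x' y) (vid B b) (vhom (vfiber V F b) x' y) i s"
      using vfiber_hom[OF F x' x'b y] by blast
    have pxy: "vfh F x y \<in> hom V (vhom E x y) (vhom B ?a b)" using FD(4)[OF x y(1)] y by simp
    obtain K k r where K: "is_pullback V (vfh F x y) ?g K k r" using pullback_exists[OF pxy g] by blast
    have e: "act B ?a (vfo F x') (vfo F y) (vid B b) ?g = ?g"
      using B.act_vid_left[OF a b g] x'b y by simp
    have i: "vid B b \<in> hom V \<one> (vhom B (vfo F x') (vfo F y))" using B.vcatD(3)[OF b] x'b y by simp
    have "isomorphic (Ho V M) (vhom (vfiber V F b) x' y) K"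
      using fibers_along_equivalence[OF x x' y(1) u inv i H, unfolded e, OF K] .
    moreover have "isomorphic (Ho V M) K G"
      using fibers_over_homotopic_points[OF Bf[rule_format, OF a b] g \<gamma> g\<gamma> F_Fib[OF x y(1)] K G] .
    ultimately show ?thesis using HoC.isomorphic_trans by blast
  qed
  then show thesis using that x' x'b by blast
qed

end

text \<open>The Euler characteristic of \<open>B\<close> is inverse to the common measure \<open>\<beta>\<close> of its hom-objects, and
  \<open>\<chi>(B)\<close> times a weighting of the fiber, extended by zero, is a weighting of \<open>E\<close>.\<close>

theorem (in measured_category) euler_char_fibration:
  assumes p: "is_vfun V p" "vsrc p = E" "vtgt p = B"
    and pF: "\<And>x y. x \<in> vobj E \<Longrightarrow> y \<in> vobj E \<Longrightarrow> vfh p x y \<in> Fib M"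
    and Ef: "\<And>x y. x \<in> vobj E \<Longrightarrow> y \<in> vobj E \<Longrightarrow> fibrant V M (vhom E x y)"
    and Bf: "\<forall>x \<in> vobj B. \<forall>y \<in> vobj B. fibrant V M (vhom B x y)"
    and iso: "is_isofibration (pi0_cat V M E) (pi0_cat V M B) (vfo p) (pi0_arr V M p)"
    and GE: "is_groupoid (pi0_cat V M E)" and GB: "is_groupoid (pi0_cat V M B)"
    and conn: "connected_vcat V M B"
    and chiE: "admits_euler_char W mu E" and chiB: "admits_euler_char W mu B"
    and b: "b \<in> vobj B" and chiF: "admits_euler_char W mu (vfiber V p b)"
  shows "euler_char mu E = euler_char mu B * euler_char mu (vfiber V p b)"
proof -
  interpret p: local_fibration V M p E B by unfold_locales (fact p pF Ef)+
  let ?F = "vfiber V p b" and ?\<beta> = "mu (vhom B b b)" and ?\<chi> = "euler_char mu B"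
  have meas_hom: "vhom A x y \<in> W" if "admits_euler_char W mu A" "x \<in> vobj A" "y \<in> vobj A"
    for A :: "('a, 'o, 'm) vcat" and x y
    using that unfolding admits_euler_char_def measurable_vcat_def by blast
  note Wm = meas_hom[OF chiE] meas_hom[OF chiB] meas_hom[OF chiF]
  have first: "mu (vhom B a c) = mu (vhom B b c)" if "a \<in> vobj B" "c \<in> vobj B" for a c
    using mu_iso(2)[OF Wm(2)[OF b that(2)] p.B.isomorphic_if_connected[OF Bf GB conn that(1) b that(2)]] .
  obtain wB vB where wB: "is_weighting mu B wB" and vB: "is_coweighting mu B vB" and finB: "finite (vobj B)"
    using chiB unfolding admits_euler_char_def by blast
  have left: "?\<chi> * mu (vhom B b c) = 1" if c: "c \<in> vobj B" for c
  proof -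
    have "?\<chi> * mu (vhom B b c) = (\<Sum>a\<in>vobj B. vB a * mu (vhom B b c))"
      using euler_char_eq(2)[OF chiB vB] by (simp add: sum_distrib_right)
    also have "\<dots> = (\<Sum>a\<in>vobj B. vB a * mu (vhom B a c))"
      using first[OF _ c] by (intro sum.cong) simp_all
    also have "\<dots> = 1" using vB c unfolding is_coweighting_def by blast
    finally show ?thesis .
  qed
  \<comment> \<open>The columns agree because all of them have the left inverse \<open>\<chi>(B)\<close> and commute.\<close>
  have all: "mu (vhom B a c) = ?\<beta>" if a: "a \<in> vobj B" and c: "c \<in> vobj B" for a c
  proof -
    have "mu (vhom B b c) = (?\<chi> * ?\<beta>) * mu (vhom B b c)" using left[OF b] by simp
    also have "\<dots> = (?\<chi> * mu (vhom B b c)) * ?\<beta>"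
      using mu_commute[OF Wm(2)[OF b b] Wm(2)[OF b c]] by (simp add: mult.assoc)
    also have "\<dots> = ?\<beta>" using left[OF c] by simp
    finally show ?thesis using first[OF a c] by simp
  qed
  have right: "?\<beta> * ?\<chi> = 1"
  proof -
    have "?\<beta> * ?\<chi> = (\<Sum>c\<in>vobj B. ?\<beta> * wB c)"
      using euler_char_eq(1)[OF chiB wB] by (simp add: sum_distrib_left)
    also have "\<dots> = (\<Sum>c\<in>vobj B. mu (vhom B b c) * wB c)" using all[OF b] by (intro sum.cong) simp_all
    also have "\<dots> = 1" using wB b unfolding is_weighting_def by blast
    finally show ?thesis .
  qed
  have comm: "mu X * ?\<chi> = ?\<chi> * mu X" if "X \<in> W" for X
  proof -
    have "mu X * ?\<chi> = (?\<chi> * ?\<beta>) * (mu X * ?\<chi>)" using left[OF b] by simp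
    also have "\<dots> = ?\<chi> * ((?\<beta> * mu X) * ?\<chi>)" by (simp add: mult.assoc)
    also have "\<dots> = ?\<chi> * ((mu X * ?\<beta>) * ?\<chi>)" using mu_commute[OF Wm(2)[OF b b] that] by simp
    also have "\<dots> = ?\<chi> * mu X" using right by (simp add: mult.assoc)
    finally show ?thesis .
  qed
  obtain wF where wF: "is_weighting mu ?F wF" using chiF unfolding admits_euler_char_def by blast
  have Fo: "vobj ?F = {x \<in> vobj E. vfo p x = b}" using vfiber_vobj[OF p(2)] .
  have finE: "finite (vobj E)" using chiE unfolding admits_euler_char_def by blast
  define w where "w y = (if vfo p y = b then ?\<chi> * wF y else 0)" for y
  have restrict: "(\<Sum>y\<in>vobj E. h y * w y) = (\<Sum>y\<in>vobj ?F. h y * (?\<chi> * wF y))" for h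
  proof -
    have "(\<Sum>y\<in>vobj E. h y * w y) = (\<Sum>y\<in>vobj ?F. h y * w y)"
      unfolding Fo by (rule sum.mono_neutral_right) (use finE in \<open>auto simp: w_def\<close>)
    also have "\<dots> = (\<Sum>y\<in>vobj ?F. h y * (?\<chi> * wF y))"
      by (rule sum.cong) (simp_all add: Fo w_def)
    finally show ?thesis .
  qed
  have "is_weighting mu E w"
    unfolding is_weighting_def
  proof
    fix x assume x: "x \<in> vobj E"
    let ?a = "vfo p x"
    note a = p.FD(3)[OF x]
    obtain I :: "nat set" and Bc \<gamma> where I: "finite I"
      and Bc: "\<forall>i \<in> I. Bc i \<in> W \<and> \<gamma> i \<in> hom V \<one> (vhom B ?a b)"
      and sumB: "mu (vhom B ?a b) = (\<Sum>i\<in>I. mu (Bc i))"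
      and sumE: "\<forall>D q G j. q \<in> hom V D (vhom B ?a b) \<and> q \<in> Fib M \<and> D \<in> W \<and>
         (\<forall>b F j. is_fiber V q b F j \<longrightarrow> F \<in> W) \<and> (\<forall>i \<in> I. is_fiber V q (\<gamma> i) (G i) (j i)) \<longrightarrow>
         mu D = (\<Sum>i\<in>I. mu (Bc i) * mu (G i))"
      using component_decomposition[OF Wm(2)[OF a b] Bf[rule_format, OF a b]] .
    have \<gamma>: "\<gamma> i \<in> hom V \<one> (vhom B ?a b)" if "i \<in> I" for i using Bc that by blast
    have "\<exists>x'. x' \<in> vobj ?F \<and> (\<forall>y \<in> vobj ?F. \<forall>G j. is_fiber V (vfh p x y) g G j \<longrightarrow>
        isomorphic (Ho V M) (vhom ?F x' y) G)" if g: "g \<in> hom V \<one> (vhom B ?a b)" for g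
    proof -
      obtain x' where x': "x' \<in> vobj E" "vfo p x' = b"
        and t: "\<forall>y G j. y \<in> vobj E \<and> vfo p y = b \<and> is_fiber V (vfh p x y) g G j \<longrightarrow>
          isomorphic (Ho V M) (vhom ?F x' y) G"
        using p.fiber_transport[OF iso GE GB Bf x b g] .
      then show ?thesis unfolding Fo by (intro exI[of _ x']) simp
    qed
    then obtain tr where tr: "g \<in> hom V \<one> (vhom B ?a b) \<Longrightarrow> tr g \<in> vobj ?F"
      and tr_iso: "g \<in> hom V \<one> (vhom B ?a b) \<Longrightarrow> y \<in> vobj ?F \<Longrightarrow> is_fiber V (vfh p x y) g G j \<Longrightarrow>
        isomorphic (Ho V M) (vhom ?F (tr g) y) G" for g y G j by metis
    have E_sum: "mu (vhom E x y) = (\<Sum>i\<in>I. mu (Bc i) * mu (vhom ?F (tr (\<gamma> i)) y))" if y: "y \<in> vobj ?F" for y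
    proof -
      have yE: "y \<in> vobj E" "vfo p y = b" using y Fo by auto
      have q: "vfh p x y \<in> hom V (vhom E x y) (vhom B ?a b)" using p.FD(4)[OF x yE(1)] yE(2) by simp
      have W: "G \<in> W \<and> mu G = mu (vhom ?F (tr g) y)" if "is_fiber V (vfh p x y) g G j" for g G j
      proof -
        have g: "g \<in> hom V \<one> (vhom B ?a b)" using that q unfolding is_fiber_def by (simp add: hom_def)
        show ?thesis using mu_iso[OF Wm(3)[OF tr[OF g] y] tr_iso[OF g y that]] by simp
      qed
      have "\<exists>G j. is_fiber V (vfh p x y) (\<gamma> i) G j" if "i \<in> I" for i
        using pullback_exists[OF q \<gamma>[OF that]] \<gamma>[OF that] homD(3)[OF q] unfolding is_fiber_def by metis
      then obtain G j where G: "\<And>i. i \<in> I \<Longrightarrow> is_fiber V (vfh p x y) (\<gamma> i) (G i) (j i)" by metis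
      have "mu (vhom E x y) = (\<Sum>i\<in>I. mu (Bc i) * mu (G i))"
        using sumE[rule_format, of "vfh p x y" "vhom E x y" G j] q pF[OF x yE(1)] Wm(1)[OF x yE(1)] G W
        by blast
      also have "\<dots> = (\<Sum>i\<in>I. mu (Bc i) * mu (vhom ?F (tr (\<gamma> i)) y))"
        using W[OF G] by (intro sum.cong) simp_all
      finally show ?thesis .
    qed
    have "(\<Sum>y\<in>vobj E. mu (vhom E x y) * w y) = (\<Sum>y\<in>vobj ?F. mu (vhom E x y) * (?\<chi> * wF y))"
      by (rule restrict)
    also have "\<dots> = (\<Sum>y\<in>vobj ?F. \<Sum>i\<in>I. mu (Bc i) * ?\<chi> * (mu (vhom ?F (tr (\<gamma> i)) y) * wF y))"
    proof (rule sum.cong[OF HOL.refl])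
      fix y assume y: "y \<in> vobj ?F"
      have "mu (Bc i) * mu (vhom ?F (tr (\<gamma> i)) y) * (?\<chi> * wF y) =
          mu (Bc i) * ?\<chi> * (mu (vhom ?F (tr (\<gamma> i)) y) * wF y)" if i: "i \<in> I" for i
      proof -
        have "mu (Bc i) * mu (vhom ?F (tr (\<gamma> i)) y) * (?\<chi> * wF y) =
            mu (Bc i) * (mu (vhom ?F (tr (\<gamma> i)) y) * ?\<chi>) * wF y" by (simp add: mult.assoc)
        also have "\<dots> = mu (Bc i) * (?\<chi> * mu (vhom ?F (tr (\<gamma> i)) y)) * wF y"
          using comm[OF Wm(3)[OF tr[OF \<gamma>[OF i]] y]] by simp
        finally show ?thesis by (simp add: mult.assoc)
      qed
      then show "mu (vhom E x y) * (?\<chi> * wF y) =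
          (\<Sum>i\<in>I. mu (Bc i) * ?\<chi> * (mu (vhom ?F (tr (\<gamma> i)) y) * wF y))"
        unfolding E_sum[OF y] sum_distrib_right by (intro sum.cong) simp_all
    qed
    also have "\<dots> = (\<Sum>i\<in>I. mu (Bc i) * ?\<chi> * (\<Sum>y\<in>vobj ?F. mu (vhom ?F (tr (\<gamma> i)) y) * wF y))"
      by (subst sum.swap) (simp add: sum_distrib_left)
    also have "\<dots> = (\<Sum>i\<in>I. mu (Bc i) * ?\<chi>)"
      using wF tr[OF \<gamma>] unfolding is_weighting_def by (intro sum.cong) simp_all
    also have "\<dots> = mu (vhom B ?a b) * ?\<chi>" unfolding sumB by (simp add: sum_distrib_right)
    also have "\<dots> = 1" using all[OF a b] right by simp
    finally show "(\<Sum>y\<in>vobj E. mu (vhom E x y) * w y) = 1" .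
  qed
  then have "euler_char mu E = (\<Sum>y\<in>vobj E. w y)" using euler_char_eq(1)[OF chiE] by blast
  also have "\<dots> = (\<Sum>y\<in>vobj ?F. ?\<chi> * wF y)" using restrict[of "\<lambda>_. 1"] by simp
  also have "\<dots> = ?\<chi> * euler_char mu ?F"
    using euler_char_eq(1)[OF chiF wF] by (simp add: sum_distrib_left)
  finally show ?thesis .
qed

theorem theorem1p1:
  fixes V :: "('o, 'm) moncat" and M :: "'m model"
    and W :: "'o set" and mu :: "'o \<Rightarrow> 'k::{ring, monoid_mult}"
    and K :: "('u, 'o, 'm) vfun model"
  assumes universe: "infinite (UNIV :: 'u set)"
    and base: "monoidal_model_category TYPE('u) V M"
    and meas: "monoidal_measure V M W mu"
    and canonical: "canonical_model_structure V M K"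
  shows
    "(\<forall>A B f. f \<in> hom (VCat V) A B \<and> f \<in> Weq K \<and>
        finite (vobj A) \<and> measurable_vcat W A \<and> finite (vobj B) \<and> measurable_vcat W B \<and>
        (admits_euler_char W mu A \<or> admits_euler_char W mu B) \<longrightarrow>
        admits_euler_char W mu A \<and> admits_euler_char W mu B \<and>
        euler_char mu A = euler_char mu B)
     \<and>
     (preserves_fibrations V M W mu \<and> condV1 V M \<and> condV2 V M \<and>
      condW1 TYPE('u) V \<and> condW2 V M W \<and> condW3 V M W \<longrightarrow>
      (\<forall>E B p. p \<in> hom (VCat V) E B \<and> naive_fibration V M p \<and>
         fibrant (VCat V) K E \<and> fibrant (VCat V) K B \<and>
         admits_euler_char W mu E \<and> admits_euler_char W mu B \<and>
         (\<forall>b \<in> vobj B. admits_euler_char W mu (vfiber V p b)) \<and>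
         is_groupoid (pi0_cat V M E) \<and> is_groupoid (pi0_cat V M B) \<and>
         connected_vcat V M B \<longrightarrow>
         (\<forall>b \<in> vobj B. euler_char mu E = euler_char mu B * euler_char mu (vfiber V p b))))"
proof -
  interpret model_structure V M using base unfolding monoidal_model_category_def model_category_def by blast
  interpret monoidal_category V using base unfolding monoidal_model_category_def closed_monoidal_def by blast
  have complete: "small_complete TYPE('u) V"
    using base unfolding monoidal_model_category_def model_category_def by blast
  interpret canonical_vcat V M K
    by unfold_locales (fact canonical universe terminal_exists[OF universe complete])+
  show ?thesis
  proof (intro conjI allI impI ballI; elim conjE)
    fix A B :: "('u, 'o, 'm) vcat" and f
    assume "f \<in> hom (VCat V) A B" "f \<in> Weq K" "finite (vobj A)" "measurable_vcat W A" "finite (vobj B)"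
      "measurable_vcat W B" "admits_euler_char W mu A \<or> admits_euler_char W mu B"
    note e = euler_char_Weq[OF meas this]
    show "admits_euler_char W mu A" "admits_euler_char W mu B" "euler_char mu A = euler_char mu B"
      using e by blast+
  next
    fix E B :: "('u, 'o, 'm) vcat" and p b
    assume pres: "preserves_fibrations V M W mu" and V1: "condV1 V M" and W3: "condW3 V M W"
      and p: "p \<in> hom (VCat V) E B" and nf: "naive_fibration V M p"
      and Ef: "fibrant (VCat V) K E" and Bf: "fibrant (VCat V) K B"
      and chi: "admits_euler_char W mu E" "admits_euler_char W mu B"
        "\<forall>b\<in>vobj B. admits_euler_char W mu (vfiber V p b)"
      and G: "is_groupoid (pi0_cat V M E)" "is_groupoid (pi0_cat V M B)"
      and conn: "connected_vcat V M B" and b: "b \<in> vobj B"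
    interpret measured_category V M W mu
    proof unfold_locales
      show "is_terminal V \<one>\<^bsub>V\<^esub>" "cofibrant V M \<one>\<^bsub>V\<^esub>" using V1 unfolding condV1_def by blast+
      show "closed_monoidal V" "pushout_product_axiom V M"
        using base unfolding monoidal_model_category_def by blast+
      show "\<exists>P r q. is_pullback V f g P r q" if "f \<in> hom V a c" "g \<in> hom V b c" for f a c g b
        using pullback_exists_if_complete[OF universe complete that] .
    qed (fact V1 meas pres W3)+
    have pv: "is_vfun V p" "vsrc p = E" "vtgt p = B" using p by (simp_all add: VCat_hom)
    have isof: "is_isofibration (pi0_cat V M E) (pi0_cat V M B) (vfo p) (pi0_arr V M p)"
      using nf unfolding naive_fibration_def pv by blast
    have pF: "vfh p x y \<in> Fib M" if "x \<in> vobj E" "y \<in> vobj E" for x y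
      using nf that unfolding naive_fibration_def pv by blast
    have fE: "fibrant V M (vhom E x y)" if "x \<in> vobj E" "y \<in> vobj E" for x y
      using Ef fibrant_vcat_iff[OF K.hom_Obj(1)[OF p]] that by blast
    have fB: "\<forall>x \<in> vobj B. \<forall>y \<in> vobj B. fibrant V M (vhom B x y)"
      using Bf fibrant_vcat_iff[OF K.hom_Obj(2)[OF p]] by blast
    show "euler_char mu E = euler_char mu B * euler_char mu (vfiber V p b)"
      using euler_char_fibration[OF pv pF fE fB isof G conn chi(1,2) b chi(3)[rule_format, OF b]] .
  qed
qed

end
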